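(* Let $S$ be a compact metric space, $\nu_0$ a probability measure on $S$, $\theta>0$ and $\beta>0$. For any $f$ in $B_+(S)$, let $\tilde{T}_f(\Gamma_{\theta,\nu_0}^{\beta})$ and $\tilde{\Gamma}_{\theta,\nu_0}^{\beta}$ be the respective image laws of $T_f(\Gamma_{\theta,\nu_0}^{\beta})$ and $\Gamma_{\theta,\nu_0}^{\beta}$ under the map $\mathcal{J}$. Then $\tilde{T}_f(\Gamma_{\theta,\nu_0}^{\beta})$ and $\tilde{\Gamma}_{\theta,\nu_0}^{\beta}$ are mutually absolutely continuous and $$\frac{d\,\tilde{T}_f(\Gamma_{\theta,\nu_0}^{\beta})}{d\,\tilde{\Gamma}_{\theta,\nu_0}^{\beta}}(\mathbf{x})=\exp\{-\theta\langle\nu_0,\log f\rangle\}\;E^{\nu_0^\infty}\Big[\exp\Big\{-\sum_{i=1}^\infty\beta^{-1}\big(f^{-1}(\xi_i)-1\big)x_i\Big\}\Big],$$ where $\mathbf{x}=(x_1,x_2,\ldots)$ and under $E^{\nu_0^\infty}$ the variables $\xi_1,\xi_2,\ldots$ are i.i.d. with distribution $\nu_0$.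
   Context: $B_+(S)$ is the collection of positive Borel measurable functions on $S$ with strictly positive lower bound; $f^{-1}=1/f$; $\langle\mu,g\rangle=\int g\,d\mu$. $M(S)$ is the space of finite nonnegative measures on $S$ with the weak topology. For $f\in B_+(S)$ and $\mu\in M(S)$, $T_f(\mu)(ds)=f(s)\mu(ds)$, and $T_f(\Gamma_{\theta,\nu_0}^{\beta})$ denotes the image law of $\Gamma_{\theta,\nu_0}^{\beta}$ under $T_f$. The gamma process with shape parameter $\theta\nu_0$ and scale parameter $\beta$ is the random measure $\beta\sum_{i\ge1}\gamma_i(\theta)\delta_{\xi_i}$, where $\gamma_1(\theta)>\gamma_2(\theta)>\cdots$ are the points of the inhomogeneous Poisson point process on $(0,\infty)$ with mean measure $\theta x^{-1}e^{-x}dx$ and, independently, $\xi_1,\xi_2,\ldots$ are i.i.d. with common distribution $\nu_0$. Its law is $\Gamma^{\beta}_{\theta,\nu_0}$. $M_a(S)=\{\sum_{i=1}^\infty x_i\delta_{\xi_i}:\xi_i\in S,\ x_i\ge0,\ 0<\sum_{i=1}^\infty x_i<\infty\}$ is the space of nonnegative finite atomic measures on $S$, with the subspace topology of $M(S)$, and $\mathbb{R}_+^{\downarrow}=\{\mathbf{x}=(x_1,x_2,\ldots):x_1\ge x_2\ge\cdots\ge0,\ \sum_{i=1}^\infty x_i<\infty\}$. The (measurable) map $\mathcal{J}:M_a(S)\to\mathbb{R}_+^{\downarrow}$ sends $\nu=\sum_{i=1}^\infty y_i\delta_{\xi_i}$ to $\mathbf{x}$, which is $(y_1,y_2,\ldots)$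 arranged in descending order.
   Formalization: Assumes log f is ν₀-integrable (otherwise T_f(μ) has infinite mass a.s.). The claim for 𝒥 on measures is for ν₀ without atoms (the formula fails for some ν₀ with atoms); for every ν₀ it is proved for the masses of the labelled sums in descending order, coinciding locations not merged. *)

theory Defs
  imports "HOL-Probability.Probability"
begin

subsection \<open>Finite measures with the weak topology\<close>

definition fin_measures :: "'a::metric_space measure set" where
  "fin_measures = {\<mu>. sets \<mu> = sets borel \<and> finite_measure \<mu>}"

definition weak_topology :: "'a::metric_space measure topology" where
  "weak_topology = topology_generated_by
     {{\<mu> \<in> fin_measures. (\<integral>s. g s \<partial>\<mu>) \<in> U} | (g :: 'a \<Rightarrow> real) U.
        continuous_on UNIV g \<and> bounded (range g) \<and> open U}"

definition weak_borel :: "'a::metric_space measure measure" where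
  "weak_borel = sigma fin_measures {U. openin weak_topology U}"

text \<open>Random measures below are finite only almost surely; on the exceptional null set they are
  replaced by the zero measure, so that they are maps into \<^const>\<open>fin_measures\<close>.\<close>

definition fin_or_zero :: "'a::metric_space measure \<Rightarrow> 'a measure" where
  "fin_or_zero \<mu> = (if finite_measure \<mu> then \<mu> else null_measure borel)"

definition B_plus :: "('a::metric_space \<Rightarrow> real) set" where
  "B_plus = {f. f \<in> borel_measurable borel \<and> (\<exists>c>0. \<forall>s. c \<le> f s)}"

definition T_map :: "('a::metric_space \<Rightarrow> real) \<Rightarrow> 'a measure \<Rightarrow> 'a measure" where
  "T_map f \<mu> = fin_or_zero (density \<mu> (\<lambda>s. ennreal (f s)))"

subsection \<open>Atomic measures and their masses in descending order\<close>

text \<open>The measure $\sum_i x_i \delta_{\xi_i}$, as the image under $\xi$ of the measure on the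
  index set giving mass $x_i$ to $i$.\<close>

definition atomic :: "(nat \<Rightarrow> real) \<Rightarrow> (nat \<Rightarrow> 'a::metric_space) \<Rightarrow> 'a measure" where
  "atomic x \<xi> = distr (density (count_space UNIV) (\<lambda>i. ennreal (x i))) borel \<xi>"

definition M_a :: "'a::metric_space measure set" where
  "M_a = {atomic x \<xi> | x \<xi>. (\<forall>i. 0 \<le> x i) \<and> summable x \<and> 0 < (\<Sum>i. x i)}"

definition R_down :: "(nat \<Rightarrow> real) set" where
  "R_down = {x. decseq x \<and> (\<forall>i. 0 \<le> x i) \<and> summable x}"

abbreviation R_down_space :: "(nat \<Rightarrow> real) measure" where
  "R_down_space \<equiv> restrict_space borel R_down"

text \<open>Descending rearrangement: every positive value occurs as often in the result as in \<open>y\<close>.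
  An infinite \<open>y\<close> cannot in general be sorted by a permutation of its indices, because zero
  entries may be interspersed among infinitely many positive ones.  The positive level sets of
  a summable \<open>y\<close> are finite, so \<^const>\<open>card\<close> is meaningful; other \<open>y\<close>
  are sent to the zero sequence.\<close>

definition descending :: "(nat \<Rightarrow> real) \<Rightarrow> nat \<Rightarrow> real" where
  "descending y =
     (if (\<forall>i. 0 \<le> y i) \<and> summable y
      then (THE x. x \<in> R_down \<and> (\<forall>t>0. card {i. x i = t} = card {i. y i = t}))
      else (\<lambda>_. 0))"

text \<open>The masses of $\nu = \sum_i y_i \delta_{\xi_i}$ are determined by $\nu$ only if the locations
  carrying positive mass are distinct; every element of \<^const>\<open>M_a\<close> has such a
  representation.\<close>

definition J_map :: "'a::metric_space measure \<Rightarrow> nat \<Rightarrow> real" where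
  "J_map \<nu> = (THE x. \<exists>y \<xi>. (\<forall>i. 0 \<le> y i) \<and> summable y \<and> inj_on \<xi> {i. 0 < y i} \<and>
                      \<nu> = atomic y \<xi> \<and> x = descending y)"

text \<open>Image under \<^const>\<open>J_map\<close> of a law on \<^const>\<open>weak_borel\<close> that is concentrated on
  \<^const>\<open>M_a\<close>; restricting to \<^const>\<open>M_a\<close> gives the Borel sets of the subspace topology.\<close>

definition J_image :: "'a::metric_space measure measure \<Rightarrow> (nat \<Rightarrow> real) measure" where
  "J_image L = distr (restrict_space L M_a) R_down_space J_map"

subsection \<open>The gamma process\<close>

definition num_points :: "(nat \<Rightarrow> 'w \<Rightarrow> real) \<Rightarrow> real set \<Rightarrow> 'w \<Rightarrow> ennreal" where
  "num_points X B \<omega> = emeasure (count_space UNIV) {i. X i \<omega> \<in> B}"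

definition poisson_points :: "'w measure \<Rightarrow> real measure \<Rightarrow> (nat \<Rightarrow> 'w \<Rightarrow> real) \<Rightarrow> bool" where
  "poisson_points P \<Lambda> X \<longleftrightarrow>
     (\<forall>i. X i \<in> borel_measurable P) \<and>
     (\<forall>B \<in> sets borel. emeasure \<Lambda> B < \<infinity> \<longrightarrow>
        (\<forall>k::nat. measure P {\<omega> \<in> space P. num_points X B \<omega> = of_nat k}
                   = exp (- measure \<Lambda> B) * measure \<Lambda> B ^ k / fact k)) \<and>
     (\<forall>B \<in> sets borel. emeasure \<Lambda> B = \<infinity> \<longrightarrow> (AE \<omega> in P. num_points X B \<omega> = \<infinity>)) \<and>
     (\<forall>n (B :: nat \<Rightarrow> real set). (\<forall>j<n. B j \<in> sets borel) \<and> disjoint_family_on B {..<n} \<longrightarrow>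
        prob_space.indep_vars P (\<lambda>_. borel) (\<lambda>j. num_points X (B j)) {..<n})"

definition gamma_intensity :: "real \<Rightarrow> real measure" where
  "gamma_intensity \<theta> = density lborel (\<lambda>x. indicator {0<..} x * ennreal (\<theta> * exp (- x) / x))"

definition gamma_points :: "'w measure \<Rightarrow> real \<Rightarrow> (nat \<Rightarrow> 'w \<Rightarrow> real) \<Rightarrow> bool" where
  "gamma_points P \<theta> \<gamma> \<longleftrightarrow>
     poisson_points P (gamma_intensity \<theta>) \<gamma> \<and>
     (AE \<omega> in P. \<forall>i. 0 < \<gamma> i \<omega> \<and> \<gamma> (Suc i) \<omega> < \<gamma> i \<omega>)"

definition iid :: "'w measure \<Rightarrow> 'a::metric_space measure \<Rightarrow> (nat \<Rightarrow> 'w \<Rightarrow> 'a) \<Rightarrow> bool" where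
  "iid P \<nu>\<^sub>0 \<xi> \<longleftrightarrow>
     prob_space.indep_vars P (\<lambda>_. borel) \<xi> UNIV \<and> (\<forall>i. distr P borel (\<xi> i) = \<nu>\<^sub>0)"

text \<open>Independence of two sequences whose values have different types, as independence of the
  \<open>\<sigma>\<close>-algebras they generate.\<close>

definition indep_sequences ::
  "'w measure \<Rightarrow> (nat \<Rightarrow> 'w \<Rightarrow> 'b::topological_space) \<Rightarrow> (nat \<Rightarrow> 'w \<Rightarrow> 'c::topological_space) \<Rightarrow> bool" where
  "indep_sequences P X Y \<longleftrightarrow>
     prob_space.indep_set P
       (sets (vimage_algebra (space P) (\<lambda>\<omega> i. X i \<omega>) (\<Pi>\<^sub>M i\<in>UNIV. borel)))
       (sets (vimage_algebra (space P) (\<lambda>\<omega> i. Y i \<omega>) (\<Pi>\<^sub>M i\<in>UNIV. borel)))"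

definition gamma_setup ::
  "'w measure \<Rightarrow> real \<Rightarrow> 'a::metric_space measure \<Rightarrow> (nat \<Rightarrow> 'w \<Rightarrow> real) \<Rightarrow> (nat \<Rightarrow> 'w \<Rightarrow> 'a) \<Rightarrow> bool" where
  "gamma_setup P \<theta> \<nu>\<^sub>0 \<gamma> \<xi> \<longleftrightarrow>
     prob_space P \<and> gamma_points P \<theta> \<gamma> \<and> iid P \<nu>\<^sub>0 \<xi> \<and> indep_sequences P \<gamma> \<xi>"

text \<open>The law of $\beta \sum_i \gamma_i \delta_{\xi_i}$.\<close>

definition gamma_law ::
  "'w measure \<Rightarrow> real \<Rightarrow> (nat \<Rightarrow> 'w \<Rightarrow> real) \<Rightarrow> (nat \<Rightarrow> 'w \<Rightarrow> 'a::metric_space) \<Rightarrow> 'a measure measure" where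
  "gamma_law P \<beta> \<gamma> \<xi> = distr P weak_borel
     (\<lambda>\<omega>. fin_or_zero (scale_measure (ennreal \<beta>) (atomic (\<lambda>i. \<gamma> i \<omega>) (\<lambda>i. \<xi> i \<omega>))))"

text \<open>The descending masses when the summands are kept apart even if some locations coincide.
  If \<open>\<nu>\<^sub>0\<close> has no atoms the locations are almost surely distinct, and these are the images
  under \<^const>\<open>J_map\<close> of the gamma law and of its transform under \<^const>\<open>T_map\<close>.\<close>

definition labelled_law :: "'w measure \<Rightarrow> real \<Rightarrow> (nat \<Rightarrow> 'w \<Rightarrow> real) \<Rightarrow> (nat \<Rightarrow> real) measure" where
  "labelled_law P \<beta> \<gamma> = distr P R_down_space (\<lambda>\<omega>. descending (\<lambda>i. \<beta> * \<gamma> i \<omega>))"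

definition labelled_T_law ::
  "'w measure \<Rightarrow> ('a \<Rightarrow> real) \<Rightarrow> real \<Rightarrow> (nat \<Rightarrow> 'w \<Rightarrow> real) \<Rightarrow> (nat \<Rightarrow> 'w \<Rightarrow> 'a::metric_space)
     \<Rightarrow> (nat \<Rightarrow> real) measure" where
  "labelled_T_law P f \<beta> \<gamma> \<xi> =
     distr P R_down_space (\<lambda>\<omega>. descending (\<lambda>i. f (\<xi> i \<omega>) * (\<beta> * \<gamma> i \<omega>)))"

definition gamma_density ::
  "real \<Rightarrow> real \<Rightarrow> 'a::metric_space measure \<Rightarrow> ('a \<Rightarrow> real) \<Rightarrow> (nat \<Rightarrow> real) \<Rightarrow> real" where
  "gamma_density \<theta> \<beta> \<nu>\<^sub>0 f x =
     exp (- \<theta> * (\<integral>s. ln (f s) \<partial>\<nu>\<^sub>0)) *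
     (\<integral>\<xi>. exp (- (\<Sum>i. inverse \<beta> * (inverse (f (\<xi> i)) - 1) * x i)) \<partial>(\<Pi>\<^sub>M i\<in>(UNIV::nat set). \<nu>\<^sub>0))"

end

theory Submission
  imports Defs
begin

text \<open>
  The marked process $\sum_i \delta_{(\gamma_i, \xi_i)}$ is Poisson with intensity
  $\theta x^{-1} e^{-x} dx\, \nu_0(ds)$, so $E \exp(-\sum_i \phi(\gamma_i, \xi_i)) =
  \exp(-\int\!\int (1 - e^{-\phi}))$ for every measurable $\phi \ge 0$.  The claimed density is itself an
  average over fresh marks, hence both sides of the claim, tested against
  $\exp(-\sum_i \phi(x_i))$, are values of this functional.  Weighting both laws with
  $\exp(-\sum_i x_i / \beta)$ makes the exponents nonnegative even where $1/f - 1 < 0$: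
  they become $\phi(\beta f(s) x) + f(s) x$ and $\phi(\beta x) + x / f(s)$, and the substitution
  $x \mapsto x / f(s)$ with the Frullani integral
  $\int_0^\infty (e^{-x/a} - e^{-x}) x^{-1} dx = \ln a$ shows that the two functionals differ by the factor
  $\exp(-\theta \langle \nu_0, \ln f\rangle)$.  Finally, Laplace functionals determine the law of a
  descending sequence, and if $\nu_0$ has no atoms the locations are almost surely distinct, so that
  \<^const>\<open>J_map\<close> recovers the labelled masses.
\<close>

section \<open>Sequences and their descending rearrangement\<close>

text \<open>The density averages over marks that the masses do not reveal, so no change of measure
  is written down pathwise; comparing Laplace functionals replaces it. All of these live in
  \<open>ennreal\<close> with a total version of exp(-x), so divergent sums and infinite exponents
  need no separate treatment. Integrability of \<open>ln f\<close> governs the total mass of the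
  transformed measure: as \<open>f\<close> is bounded below, it is equivalent to finiteness of the
  integral of ln(1 + f), which is the Laplace exponent of that mass up to the factor \<theta>. If
  \<open>\<nu>\<^sub>0\<close> has an atom, several points may share a location and
  \<open>J_map\<close> sees only their sum, which is not a point of the process. This is why the
  labelled laws carry the argument and the transfer to \<open>J_map\<close> is made for atomless
  \<open>\<nu>\<^sub>0\<close>. A separate obstacle is measurability: \<open>descending\<close> and
  \<open>J_map\<close> are defined by unique choice. Both are controlled by the number of masses
  above a threshold, which is a series for sequences and an integral for measures.\<close>

lemma finite_ge_summable:
  fixes y :: "nat \<Rightarrow> real"
  assumes "summable y" "0 < t"
  shows "finite {i. t \<le> y i}"
proof -
  have "y \<longlonglongrightarrow> 0" using assms(1) by (rule summable_LIMSEQ_zero)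
  then have "eventually (\<lambda>i. y i < t) sequentially"
    using assms(2) by (rule order_tendstoD)
  then obtain N where "\<And>i. i \<ge> N \<Longrightarrow> y i < t" by (auto simp: eventually_sequentially)
  then have "{i. t \<le> y i} \<subseteq> {..<N}" by (auto simp: not_le[symmetric])
  then show ?thesis by (rule finite_subset) simp
qed

text \<open>Finite level sets of equal size can be matched by bijections, one for each positive value.\<close>

lemma suminf_eq_of_levels:
  fixes x y :: "nat \<Rightarrow> real" and \<phi> :: "real \<Rightarrow> ennreal"
  assumes fin: "\<And>t. 0 < t \<Longrightarrow> finite {i. x i = t}" "\<And>t. 0 < t \<Longrightarrow> finite {i. y i = t}"
    and card: "\<And>t. 0 < t \<Longrightarrow> card {i. x i = t} = card {i. y i = t}"
    and nonneg: "\<And>i. 0 \<le> x i" "\<And>i. 0 \<le> y i" and "\<phi> 0 = 0"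
  shows "(\<Sum>i. \<phi> (x i)) = (\<Sum>i. \<phi> (y i))"
proof -
  have "\<forall>t. \<exists>b. 0 < t \<longrightarrow> bij_betw b {i. x i = t} {i. y i = t}"
    using fin card by (meson finite_same_card_bij)
  then obtain b where b: "\<And>t. 0 < t \<Longrightarrow> bij_betw (b t) {i. x i = t} {i. y i = t}" by metis
  define h where "h i = b (x i) i" for i
  have yh: "y (h i) = x i" if "0 < x i" for i
    using bij_betwE[OF b[OF that]] by (auto simp: h_def)
  have "bij_betw h {i. 0 < x i} {i. 0 < y i}"
  proof (rule bij_betw_imageI)
    show "inj_on h {i. 0 < x i}"
    proof (rule inj_onI)
      fix i j assume ij: "i \<in> {i. 0 < x i}" "j \<in> {i. 0 < x i}" "h i = h j"
      then have "x i = x j" using yh by (metis mem_Collect_eq)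
      then show "i = j" using ij bij_betw_imp_inj_on[OF b[of "x i"]]
        by (auto simp: h_def inj_on_def)
    qed
    show "h ` {i. 0 < x i} = {i. 0 < y i}"
    proof (intro equalityI subsetI)
      fix j assume "j \<in> {i. 0 < y i}"
      then have "0 < y j" by simp
      then have "j \<in> b (y j) ` {i. x i = y j}" using bij_betw_imp_surj_on[OF b] by auto
      then obtain i where "x i = y j" "j = b (x i) i" by (metis (mono_tags, lifting) imageE mem_Collect_eq)
      then show "j \<in> h ` {i. 0 < x i}" using \<open>0 < y j\<close> by (intro image_eqI[of _ _ i]) (auto simp: h_def)
    qed (auto simp: yh)
  qed
  then have "(\<integral>\<^sup>+i. \<phi> (y (h i)) \<partial>count_space {i. 0 < x i})
      = (\<integral>\<^sup>+i. \<phi> (y i) \<partial>count_space {i. 0 < y i})"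
    by (rule nn_integral_bij_count_space)
  moreover have "(\<integral>\<^sup>+i. \<phi> (y (h i)) \<partial>count_space {i. 0 < x i})
      = (\<integral>\<^sup>+i. \<phi> (x i) \<partial>count_space {i. 0 < x i})"
    by (rule nn_integral_cong) (simp add: yh)
  \<comment> \<open>The two sequences may differ in their number of zero entries; these are
    discarded by the hypothesis that \<phi> vanishes at 0.\<close>
  moreover have "(\<integral>\<^sup>+i. \<phi> (z i) \<partial>count_space {i. 0 < z i}) = (\<Sum>i. \<phi> (z i))"
    if "\<And>i. 0 \<le> z i" for z :: "nat \<Rightarrow> real"
  proof -
    have "(\<integral>\<^sup>+i. \<phi> (z i) \<partial>count_space {i. 0 < z i})
      = (\<integral>\<^sup>+i. \<phi> (z i) * indicator {i. 0 < z i} i \<partial>count_space UNIV)"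
      by (rule nn_integral_count_space_indicator) simp
    also have "\<dots> = (\<integral>\<^sup>+i. \<phi> (z i) \<partial>count_space UNIV)"
      by (rule nn_integral_cong)
         (metis assms(6) indicator_simps(1,2) mem_Collect_eq mult.right_neutral mult_zero_right
             order_le_imp_less_or_eq that)
    finally show ?thesis by (simp add: nn_integral_count_space_nat)
  qed
  ultimately show ?thesis using nonneg by simp
qed

section \<open>Counts above a threshold and sorting\<close>

text \<open>A series of indicators rather than a cardinality: measurability in \<open>y\<close> is
  immediate, and infinitely many entries give the value \<infinity> instead of a default.\<close>

definition count_above :: "real \<Rightarrow> (nat \<Rightarrow> real) \<Rightarrow> ennreal" where
  "count_above t y = (\<Sum>i. indicator {t<..} (y i))"

lemma count_above_eq_emeasure:
  "count_above t y = emeasure (count_space UNIV) {i. t < y i}"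
proof -
  have "count_above t y = (\<integral>\<^sup>+i. indicator {i. t < y i} i \<partial>count_space UNIV)"
    unfolding count_above_def nn_integral_count_space_nat
    by (intro arg_cong[where f = suminf]) (auto split: split_indicator)
  then show ?thesis by simp
qed

lemma count_above_lessThan: "{i. t < y i} = {..<n} \<Longrightarrow> count_above t y = of_nat n"
  by (simp add: count_above_eq_emeasure)

lemma of_nat_less_count_above_iff:
  "of_nat n < count_above t y \<longleftrightarrow> (\<exists>F. finite F \<and> card F = Suc n \<and> (\<forall>i\<in>F. t < y i))"
proof (cases "finite {i. t < y i}")
  case True
  have "of_nat n < count_above t y \<longleftrightarrow> n < card {i. t < y i}"
    by (simp add: count_above_eq_emeasure True)
  also have "\<dots> \<longleftrightarrow> (\<exists>F. finite F \<and> card F = Suc n \<and> (\<forall>i\<in>F. t < y i))"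
  proof
    assume "n < card {i. t < y i}"
    then obtain F where "F \<subseteq> {i. t < y i}" "card F = Suc n"
      using obtain_subset_with_card_n[of "Suc n"] by (metis Suc_leI)
    then show "\<exists>F. finite F \<and> card F = Suc n \<and> (\<forall>i\<in>F. t < y i)"
      by (intro exI[of _ F]) (auto intro: card_ge_0_finite)
  next
    assume "\<exists>F. finite F \<and> card F = Suc n \<and> (\<forall>i\<in>F. t < y i)"
    then obtain F where F: "card F = Suc n" "F \<subseteq> {i. t < y i}" by blast
    then show "n < card {i. t < y i}" using card_mono[OF True F(2)] by simp
  qed
  finally show ?thesis .
next
  case False
  then have "count_above t y = \<infinity>" by (simp add: count_above_eq_emeasure)
  moreover obtain F where "finite F" "card F = Suc n" "F \<subseteq> {i. t < y i}"
    using infinite_arbitrarily_large[OF False] by metis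
  ultimately show ?thesis by (auto simp: of_nat_less_top)
qed

text \<open>In a decreasing sequence the indices of the entries above \<open>t\<close> form an
  initial segment, so \<open>n\<close> lies in it exactly when it has more than \<open>n\<close>
  elements. Coordinates thereby become statements about counts, which do not depend on the order of
  the entries.\<close>

lemma decseq_less_iff_count_above:
  assumes "decseq x"
  shows "t < x n \<longleftrightarrow> of_nat n < count_above t x"
proof
  assume "t < x n"
  then have "\<forall>i\<in>{..n}. t < x i" using assms by (auto intro: less_le_trans dest: decseqD)
  then show "of_nat n < count_above t x"
    unfolding of_nat_less_count_above_iff by (intro exI[of _ "{..n}"]) auto
next
  assume "of_nat n < count_above t x"
  then obtain F where F: "finite F" "card F = Suc n" "\<forall>i\<in>F. t < x i"
    unfolding of_nat_less_count_above_iff by blast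
  have "\<not> F \<subseteq> {..<n}" using card_mono[of "{..<n}" F] F by auto
  then obtain i where "i \<in> F" "n \<le> i" by (meson lessThan_iff not_less subsetI)
  then show "t < x n" using F(3) decseqD[OF assms \<open>n \<le> i\<close>] by fastforce
qed

lemma R_down_levels_unique:
  assumes "x \<in> R_down" "x' \<in> R_down" "\<And>t. 0 < t \<Longrightarrow> card {i. x i = t} = card {i. x' i = t}"
  shows "x = x'"
proof -
  have fin: "finite {i. z i = t}" if "z \<in> R_down" "0 < t" for z t
    using that by (intro finite_subset[OF _ finite_ge_summable[of z t]]) (auto simp: R_down_def)
  have eq: "count_above t x = count_above t x'" if "0 \<le> t" for t
    unfolding count_above_def
    by (rule suminf_eq_of_levels) (use assms fin that in \<open>auto simp: R_down_def\<close>)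
  have less: "t < x n \<longleftrightarrow> t < x' n" if "0 \<le> t" for t n
    using eq[OF that] assms decseq_less_iff_count_above by (auto simp: R_down_def)
  \<comment> \<open>The equivalence is used at the two thresholds \<open>x n\<close> and
    \<open>x' n\<close>, which are nonnegative; each excludes one strict inequality.\<close>
  have "x n = x' n" for n
    using less[of "x n" n] less[of "x' n" n] assms by (auto simp: R_down_def)
  then show ?thesis by auto
qed

text \<open>The sorted sequence is the generalized inverse of the counting function
  \<open>count_above\<close>, as a quantile function is of a distribution function. It needs no
  sorting permutation, and the last conclusion is what later gives measurability.\<close>

lemma ex_descending:
  fixes y :: "nat \<Rightarrow> real"
  assumes y: "\<And>i. 0 \<le> y i" "summable y"
  obtains x where "x \<in> R_down" "\<And>t. 0 < t \<Longrightarrow> card {i. x i = t} = card {i. y i = t}"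
    "\<And>t n. 0 \<le> t \<Longrightarrow> t < x n \<longleftrightarrow> of_nat n < count_above t y"
proof -
  define A where "A n = {t. 0 \<le> t \<and> count_above t y \<le> of_nat n}" for n
  define d where "d n = Inf (A n)" for n
  have bdd: "bdd_below (A n)" for n by (auto simp: A_def bdd_below_def)
  define K where "K = suminf y"
  have K: "y i \<le> K" "0 \<le> K" for i
    using sum_le_suminf[OF y(2), of "{i}"] y(1) suminf_nonneg[OF y(2) y(1)] by (simp_all add: K_def)
  have KA: "K \<in> A n" for n
  proof -
    have "{i. K < y i} = {..<0}" using K(1) by (auto simp: not_less)
    from count_above_lessThan[OF this] show ?thesis using K by (simp add: A_def)
  qed
  have less: "t < d n \<longleftrightarrow> of_nat n < count_above t y" if "0 \<le> t" for t n
  proof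
    assume "t < d n"
    then have "t \<notin> A n" unfolding d_def using cInf_lower[OF _ bdd, of t n] by auto
    then show "of_nat n < count_above t y" using that by (auto simp: A_def)
  next
    assume "of_nat n < count_above t y"
    then obtain F where F: "finite F" "card F = Suc n" "\<forall>i\<in>F. t < y i"
      unfolding of_nat_less_count_above_iff by blast
    then have "F \<noteq> {}" by auto
    \<comment> \<open>The \<open>n + 1\<close> entries above \<open>t\<close> have a minimum still
      above \<open>t\<close>, and no threshold below this minimum belongs to \<open>A n\<close>.
      Hence the strict inequality survives the infimum.\<close>
    have "Min (y ` F) \<le> s" if "s \<in> A n" for s
    proof (rule ccontr)
      assume "\<not> Min (y ` F) \<le> s"
      then have "\<forall>i\<in>F. s < y i"
        using F(1) by (meson Min_le finite_imageI imageI not_le order_less_le_trans)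
      then have "of_nat n < count_above s y"
        unfolding of_nat_less_count_above_iff using F by blast
      then show False using that by (auto simp: A_def)
    qed
    then have "Min (y ` F) \<le> d n" unfolding d_def using KA[of n] by (intro cInf_greatest) auto
    moreover have "t < Min (y ` F)" using F \<open>F \<noteq> {}\<close> by auto
    ultimately show "t < d n" by simp
  qed
  have A_ne: "A n \<noteq> {}" for n using KA[of n] by blast
  have A_nn: "0 \<le> t" if "t \<in> A n" for t n using that by (simp add: A_def)
  have d0: "0 \<le> d n" for n unfolding d_def by (rule cInf_greatest[OF A_ne A_nn])
  have dec: "decseq d"
  proof (rule decseq_SucI)
    fix n
    have "A n \<subseteq> A (Suc n)"
    proof
      fix t assume "t \<in> A n"
      then show "t \<in> A (Suc n)"
        using order_trans[of "count_above t y" "of_nat n" "of_nat (Suc n)"]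
          of_nat_mono[of n "Suc n", where 'a = ennreal]
        unfolding A_def mem_Collect_eq by linarith
    qed
    then show "d (Suc n) \<le> d n" unfolding d_def by (rule cInf_superset_mono[OF A_ne bdd])
  qed
  have count: "count_above t d = count_above t y" if "0 \<le> t" for t
  proof -
    have less_iff: "of_nat n < count_above t d \<longleftrightarrow> of_nat n < count_above t y" for n
      using decseq_less_iff_count_above[OF dec, of t n] less[OF that, of n] by simp
    \<comment> \<open>The two counts exceed the same natural numbers. If they differed, the smaller
      one would be finite, hence itself a natural number exceeded by only one of them.\<close>
    have nat: "\<exists>n. count_above t z = of_nat n" if "count_above t z < count_above t z'" for z z'
    proof (cases "finite {i. t < z i}")
      case True
      then show ?thesis using emeasure_count_space_finite[OF subset_UNIV True]
        unfolding count_above_eq_emeasure by blast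
    next
      case False
      then show ?thesis using that emeasure_count_space_infinite[OF subset_UNIV False]
        unfolding count_above_eq_emeasure by simp
    qed
    show ?thesis
    proof (rule ccontr)
      assume "count_above t d \<noteq> count_above t y"
      then consider "count_above t d < count_above t y" | "count_above t y < count_above t d"
        by (meson linorder_less_linear)
      then show False
      proof cases
        case 1
        then obtain n where "count_above t d = of_nat n" using nat by blast
        with 1 less_iff[of n] show False by (simp only: less_irrefl)
      next
        case 2
        then obtain n where "count_above t y = of_nat n" using nat by blast
        with 2 less_iff[of n] show False by (simp only: less_irrefl)
      qed
    qed
  qed
  have fin: "finite {i. t < d i}" "finite {i. t < y i}" "card {i. t < d i} = card {i. t < y i}"
    if "0 < t" for t
  proof -
    show fy: "finite {i. t < y i}"
      by (rule finite_subset[OF _ finite_ge_summable[OF y(2) that]]) auto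
    have eq: "emeasure (count_space UNIV) {i. t < d i} = of_nat (card {i. t < y i})"
      using count[OF less_imp_le[OF that]] emeasure_count_space_finite[OF subset_UNIV fy]
      by (simp only: count_above_eq_emeasure)
    show fd: "finite {i. t < d i}"
    proof (rule ccontr)
      assume "infinite {i. t < d i}"
      from emeasure_count_space_infinite[OF subset_UNIV this] eq show False
        by (simp only: infinity_ennreal_def ennreal_of_nat_neq_top)
    qed
    show "card {i. t < d i} = card {i. t < y i}"
      using eq emeasure_count_space_finite[OF subset_UNIV fd] by (simp only: of_nat_eq_iff)
  qed
  have levels: "card {i. d i = t} = card {i. y i = t}" if "0 < t" for t
  proof -
    \<comment> \<open>The aim is a positive threshold \<open>t' < t\<close> with no value of either
      sequence strictly between \<open>t'\<close> and \<open>t\<close>; the level \<open>t\<close>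
      is then a difference of two counts. Only finitely many values exceed \<open>t / 2\<close>, and
      \<open>t / 2\<close> itself is added so that the maximum exists and is positive.\<close>
    define V where "V = insert (t / 2) (({d i |i. t / 2 < d i} \<union> {y i |i. t / 2 < y i}) \<inter> {..<t})"
    have "finite V" unfolding V_def using fin(1,2)[of "t / 2"] that
      by (intro finite.insertI finite_Int disjI1 finite_UnI) (simp_all add: Setcompr_eq_image)
    define t' where "t' = Max V"
    have V: "z \<le> t'" if "z \<in> V" for z unfolding t'_def by (rule Max_ge[OF \<open>finite V\<close> that])
    have "t' \<in> V" unfolding t'_def by (rule Max_in[OF \<open>finite V\<close>]) (auto simp: V_def)
    then have t': "t / 2 \<le> t'" "t' < t" using that V[of "t / 2"] by (auto simp: V_def)
    have le: "d i \<le> t'" if "d i < t" for i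
    proof (cases "t / 2 < d i")
      case True
      then show ?thesis using that by (intro V) (auto simp: V_def)
    qed (use t' in simp)
    have le': "y i \<le> t'" if "y i < t" for i
    proof (cases "t / 2 < y i")
      case True
      then show ?thesis using that by (intro V) (auto simp: V_def)
    qed (use t' in simp)
    have *: "card {i. z i = t} = card {i. t' < z i} - card {i. t < z i}"
      if "\<And>i. z i < t \<Longrightarrow> z i \<le> t'" "finite {i. t < z i}" for z :: "nat \<Rightarrow> real"
    proof -
      have "z i = t \<longleftrightarrow> t' < z i \<and> \<not> t < z i" for i using that(1)[of i] t' by linarith
      then have "{i. z i = t} = {i. t' < z i} - {i. t < z i}" by auto
      moreover have "{i. t < z i} \<subseteq> {i. t' < z i}" using t' by auto
      ultimately show ?thesis using that(2) by (simp only: card_Diff_subset)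
    qed
    have "0 < t'" using t' that by linarith
    show ?thesis
      using *[OF le fin(1)[OF that]] *[OF le' fin(2)[OF that]] fin(3)[OF that] fin(3)[OF \<open>0 < t'\<close>]
      by (simp only:)
  qed
  have "(\<Sum>i. ennreal (d i)) = (\<Sum>i. ennreal (y i))"
  proof (rule suminf_eq_of_levels)
    fix t :: real assume "0 < t"
    show "finite {i. d i = t}" "finite {i. y i = t}"
      by (rule finite_subset[OF _ fin(1)[of "t / 2"]], use \<open>0 < t\<close> in auto)
        (rule finite_subset[OF _ fin(2)[of "t / 2"]], use \<open>0 < t\<close> in auto)
  qed (use levels d0 y in auto)
  then have "(\<Sum>i. ennreal (d i)) \<noteq> top"
    using suminf_ennreal2[OF y] by simp
  then have "summable d" by (rule summable_suminf_not_top[OF d0])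
  then have "d \<in> R_down" using dec d0 by (auto simp: R_down_def)
  then show thesis using that levels less by blast
qed

lemma
  fixes y :: "nat \<Rightarrow> real"
  assumes y: "\<And>i. 0 \<le> y i" "summable y"
  shows descending_in_R_down_summable: "descending y \<in> R_down"
    and card_descending: "0 < t \<Longrightarrow> card {i. descending y i = t} = card {i. y i = t}"
    and less_descending_iff: "0 \<le> t \<Longrightarrow> t < descending y n \<longleftrightarrow> of_nat n < count_above t y"
proof -
  obtain x where x: "x \<in> R_down" "\<And>t. 0 < t \<Longrightarrow> card {i. x i = t} = card {i. y i = t}"
    "\<And>t n. 0 \<le> t \<Longrightarrow> t < x n \<longleftrightarrow> of_nat n < count_above t y"
    using ex_descending[OF y] by blast
  have "descending y = x"
  proof -
    have "(THE x. x \<in> R_down \<and> (\<forall>t>0. card {i. x i = t} = card {i. y i = t})) = x"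
    proof (rule the_equality)
      show "x \<in> R_down \<and> (\<forall>t>0. card {i. x i = t} = card {i. y i = t})" using x(1,2) by blast
    next
      fix z assume z: "z \<in> R_down \<and> (\<forall>t>0. card {i. z i = t} = card {i. y i = t})"
      show "z = x"
      proof (rule R_down_levels_unique)
        fix t :: real assume "0 < t"
        with z x(2) show "card {i. z i = t} = card {i. x i = t}" by metis
      qed (use z x(1) in blast)+
    qed
    then show ?thesis unfolding descending_def by (subst if_P) (use y in blast)+
  qed
  then show "descending y \<in> R_down" "0 < t \<Longrightarrow> card {i. descending y i = t} = card {i. y i = t}"
    "0 \<le> t \<Longrightarrow> t < descending y n \<longleftrightarrow> of_nat n < count_above t y"
    by (simp_all only: x)
qed

lemma descending_not_summable:
  "\<not> ((\<forall>i. 0 \<le> y i) \<and> summable y) \<Longrightarrow> descending y = (\<lambda>_. 0)"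
  unfolding descending_def by (rule if_not_P)

lemma descending_in_R_down: "descending y \<in> R_down"
proof (cases "(\<forall>i. 0 \<le> y i) \<and> summable y")
  case False
  then show ?thesis by (simp add: descending_not_summable) (simp add: R_down_def decseq_def)
qed (auto intro: descending_in_R_down_summable)

lemma descending_id: "x \<in> R_down \<Longrightarrow> descending x = x"
  by (rule R_down_levels_unique[OF descending_in_R_down])
     (simp_all add: R_down_def card_descending)

lemma suminf_descending:
  fixes \<phi> :: "real \<Rightarrow> ennreal"
  assumes y: "\<And>i. 0 \<le> y i" "summable y" and "\<phi> 0 = 0"
  shows "(\<Sum>i. \<phi> (descending y i)) = (\<Sum>i. \<phi> (y i))"
proof -
  have fin: "finite {i. z i = t}" if "summable z" "0 < t" for z :: "nat \<Rightarrow> real" and t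
    using that by (intro finite_subset[OF _ finite_ge_summable[of z t]]) auto
  show ?thesis
    by (rule suminf_eq_of_levels)
       (use fin y card_descending[OF y] descending_in_R_down[of y] assms(3) in \<open>auto simp: R_down_def\<close>)
qed

section \<open>Measurability of the rearrangement\<close>

lemma sets_borel_seq: "sets (borel :: (nat \<Rightarrow> real) measure) = sets (\<Pi>\<^sub>M i\<in>UNIV. borel)"
  by (rule sets_PiM_equal_borel[symmetric])

lemma space_R_down_space [simp]: "space R_down_space = R_down"
  by (simp add: space_restrict_space)

lemma measurable_coordinate: "(\<lambda>x. x i) \<in> borel_measurable (borel :: (nat \<Rightarrow> real) measure)"
  by (rule borel_measurable_continuous_onI) (rule continuous_on_product_coordinates)

lemma measurable_R_down_coordinate: "(\<lambda>x. x i) \<in> borel_measurable R_down_space"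
  by (rule measurable_restrict_space1) (rule measurable_coordinate)

lemma measurable_to_R_downI:
  assumes "\<And>w. w \<in> space M \<Longrightarrow> X w \<in> R_down" "\<And>n. (\<lambda>w. X w n) \<in> borel_measurable M"
  shows "X \<in> measurable M R_down_space"
proof (rule measurable_restrict_space2)
  show "X \<in> space M \<rightarrow> R_down" using assms by auto
  have "X \<in> measurable M (\<Pi>\<^sub>M i\<in>UNIV. borel)"
    using assms(2) by (intro measurable_PiM_single') auto
  then show "X \<in> borel_measurable M" by (simp cong: measurable_cong_sets add: sets_borel_seq)
qed

text \<open>The unique choice in \<open>descending\<close> gives no handle on measurability, but the
  event that entry \<open>n\<close> exceeds \<open>t\<close> is a count condition. The clause for
  negative \<open>t\<close> and the conditions of nonnegativity and summability account for the
  default zero sequence.\<close>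

lemma measurable_descending:
  assumes [measurable]: "\<And>n. (\<lambda>w. Y w n) \<in> borel_measurable M"
  shows "(\<lambda>w. descending (Y w)) \<in> measurable M R_down_space"
proof (rule measurable_to_R_downI)
  fix n
  have eq: "t < descending (Y w) n \<longleftrightarrow>
      (t < 0 \<or> ((\<forall>i. 0 \<le> Y w i) \<and> (\<Sum>i. ennreal (Y w i)) < \<infinity> \<and> of_nat n < count_above t (Y w)))"
    for t w
  proof (cases "t < 0")
    case True
    have "0 \<le> descending (Y w) n" using descending_in_R_down by (auto simp: R_down_def)
    then show ?thesis using True by auto
  next
    case False
    show ?thesis
    proof (cases "\<forall>i. 0 \<le> Y w i")
      case True
      have s: "summable (Y w) \<longleftrightarrow> (\<Sum>i. ennreal (Y w i)) < \<infinity>"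
      proof
        assume "summable (Y w)"
        then have "(\<Sum>i. ennreal (Y w i)) = ennreal (suminf (Y w))"
          using True by (intro suminf_ennreal2) blast+
        then show "(\<Sum>i. ennreal (Y w i)) < \<infinity>" by (simp only: ennreal_less_top infinity_ennreal_def)
      next
        assume "(\<Sum>i. ennreal (Y w i)) < \<infinity>"
        then have "(\<Sum>i. ennreal (Y w i)) \<noteq> top" by (simp only: infinity_ennreal_def less_top)
        then show "summable (Y w)" by (rule summable_suminf_not_top[rotated]) (use True in blast)
      qed
      show ?thesis
      proof (cases "summable (Y w)")
        case sm: True
        show ?thesis using less_descending_iff[of "Y w" t n] s sm True False
          unfolding not_less by (metis (no_types, lifting) not_less)
      next
        case sm: False
        show ?thesis using sm s True False descending_not_summable[of "Y w"] by simp
      qed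
    next
      case F: False
      then show ?thesis using False descending_not_summable[of "Y w"] by simp
    qed
  qed
  show "(\<lambda>w. descending (Y w) n) \<in> borel_measurable M"
    unfolding borel_measurable_iff_greater eq count_above_def by measurable
qed (rule descending_in_R_down)

section \<open>Laplace functionals of Poisson and marked point processes\<close>

text \<open>The function exp(-x) extended continuously by the value 0 at \<infinity>, so that
  Laplace functionals of possibly divergent sums are always defined.\<close>

definition nexp :: "ennreal \<Rightarrow> ennreal" where
  "nexp x = (if x = top then 0 else ennreal (exp (- enn2real x)))"

lemma nexp_top [simp]: "nexp top = 0"
  by (simp add: nexp_def)

lemma nexp_ennreal: "0 \<le> r \<Longrightarrow> nexp (ennreal r) = ennreal (exp (- r))"
  by (simp add: nexp_def)

lemma nexp_0 [simp]: "nexp 0 = 1"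
  by (simp add: nexp_def)

lemma nexp_add: "nexp (x + y) = nexp x * nexp y"
proof (cases "x = top \<or> y = top")
  case False
  then obtain a b where "0 \<le> a" "x = ennreal a" "0 \<le> b" "y = ennreal b"
    by (metis ennreal_cases)
  then show ?thesis
    by (simp add: nexp_ennreal ennreal_plus[symmetric] ennreal_mult[symmetric] exp_add[symmetric] del: ennreal_plus)
qed auto

lemma nexp_sum: "finite I \<Longrightarrow> nexp (sum f I) = (\<Prod>i\<in>I. nexp (f i))"
  by (induction rule: finite_induct) (simp_all add: nexp_add)

lemma nexp_of_nat_mult: "nexp (a * of_nat k) = nexp a ^ k"
  by (induction k) (simp_all add: nexp_add algebra_simps)

lemma nexp_le_1 [simp]: "nexp x \<le> 1"
  by (cases x) (simp_all add: nexp_ennreal)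

lemma nexp_less_top [simp]: "nexp x < top"
  by (simp add: nexp_def)

lemma nexp_neq_top [simp]: "nexp x \<noteq> top"
  by (simp add: nexp_def)

lemma nexp_antimono: "x \<le> y \<Longrightarrow> nexp y \<le> nexp x"
proof (cases "y = top")
  case False
  assume "x \<le> y"
  with False obtain a b where "0 \<le> a" "x = ennreal a" "0 \<le> b" "y = ennreal b" "a \<le> b"
    by (metis ennreal_cases ennreal_le_iff top.extremum_unique)
  then show ?thesis by (simp add: nexp_ennreal)
qed simp

lemma nexp_less_1: "x \<noteq> 0 \<Longrightarrow> nexp x < 1"
  by (cases x) (simp_all add: nexp_ennreal ennreal_less_one_iff)

lemma nexp_pos: "x \<noteq> top \<Longrightarrow> 0 < nexp x"
  by (simp add: nexp_def)

lemma measurable_nexp [measurable]: "nexp \<in> borel_measurable borel"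
  unfolding nexp_def[abs_def] by measurable

lemma tendsto_nexp:
  fixes f :: "'b \<Rightarrow> ennreal"
  assumes "(f \<longlongrightarrow> x) F"
  shows "((\<lambda>i. nexp (f i)) \<longlongrightarrow> nexp x) F"
proof (cases "x = top")
  case False
  then obtain r where r: "0 \<le> r" "x = ennreal r" by (metis ennreal_cases)
  have "eventually (\<lambda>i. f i < top) F"
    by (rule order_tendstoD(2)[OF assms]) (simp add: r)
  then have "eventually (\<lambda>i. ennreal (exp (- enn2real (f i))) = nexp (f i)) F"
    by eventually_elim (simp add: nexp_def)
  moreover have "((\<lambda>i. ennreal (exp (- enn2real (f i)))) \<longlongrightarrow> ennreal (exp (- r))) F"
    using assms r by (intro tendsto_ennrealI tendsto_exp tendsto_minus tendsto_enn2real) simp_all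
  ultimately have "((\<lambda>i. nexp (f i)) \<longlongrightarrow> ennreal (exp (- r))) F"
    by (rule Lim_transform_eventually[rotated])
  then show ?thesis using r by (simp only: nexp_ennreal)
next
  case True
  show ?thesis
  proof (rule order_tendstoI)
    fix a assume "a < nexp x"
    then show "eventually (\<lambda>i. a < nexp (f i)) F" using True by simp
  next
    fix a assume "nexp x < a"
    then have "0 < a" using True by simp
    then obtain c where c: "0 < c" "c < a" using dense by blast
    then obtain b where b: "0 < b" "ennreal b < a" by (cases c) auto
    \<comment> \<open>The absolute value keeps \<open>K\<close> nonnegative also when
      \<open>b\<close> exceeds 1, since \<open>ennreal\<close> would truncate a negative number to
      0.\<close>
    define K where "K = \<bar>ln b\<bar>"
    have "exp (- K) \<le> b" using b(1) exp_le_cancel_iff[of "- K" "ln b"] by (simp add: K_def)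
    have "eventually (\<lambda>i. ennreal K < f i) F"
      using order_tendstoD(1)[OF assms] True by simp
    then show "eventually (\<lambda>i. nexp (f i) < a) F"
    proof eventually_elim
      case (elim i)
      then have "nexp (f i) \<le> nexp (ennreal K)" by (intro nexp_antimono) simp
      also have "\<dots> \<le> ennreal b" using \<open>exp (- K) \<le> b\<close> by (simp add: nexp_ennreal K_def ennreal_leI)
      finally show ?case using b(2) by simp
    qed
  qed
qed

text \<open>A right inverse of \<^const>\<open>nexp\<close> on $[0,1]$: it turns the product of the marginal expectations over
  independent marks back into an exponential of a sum.\<close>

definition nlog :: "ennreal \<Rightarrow> ennreal" where
  "nlog z = (if z = 0 then top else ennreal (- ln (enn2real z)))"

lemma nexp_nlog: "z \<le> 1 \<Longrightarrow> nexp (nlog z) = z"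
proof (cases z)
  case (real r)
  assume "z \<le> 1"
  then have "r \<le> 1" using real by simp
  then show ?thesis using real
    by (cases "r = 0") (simp_all add: nlog_def nexp_ennreal)
qed (simp add: top_unique)

lemma measurable_nlog [measurable]: "nlog \<in> borel_measurable borel"
  unfolding nlog_def[abs_def] by measurable

section \<open>Laplace functionals of Poisson points\<close>

lemma num_points_eq_suminf: "num_points X B w = (\<Sum>i. indicator B (X i w))"
proof -
  have "num_points X B w = (\<integral>\<^sup>+i. indicator {i. X i w \<in> B} i \<partial>count_space UNIV)"
    unfolding num_points_def by simp
  also have "\<dots> = (\<integral>\<^sup>+i. indicator B (X i w) \<partial>count_space UNIV)"
    by (rule nn_integral_cong) (simp split: split_indicator)
  finally show ?thesis by (simp add: nn_integral_count_space_nat)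
qed

text \<open>The probability generating function of the Poisson law with mean \<open>m\<close>,
  evaluated at \<open>z\<close>.\<close>

lemma ennreal_power_exp_suminf:
  fixes z m :: real
  assumes "0 \<le> z" "0 \<le> m"
  shows "(\<Sum>k. ennreal z ^ k * ennreal (exp (- m) * m ^ k / fact k)) = ennreal (exp (- ((1 - z) * m)))"
proof -
  have "(\<lambda>k. exp (- m) * ((z * m) ^ k /\<^sub>R fact k)) sums (exp (- m) * exp (z * m))"
    by (intro sums_mult exp_converges)
  then have "(\<lambda>k. exp (- m) * ((z * m) ^ k /\<^sub>R fact k)) sums (exp (- ((1 - z) * m)))"
    by (simp add: exp_add[symmetric] algebra_simps)
  then have "(\<Sum>k. ennreal (exp (- m) * ((z * m) ^ k /\<^sub>R fact k))) = ennreal (exp (- ((1 - z) * m)))"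
    using assms by (intro suminf_ennreal_eq) auto
  moreover have "ennreal z ^ k * ennreal (exp (- m) * m ^ k / fact k)
      = ennreal (exp (- m) * ((z * m) ^ k /\<^sub>R fact k))" for k
    using assms by (simp add: ennreal_power ennreal_mult[symmetric] power_mult_distrib divide_inverse mult_ac)
  ultimately show ?thesis by simp
qed

context
  fixes P :: "'w measure" and \<Lambda> :: "real measure" and X :: "nat \<Rightarrow> 'w \<Rightarrow> real"
  assumes P: "prob_space P" and X: "poisson_points P \<Lambda> X" and \<Lambda>: "sets \<Lambda> = sets borel"
begin

interpretation P: prob_space P by (rule P)

lemma measurable_poisson_points: "X i \<in> borel_measurable P"
  using X by (simp add: poisson_points_def)

lemma measurable_num_points:
  assumes [measurable]: "B \<in> sets borel"
  shows "num_points X B \<in> borel_measurable P"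
proof -
  note measurable_poisson_points [measurable]
  show ?thesis unfolding num_points_eq_suminf[abs_def] by measurable
qed

lemma nn_integral_num_points_finite:
  assumes [measurable]: "B \<in> sets borel" and fin: "emeasure \<Lambda> B < \<infinity>"
  shows "(\<integral>\<^sup>+w. nexp (a * num_points X B w) \<partial>P) = nexp ((1 - nexp a) * emeasure \<Lambda> B)"
proof -
  note measurable_poisson_points [measurable] measurable_num_points [measurable]
  define m where "m = measure \<Lambda> B"
  have m: "emeasure \<Lambda> B = ennreal m" "0 \<le> m"
    using fin by (simp_all add: m_def emeasure_eq_ennreal_measure less_top)
  define E where "E k = {w \<in> space P. num_points X B w = of_nat k}" for k :: nat
  have [measurable]: "E k \<in> sets P" for k unfolding E_def by measurable
  have PE: "emeasure P (E k) = ennreal (exp (- m) * m ^ k / fact k)" for k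
    using X fin unfolding poisson_points_def
    by (simp add: E_def m_def P.emeasure_eq_measure del: of_nat_fact)
  have disj: "E j \<inter> E k = {}" if "j \<noteq> k" for j k using that by (auto simp: E_def)
  have ind: "(\<Sum>k. c k * indicator (E k) w) = c j" if "w \<in> E j" for c :: "nat \<Rightarrow> ennreal" and j w
  proof -
    have "(\<Sum>k. c k * indicator (E k) w) = (\<Sum>k\<in>{j}. c k * indicator (E k) w)"
      by (rule suminf_finite) (use that disj in \<open>auto split: split_indicator\<close>)
    then show ?thesis using that by simp
  qed
  \<comment> \<open>The definition of \<open>poisson_points\<close> prescribes only the
    probabilities of the finite values. That these sum to 1, the generating function at
    \<open>z = 1\<close>, shows that the count is almost surely finite, so the events
    \<open>E k\<close> suffice to compute the expectation.\<close>
  have "(\<integral>\<^sup>+w. (\<Sum>k. 1 * indicator (E k) w) \<partial>P) = (\<Sum>k. 1 * emeasure P (E k))"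
    by (subst nn_integral_suminf) simp_all
  also have "\<dots> = (\<Sum>k. ennreal 1 ^ k * ennreal (exp (- m) * m ^ k / fact k))" by (simp add: PE)
  also have "\<dots> = 1" by (subst ennreal_power_exp_suminf) (simp_all add: m)
  also have "\<dots> = (\<integral>\<^sup>+w. indicator (\<Union>k. E k) w \<partial>P) + emeasure P (space P - (\<Union>k. E k))"
    by (subst nn_integral_indicator)
       (simp_all add: emeasure_compl P.emeasure_space_1 P.emeasure_le_1 add_diff_inverse_ennreal)
  finally have "(\<integral>\<^sup>+w. (\<Sum>k. 1 * indicator (E k) w) \<partial>P) =
      (\<integral>\<^sup>+w. indicator (\<Union>k. E k) w \<partial>P) + emeasure P (space P - (\<Union>k. E k))" .
  moreover have "(\<Sum>k. 1 * indicator (E k) w) = (indicator (\<Union>k. E k) w :: ennreal)" for w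
  proof (cases "w \<in> (\<Union>k. E k)")
    case True
    then obtain j where "w \<in> E j" by blast
    then show ?thesis using ind[of w j "\<lambda>_. 1"] True by simp
  next
    case False
    then have "indicator (E k) w = (0::ennreal)" for k by simp
    then show ?thesis using False by simp
  qed
  ultimately have "(\<integral>\<^sup>+w. indicator (\<Union>k. E k) w \<partial>P) =
      (\<integral>\<^sup>+w. indicator (\<Union>k. E k) w \<partial>P) + emeasure P (space P - (\<Union>k. E k))" by simp
  then have "emeasure P (\<Union>k. E k) + 0 = emeasure P (\<Union>k. E k) + emeasure P (space P - (\<Union>k. E k))"
    by simp
  then have "emeasure P (space P - (\<Union>k. E k)) = 0"
    unfolding ennreal_add_left_cancel by simp
  then have AE: "AE w in P. w \<in> (\<Union>k. E k)"
    by (intro AE_I[of _ _ "space P - (\<Union>k. E k)"]) auto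
  obtain z where z: "nexp a = ennreal z" "0 \<le> z" "z \<le> 1"
    using nexp_le_1[of a] nexp_less_top[of a] by (cases "nexp a") simp_all
  have "(\<integral>\<^sup>+w. nexp (a * num_points X B w) \<partial>P)
      = (\<integral>\<^sup>+w. (\<Sum>k. nexp a ^ k * indicator (E k) w) \<partial>P)"
  proof (rule nn_integral_cong_AE, use AE in eventually_elim)
    case (elim w)
    then obtain j where j: "w \<in> E j" by blast
    then have "num_points X B w = of_nat j" by (simp add: E_def)
    with ind[OF j, of "\<lambda>k. nexp a ^ k"] show ?case by (simp add: nexp_of_nat_mult)
  qed
  also have "\<dots> = (\<Sum>k. nexp a ^ k * emeasure P (E k))"
    by (subst nn_integral_suminf) (simp_all add: nn_integral_cmult_indicator)
  also have "\<dots> = ennreal (exp (- ((1 - z) * m)))"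
    unfolding PE z by (rule ennreal_power_exp_suminf) (use z m in auto)
  also have "\<dots> = nexp ((1 - nexp a) * emeasure \<Lambda> B)"
    using z m ennreal_minus[of z 1]
    by (simp add: nexp_ennreal ennreal_mult[symmetric] flip: ennreal_1)
  finally show ?thesis .
qed

text \<open>When the mean is infinite the count is almost surely infinite and both sides vanish. The
  exception is \<open>a = 0\<close>, where the convention 0 * \<infinity> = 0 makes both sides equal
  to 1.\<close>

lemma nn_integral_num_points:
  assumes [measurable]: "B \<in> sets borel"
  shows "(\<integral>\<^sup>+w. nexp (a * num_points X B w) \<partial>P) = nexp ((1 - nexp a) * emeasure \<Lambda> B)"
  supply measurable_poisson_points [measurable] measurable_num_points [measurable]
proof (cases "emeasure \<Lambda> B < \<infinity>")
  case True
  then show ?thesis by (rule nn_integral_num_points_finite[OF assms])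
next
  case False
  then have inf: "emeasure \<Lambda> B = top" by (simp add: less_top[symmetric])
  then have AE: "AE w in P. num_points X B w = \<infinity>"
    using X assms unfolding poisson_points_def by simp
  show ?thesis
  proof (cases "a = 0")
    case True
    then show ?thesis by (simp add: P.emeasure_space_1)
  next
    case a: False
    then have "1 - nexp a \<noteq> 0" using nexp_less_1[OF a] by (simp add: diff_eq_0_iff_ennreal)
    moreover have "(\<integral>\<^sup>+w. nexp (a * num_points X B w) \<partial>P) = (\<integral>\<^sup>+w. 0 \<partial>P)"
      by (rule nn_integral_cong_AE, use AE in eventually_elim) (simp add: a ennreal_mult_top)
    ultimately show ?thesis using inf by (simp add: ennreal_mult_top)
  qed
qed

text \<open>The sum over the points is a combination of the numbers of points in the level sets of
  \<phi>. These sets are disjoint, so the counts are independent and the expectation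
  factorizes.\<close>

lemma laplace_simple:
  assumes \<phi>: "simple_function borel (\<phi> :: real \<Rightarrow> ennreal)"
  shows "(\<integral>\<^sup>+w. nexp (\<Sum>i. \<phi> (X i w)) \<partial>P) = nexp (\<integral>\<^sup>+x. 1 - nexp (\<phi> x) \<partial>\<Lambda>)"
proof -
  note measurable_poisson_points [measurable] measurable_num_points [measurable]
  have [measurable]: "\<phi> \<in> borel_measurable borel" by (rule borel_measurable_simple_function[OF \<phi>])
  have fin: "finite (range \<phi>)" using simple_functionD(1)[OF \<phi>] by simp
  obtain h n where h: "bij_betw h {..<n::nat} (range \<phi>)"
    using ex_bij_betw_nat_finite[OF fin] by (metis lessThan_atLeast0)
  define B where "B j = \<phi> -` {h j}" for j
  have [measurable]: "B j \<in> sets borel" for j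
    using measurable_sets[of \<phi> borel borel "{h j}"] by (simp add: B_def)
  have disj: "disjoint_family_on B {..<n}"
    using bij_betw_imp_inj_on[OF h] by (auto simp: disjoint_family_on_def B_def inj_on_def)
  \<comment> \<open>Stated for an arbitrary \<open>g\<close> because it is used twice: with the
    identity to write the sum over the points as counts, and with \<open>1 - nexp\<close> to
    recombine the exponents into an integral.\<close>
  have expand: "g (\<phi> x) = (\<Sum>j<n. g (h j) * indicator (B j) x)" for g :: "ennreal \<Rightarrow> ennreal" and x
  proof -
    obtain k where k: "k < n" "\<phi> x = h k"
      using bij_betw_imp_surj_on[OF h] by (metis imageE lessThan_iff rangeI)
    have "(\<Sum>j<n. g (h j) * indicator (B j) x) = (\<Sum>j<n. if j = k then g (h j) else 0)"
      using k bij_betw_imp_inj_on[OF h]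
      by (intro sum.cong) (auto simp: B_def inj_on_def split: split_indicator)
    then show ?thesis using k by simp
  qed
  have "(\<Sum>i. \<phi> (X i w)) = (\<Sum>j<n. h j * num_points X (B j) w)" for w
  proof -
    have "(\<Sum>i. \<phi> (X i w)) = (\<Sum>i. \<Sum>j<n. h j * indicator (B j) (X i w))"
      using expand[of "\<lambda>x. x"] by simp
    also have "\<dots> = (\<Sum>j<n. \<Sum>i. h j * indicator (B j) (X i w))"
      by (rule suminf_sum) (rule summableI)
    finally show ?thesis by (simp only: ennreal_suminf_cmult num_points_eq_suminf)
  qed
  then have "(\<integral>\<^sup>+w. nexp (\<Sum>i. \<phi> (X i w)) \<partial>P)
      = (\<integral>\<^sup>+w. (\<Prod>j<n. nexp (h j * num_points X (B j) w)) \<partial>P)"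
    by (simp add: nexp_sum)
  also have "\<dots> = (\<Prod>j<n. \<integral>\<^sup>+w. nexp (h j * num_points X (B j) w) \<partial>P)"
  proof (rule P.indep_vars_nn_integral)
    have "P.indep_vars (\<lambda>_. borel) (\<lambda>j. num_points X (B j)) {..<n}"
      using X disj unfolding poisson_points_def by simp
    then show "P.indep_vars (\<lambda>_. borel) (\<lambda>j w. nexp (h j * num_points X (B j) w)) {..<n}"
      by (rule P.indep_vars_compose2[where Y = "\<lambda>j x. nexp (h j * x)"]) measurable
  qed simp_all
  also have "\<dots> = (\<Prod>j<n. nexp ((1 - nexp (h j)) * emeasure \<Lambda> (B j)))"
    by (simp add: nn_integral_num_points)
  also have "\<dots> = nexp (\<Sum>j<n. (1 - nexp (h j)) * emeasure \<Lambda> (B j))"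
    by (simp add: nexp_sum)
  also have "(\<Sum>j<n. (1 - nexp (h j)) * emeasure \<Lambda> (B j))
      = (\<integral>\<^sup>+x. (\<Sum>j<n. (1 - nexp (h j)) * indicator (B j) x) \<partial>\<Lambda>)"
    using \<Lambda> by (subst nn_integral_sum) (simp_all add: nn_integral_cmult_indicator)
  also have "\<dots> = (\<integral>\<^sup>+x. 1 - nexp (\<phi> x) \<partial>\<Lambda>)"
    using expand[of "\<lambda>x. 1 - nexp x"] by simp
  finally show ?thesis .
qed

text \<open>Simple functions increase to \<phi>. The left side passes to the limit by dominated
  convergence, as \<open>nexp\<close> is bounded by 1 under a probability; the integral in the
  exponent does so by monotone convergence, as \<open>1 - nexp\<close> is increasing and the
  intensity may be infinite.\<close>

lemma laplace_poisson:
  assumes [measurable]: "\<phi> \<in> borel_measurable borel"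
  shows "(\<integral>\<^sup>+w. nexp (\<Sum>i. \<phi> (X i w)) \<partial>P) = nexp (\<integral>\<^sup>+x. 1 - nexp (\<phi> x) \<partial>\<Lambda>)"
proof -
  note measurable_poisson_points [measurable] measurable_num_points [measurable]
  obtain f :: "nat \<Rightarrow> real \<Rightarrow> ennreal" where f0: "incseq f" "\<forall>i. (\<forall>x. f i x < top) \<and> simple_function borel (f i)"
      "\<phi> = (SUP i. f i)"
    using borel_measurable_implies_simple_function_sequence[OF assms] by (elim exE conjE)
  have f: "simple_function borel (f i)" "incseq f" "(SUP i. f i x) = \<phi> x" for i x
    using f0 by (simp_all add: SUP_apply image_comp)
  have [measurable]: "f n \<in> borel_measurable borel" for n
    by (rule borel_measurable_simple_function[OF f(1)])
  have \<Lambda>': "borel_measurable \<Lambda> = borel_measurable (borel :: real measure)"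
    by (rule measurable_cong_sets[OF \<Lambda> refl])
  have lim: "(\<lambda>n. f n x) \<longlonglongrightarrow> \<phi> x" for x
    using LIMSEQ_SUP[of "\<lambda>n. f n x"] f(2) unfolding f(3) by (simp add: incseq_def le_fun_def)
  have "(\<lambda>n. \<integral>\<^sup>+i. f n (X i w) \<partial>count_space UNIV) \<longlonglongrightarrow> (\<integral>\<^sup>+i. \<phi> (X i w) \<partial>count_space UNIV)" for w
    by (rule nn_integral_LIMSEQ) (use f(2) lim in \<open>auto simp: incseq_def le_fun_def\<close>)
  then have sumlim: "(\<lambda>n. \<Sum>i. f n (X i w)) \<longlonglongrightarrow> (\<Sum>i. \<phi> (X i w))" for w
    by (simp add: nn_integral_count_space_nat)
  have "(\<lambda>n. \<integral>\<^sup>+w. nexp (\<Sum>i. f n (X i w)) \<partial>P) \<longlonglongrightarrow> (\<integral>\<^sup>+w. nexp (\<Sum>i. \<phi> (X i w)) \<partial>P)"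
    by (rule nn_integral_dominated_convergence[where w = "\<lambda>_. 1"])
       (simp_all add: P.emeasure_space_1 tendsto_nexp sumlim)
  moreover have "(\<lambda>n. nexp (\<integral>\<^sup>+x. 1 - nexp (f n x) \<partial>\<Lambda>)) \<longlonglongrightarrow> nexp (\<integral>\<^sup>+x. 1 - nexp (\<phi> x) \<partial>\<Lambda>)"
  proof (intro tendsto_nexp nn_integral_LIMSEQ)
    show "incseq (\<lambda>n x. 1 - nexp (f n x))"
      using f(2) by (auto simp: incseq_def le_fun_def intro!: ennreal_minus_mono nexp_antimono)
    show "(\<lambda>x. 1 - nexp (f n x)) \<in> borel_measurable \<Lambda>" for n unfolding \<Lambda>' by measurable
    show "(\<lambda>n. 1 - nexp (f n x)) \<longlonglongrightarrow> 1 - nexp (\<phi> x)" for x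
      by (intro tendsto_diff_ennreal tendsto_const tendsto_nexp lim) simp_all
  qed
  ultimately show ?thesis
    unfolding laplace_simple[OF f(1)] by (rule LIMSEQ_unique)
qed

end

section \<open>Independent marks\<close>

lemma nn_integral_PiM_prod:
  fixes h :: "nat \<Rightarrow> 'a \<Rightarrow> ennreal"
  assumes "prob_space N" and [measurable]: "\<And>i. h i \<in> borel_measurable N"
  shows "(\<integral>\<^sup>+y. (\<Prod>i<n. h i (y i)) \<partial>(\<Pi>\<^sub>M i\<in>(UNIV::nat set). N)) = (\<Prod>i<n. \<integral>\<^sup>+s. h i s \<partial>N)"
proof -
  interpret N: prob_space N by fact
  interpret product_prob_space "\<lambda>_::nat. N" UNIV by unfold_locales
  have "(\<Prod>i<n. \<integral>\<^sup>+s. h i s \<partial>N) = (\<integral>\<^sup>+y. (\<Prod>i<n. h i (y i)) \<partial>(\<Pi>\<^sub>M i\<in>{..<n}. N))"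
    by (rule product_nn_integral_prod[symmetric]) simp_all
  also have "(\<Pi>\<^sub>M i\<in>{..<n}. N) = distr (\<Pi>\<^sub>M i\<in>UNIV. N) (\<Pi>\<^sub>M i\<in>{..<n}. N) (\<lambda>y. restrict y {..<n})"
    by (rule distr_PiM_restrict_finite[symmetric]) simp_all
  also have "(\<integral>\<^sup>+y. (\<Prod>i<n. h i (y i)) \<partial>\<dots>)
      = (\<integral>\<^sup>+y. (\<Prod>i<n. h i (restrict y {..<n} i)) \<partial>(\<Pi>\<^sub>M i\<in>UNIV. N))"
    by (rule nn_integral_distr) (auto intro!: measurable_restrict_subset)
  also have "\<dots> = (\<integral>\<^sup>+y. (\<Prod>i<n. h i (y i)) \<partial>(\<Pi>\<^sub>M i\<in>UNIV. N))"
    by (intro nn_integral_cong prod.cong) simp_all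
  finally show ?thesis by simp
qed

text \<open>The infinite product of the marginal expectations is reached as a limit of finite
  products. The value \<infinity> of \<open>nlog\<close> at 0 covers vanishing factors, so no lower
  bound on the marginals enters.\<close>

lemma nn_integral_PiM_nexp:
  fixes g :: "nat \<Rightarrow> 'a \<Rightarrow> ennreal"
  assumes N: "prob_space N" and [measurable]: "\<And>i. g i \<in> borel_measurable N"
  shows "(\<integral>\<^sup>+y. nexp (\<Sum>i. g i (y i)) \<partial>(\<Pi>\<^sub>M i\<in>(UNIV::nat set). N))
    = nexp (\<Sum>i. nlog (\<integral>\<^sup>+s. nexp (g i s) \<partial>N))"
proof -
  interpret N: prob_space N by fact
  interpret PiM: prob_space "\<Pi>\<^sub>M i\<in>(UNIV::nat set). N" by (rule prob_space_PiM) (rule N)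
  have le: "(\<integral>\<^sup>+s. nexp (g i s) \<partial>N) \<le> 1" for i
    using nn_integral_mono[of N "\<lambda>s. nexp (g i s)" "\<lambda>_. 1"] by (simp add: N.emeasure_space_1)
  have lim: "(\<lambda>n. \<Sum>i<n. a i) \<longlonglongrightarrow> suminf a" for a :: "nat \<Rightarrow> ennreal"
    using summable_LIMSEQ[OF summableI] .
  have "(\<lambda>n. \<integral>\<^sup>+y. nexp (\<Sum>i<n. g i (y i)) \<partial>(\<Pi>\<^sub>M i\<in>(UNIV::nat set). N))
      \<longlonglongrightarrow> (\<integral>\<^sup>+y. nexp (\<Sum>i. g i (y i)) \<partial>(\<Pi>\<^sub>M i\<in>(UNIV::nat set). N))"
    by (rule nn_integral_dominated_convergence[where w = "\<lambda>_. 1"])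
       (simp_all add: PiM.emeasure_space_1 tendsto_nexp lim)
  moreover have "(\<integral>\<^sup>+y. nexp (\<Sum>i<n. g i (y i)) \<partial>(\<Pi>\<^sub>M i\<in>(UNIV::nat set). N))
      = nexp (\<Sum>i<n. nlog (\<integral>\<^sup>+s. nexp (g i s) \<partial>N))" for n
    using nn_integral_PiM_prod[OF N, of "\<lambda>i s. nexp (g i s)" n]
    by (simp add: nexp_sum nexp_nlog le)
  moreover have "(\<lambda>n. nexp (\<Sum>i<n. nlog (\<integral>\<^sup>+s. nexp (g i s) \<partial>N)))
      \<longlonglongrightarrow> nexp (\<Sum>i. nlog (\<integral>\<^sup>+s. nexp (g i s) \<partial>N))"
    by (rule tendsto_nexp[OF lim])
  ultimately show ?thesis by (simp add: LIMSEQ_unique)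
qed

context
  fixes P :: "'w measure" and \<Lambda> :: "real measure" and X :: "nat \<Rightarrow> 'w \<Rightarrow> real"
    and \<xi> :: "nat \<Rightarrow> 'w \<Rightarrow> 'a::metric_space" and \<nu>\<^sub>0 :: "'a measure"
  assumes P: "prob_space P" and X: "poisson_points P \<Lambda> X" and \<Lambda>: "sets \<Lambda> = sets borel"
    and iid: "iid P \<nu>\<^sub>0 \<xi>" and ind: "indep_sequences P X \<xi>"
    and \<nu>: "prob_space \<nu>\<^sub>0" and sets_\<nu>: "sets \<nu>\<^sub>0 = sets borel"
begin

interpretation P: prob_space P by (rule P)
interpretation \<nu>: prob_space \<nu>\<^sub>0 by (rule \<nu>)

lemma measurable_marks: "\<xi> i \<in> borel_measurable P"
  using iid P.indep_vars_def2 unfolding iid_def by (metis UNIV_I)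

lemma distr_marks: "distr P (\<Pi>\<^sub>M i\<in>UNIV. borel) (\<lambda>w i. \<xi> i w) = (\<Pi>\<^sub>M i\<in>UNIV. \<nu>\<^sub>0)"
  using P.indep_vars_iff_distr_eq_PiM'[of UNIV \<xi> "\<lambda>_. borel"] iid
  unfolding iid_def by (simp add: restrict_UNIV measurable_marks)

text \<open>By independence, the marks may be replaced by a fresh i.i.d. sample integrated with the
  points held fixed. Read from right to left, the identity later turns the mark average inside the
  claimed density into the marks of the process itself.\<close>

lemma nn_integral_joint:
  assumes h [measurable]: "h \<in> borel_measurable ((\<Pi>\<^sub>M i\<in>UNIV. borel) \<Otimes>\<^sub>M (\<Pi>\<^sub>M i\<in>UNIV. \<nu>\<^sub>0))"
  shows "(\<integral>\<^sup>+w. h (\<lambda>i. X i w, \<lambda>i. \<xi> i w) \<partial>P)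
    = (\<integral>\<^sup>+w. \<integral>\<^sup>+y. h (\<lambda>i. X i w, y) \<partial>(\<Pi>\<^sub>M i\<in>UNIV. \<nu>\<^sub>0) \<partial>P)"
proof -
  note measurable_poisson_points[OF P X \<Lambda>, measurable] measurable_marks [measurable]
  let ?S = "\<Pi>\<^sub>M i\<in>(UNIV::nat set). (borel :: real measure)"
  let ?T = "\<Pi>\<^sub>M i\<in>(UNIV::nat set). (borel :: 'a measure)"
  let ?N = "\<Pi>\<^sub>M i\<in>(UNIV::nat set). \<nu>\<^sub>0"
  have [measurable]: "(\<lambda>w i. X i w) \<in> measurable P ?S" "(\<lambda>w i. \<xi> i w) \<in> measurable P ?T"
    using measurable_poisson_points[OF P X \<Lambda>] by (auto intro!: measurable_PiM_single' measurable_marks)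
  have sets_N: "sets ?N = sets ?T" by (rule sets_PiM_cong) (simp_all add: sets_\<nu>)
  have h' [measurable]: "h \<in> borel_measurable (?S \<Otimes>\<^sub>M ?T)"
    using h by (simp cong: measurable_cong_sets sets_pair_measure_cong add: sets_N)
  interpret N: prob_space ?N by (rule prob_space_PiM) (rule \<nu>)
  interpret D: prob_space "distr P ?S (\<lambda>w i. X i w)" by (rule P.prob_space_distr) measurable
  have "distr P ?S (\<lambda>w i. X i w) \<Otimes>\<^sub>M ?N = distr P (?S \<Otimes>\<^sub>M ?T) (\<lambda>w. (\<lambda>i. X i w, \<lambda>i. \<xi> i w))"
  proof (rule pair_measure_eqI)
    show "sigma_finite_measure (distr P ?S (\<lambda>w i. X i w))" "sigma_finite_measure ?N"
      by unfold_locales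
    show "sets (distr P ?S (\<lambda>w i. X i w) \<Otimes>\<^sub>M ?N)
        = sets (distr P (?S \<Otimes>\<^sub>M ?T) (\<lambda>w. (\<lambda>i. X i w, \<lambda>i. \<xi> i w)))"
      using sets_N by (simp cong: sets_pair_measure_cong)
    fix A B assume "A \<in> sets (distr P ?S (\<lambda>w i. X i w))" and "B \<in> sets ?N"
    then have A [measurable]: "A \<in> sets ?S" and B [measurable]: "B \<in> sets ?T" using sets_N by simp_all
    let ?A = "(\<lambda>w i. X i w) -` A \<inter> space P" and ?B = "(\<lambda>w i. \<xi> i w) -` B \<inter> space P"
    have "measure P (?A \<inter> ?B) = measure P ?A * measure P ?B"
      using ind unfolding indep_sequences_def by (rule P.indep_setD) (intro in_vimage_algebra A B)+
    moreover have "(\<lambda>w. (\<lambda>i. X i w, \<lambda>i. \<xi> i w)) -` (A \<times> B) \<inter> space P = ?A \<inter> ?B" by blast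
    moreover have "emeasure ?N B = emeasure P ?B"
      unfolding distr_marks[symmetric] by (simp add: emeasure_distr)
    ultimately show "emeasure (distr P ?S (\<lambda>w i. X i w)) A * emeasure ?N B
        = emeasure (distr P (?S \<Otimes>\<^sub>M ?T) (\<lambda>w. (\<lambda>i. X i w, \<lambda>i. \<xi> i w))) (A \<times> B)"
      by (simp add: emeasure_distr P.emeasure_eq_measure ennreal_mult)
  qed
  then have "(\<integral>\<^sup>+z. h z \<partial>distr P (?S \<Otimes>\<^sub>M ?T) (\<lambda>w. (\<lambda>i. X i w, \<lambda>i. \<xi> i w)))
      = (\<integral>\<^sup>+z. h z \<partial>(distr P ?S (\<lambda>w i. X i w) \<Otimes>\<^sub>M ?N))" by simp
  also have "\<dots> = (\<integral>\<^sup>+x. \<integral>\<^sup>+y. h (x, y) \<partial>?N \<partial>distr P ?S (\<lambda>w i. X i w))"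
    by (rule N.nn_integral_fst[symmetric])
       (use h in \<open>simp cong: measurable_cong_sets sets_pair_measure_cong\<close>)
  also have "\<dots> = (\<integral>\<^sup>+w. \<integral>\<^sup>+y. h (\<lambda>i. X i w, y) \<partial>?N \<partial>P)"
    using h by (intro nn_integral_distr) measurable
  finally show ?thesis using h' by (subst (asm) nn_integral_distr) simp_all
qed

text \<open>A form of the marking theorem that avoids Poisson measures on a product space:
  integrating the marks out at fixed points leaves a sum over the points alone, with test function
  \<open>\<psi>\<close>. Since \<open>\<nu>\<^sub>0\<close> has mass 1,
  \<open>1 - nexp (\<psi> x)\<close> is the mark average of
  \<open>1 - nexp (\<phi> (x, s))\<close>.\<close>

lemma laplace_marked:
  assumes [measurable]: "\<phi> \<in> borel_measurable (borel \<Otimes>\<^sub>M \<nu>\<^sub>0)"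
  shows "(\<integral>\<^sup>+w. nexp (\<Sum>i. \<phi> (X i w, \<xi> i w)) \<partial>P)
    = nexp (\<integral>\<^sup>+x. \<integral>\<^sup>+s. 1 - nexp (\<phi> (x, s)) \<partial>\<nu>\<^sub>0 \<partial>\<Lambda>)"
proof -
  note measurable_poisson_points[OF P X \<Lambda>, measurable] measurable_marks [measurable]
  let ?N = "\<Pi>\<^sub>M i\<in>(UNIV::nat set). \<nu>\<^sub>0"
  define \<psi> where "\<psi> x = nlog (\<integral>\<^sup>+s. nexp (\<phi> (x, s)) \<partial>\<nu>\<^sub>0)" for x
  have [measurable]: "\<psi> \<in> borel_measurable borel"
    unfolding \<psi>_def[abs_def] by measurable
  have le: "(\<integral>\<^sup>+s. nexp (\<phi> (x, s)) \<partial>\<nu>\<^sub>0) \<le> 1" for x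
    using nn_integral_mono[of \<nu>\<^sub>0 "\<lambda>s. nexp (\<phi> (x, s))" "\<lambda>_. 1"] by (simp add: \<nu>.emeasure_space_1)
  have "(\<integral>\<^sup>+w. nexp (\<Sum>i. \<phi> (X i w, \<xi> i w)) \<partial>P)
      = (\<integral>\<^sup>+w. \<integral>\<^sup>+y. nexp (\<Sum>i. \<phi> (X i w, y i)) \<partial>?N \<partial>P)"
    using nn_integral_joint[of "\<lambda>(x, y). nexp (\<Sum>i. \<phi> (x i, y i))"] by simp
  also have "\<dots> = (\<integral>\<^sup>+w. nexp (\<Sum>i. \<psi> (X i w)) \<partial>P)"
    unfolding \<psi>_def by (intro nn_integral_cong nn_integral_PiM_nexp[OF \<nu>]) measurable
  also have "\<dots> = nexp (\<integral>\<^sup>+x. 1 - nexp (\<psi> x) \<partial>\<Lambda>)"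
    by (rule laplace_poisson[OF P X \<Lambda>]) measurable
  also have "(\<lambda>x. 1 - nexp (\<psi> x)) = (\<lambda>x. \<integral>\<^sup>+s. 1 - nexp (\<phi> (x, s)) \<partial>\<nu>\<^sub>0)"
  proof
    fix x
    have "(\<integral>\<^sup>+s. 1 - nexp (\<phi> (x, s)) \<partial>\<nu>\<^sub>0) = (\<integral>\<^sup>+s. 1 \<partial>\<nu>\<^sub>0) - (\<integral>\<^sup>+s. nexp (\<phi> (x, s)) \<partial>\<nu>\<^sub>0)"
      using le[of x] by (intro nn_integral_diff) (auto simp: top_unique)
    then show "1 - nexp (\<psi> x) = (\<integral>\<^sup>+s. 1 - nexp (\<phi> (x, s)) \<partial>\<nu>\<^sub>0)"
      by (simp add: \<psi>_def nexp_nlog le \<nu>.emeasure_space_1)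
  qed
  finally show ?thesis .
qed

end

section \<open>The gamma intensity\<close>

lemma nn_integral_exp_Ioi:
  assumes "0 < t"
  shows "(\<integral>\<^sup>+x. indicator {0<..} x * ennreal (exp (- (t * x))) \<partial>lborel) = ennreal (1 / t)"
proof -
  have "(\<integral>\<^sup>+x. indicator {0<..} x * ennreal (exp (- (t * x))) \<partial>lborel)
      = (\<integral>\<^sup>+x. ennreal (exp (- (t * x))) * indicator {0..} x \<partial>lborel)"
    by (rule nn_integral_cong_AE, use AE_lborel_singleton[of "0::real"] in eventually_elim)
       (auto split: split_indicator)
  also have "\<dots> = ennreal (0 - (- (exp (- (t * 0)) / t)))"
  proof (rule nn_integral_FTC_atLeast)
    show "((\<lambda>x. - (exp (- (t * x)) / t)) has_real_derivative exp (- (t * x))) (at x)" for x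
      using assms by (auto intro!: derivative_eq_intros)
    have "((\<lambda>x. exp (- (t * x))) \<longlongrightarrow> 0) at_top"
      using assms
      by (intro filterlim_compose[OF exp_at_bot] filterlim_uminus_at_bot_at_top[THEN filterlim_compose]
          filterlim_tendsto_pos_mult_at_top[OF tendsto_const] filterlim_ident)
    from tendsto_minus[OF tendsto_divide[OF this tendsto_const[of t]]]
    show "((\<lambda>x. - (exp (- (t * x)) / t)) \<longlongrightarrow> 0) at_top" using assms by simp
  qed simp_all
  finally show ?thesis by simp
qed

text \<open>For \<open>a < b\<close> the integrand is the integral of exp(-t x) over t in [a, b];
  exchanging the integrals leaves that of 1/t. The positive part keeps everything nonnegative, and
  both sides vanish when \<open>b \<le> a\<close>, so the two signs of a logarithm can be handled by
  swapping the arguments.\<close>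

lemma frullani:
  assumes "0 < a" "0 < b"
  shows "(\<integral>\<^sup>+x. indicator {0<..} x * ennreal (max 0 (exp (- (a * x)) - exp (- (b * x))) / x) \<partial>lborel)
    = ennreal (max 0 (ln (b / a)))"
proof (cases "a < b")
  case False
  have "(\<integral>\<^sup>+x. indicator {0<..} x * ennreal (max 0 (exp (- (a * x)) - exp (- (b * x))) / x) \<partial>lborel)
      = (\<integral>\<^sup>+x. 0 \<partial>(lborel :: real measure))"
  proof (rule nn_integral_cong)
    fix x :: real
    show "indicator {0<..} x * ennreal (max 0 (exp (- (a * x)) - exp (- (b * x))) / x) = 0"
    proof (cases "0 < x")
      case True
      then have "b * x \<le> a * x" using False by simp
      then show ?thesis by (simp add: max_def)
    qed simp
  qed
  moreover have "ln (b / a) \<le> 0" using False assms by (simp add: ln_le_zero_iff)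
  ultimately show ?thesis by (simp add: max_def)
next
  case True
  have inner: "ennreal (max 0 (exp (- (a * x)) - exp (- (b * x))) / x)
      = (\<integral>\<^sup>+t. ennreal (exp (- (t * x))) * indicator {a..b} t \<partial>lborel)" if "0 < x" for x
  proof -
    have "(\<integral>\<^sup>+t. ennreal (exp (- (t * x))) * indicator {a..b} t \<partial>lborel)
        = ennreal (- (exp (- (b * x)) / x) - (- (exp (- (a * x)) / x)))"
      by (rule nn_integral_FTC_Icc)
         (use that True in \<open>auto intro!: derivative_eq_intros\<close>)
    moreover have "a * x \<le> b * x" using True that by simp
    ultimately show ?thesis using that by (simp add: max_def diff_divide_distrib)
  qed
  have "(\<integral>\<^sup>+x. indicator {0<..} x * ennreal (max 0 (exp (- (a * x)) - exp (- (b * x))) / x) \<partial>lborel)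
      = (\<integral>\<^sup>+x. \<integral>\<^sup>+t. indicator {0<..} x * (ennreal (exp (- (t * x))) * indicator {a..b} t) \<partial>lborel \<partial>lborel)"
    by (rule nn_integral_cong) (simp add: inner nn_integral_cmult split: split_indicator)
  also have "\<dots> = (\<integral>\<^sup>+t. \<integral>\<^sup>+x. indicator {0<..} x * (ennreal (exp (- (t * x))) * indicator {a..b} t) \<partial>lborel \<partial>lborel)"
    by (rule lborel_pair.Fubini') simp
  also have "\<dots> = (\<integral>\<^sup>+t. ennreal (1 / t) * indicator {a..b} t \<partial>lborel)"
  proof (rule nn_integral_cong)
    fix t :: real
    show "(\<integral>\<^sup>+x. indicator {0<..} x * (ennreal (exp (- (t * x))) * indicator {a..b} t) \<partial>lborel)
        = ennreal (1 / t) * indicator {a..b} t"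
      using nn_integral_exp_Ioi[of t] assms by (simp split: split_indicator)
  qed
  also have "\<dots> = ennreal (ln b - ln a)"
    by (rule nn_integral_FTC_Icc) (use assms True in \<open>auto intro!: derivative_eq_intros\<close>)
  finally show ?thesis using True assms by (simp add: ln_div max_def)
qed

section \<open>Scaling the gamma intensity\<close>

abbreviation gamma_kernel :: "real \<Rightarrow> real \<Rightarrow> ennreal" where
  "gamma_kernel \<theta> x \<equiv> indicator {0<..} x * ennreal (\<theta> * exp (- x) / x)"

text \<open>Substituting $x \mapsto x / a$ on the left, the integrands on both sides differ by
  $\theta (e^{-x/a} - e^{-x}) / x$, whose Frullani integral is $\theta \ln a$.  Positive and negative parts are kept
  on separate sides, since both integrals may be infinite.\<close>

lemma gamma_intensity_scale:
  fixes \<phi> :: "real \<Rightarrow> ennreal"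
  assumes [measurable]: "\<phi> \<in> borel_measurable borel" and "0 < a" "0 \<le> \<theta>"
  shows "(\<integral>\<^sup>+x. gamma_kernel \<theta> x * (1 - nexp (\<phi> (a * x) + ennreal (a * x))) \<partial>lborel)
      + ennreal (\<theta> * max 0 (- ln a))
    = (\<integral>\<^sup>+x. gamma_kernel \<theta> x * (1 - nexp (\<phi> x + ennreal (x / a))) \<partial>lborel)
      + ennreal (\<theta> * max 0 (ln a))" (is "?L + _ = ?R + _")
proof -
  have "?L = ennreal \<bar>1 / a\<bar> * (\<integral>\<^sup>+y. indicator {0<..} (0 + (1 / a) * y) *
      ennreal (\<theta> * exp (- (0 + (1 / a) * y)) / (0 + (1 / a) * y)) *
      (1 - nexp (\<phi> (a * (0 + (1 / a) * y)) + ennreal (a * (0 + (1 / a) * y)))) \<partial>lborel)"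
    by (rule nn_integral_real_affine) (use assms in simp_all)
  also have "\<dots> = (\<integral>\<^sup>+y. ennreal (1 / a) * (indicator {0<..} (y / a) * ennreal (\<theta> * exp (- (y / a)) / (y / a)) *
      (1 - nexp (\<phi> y + ennreal y))) \<partial>lborel)"
    using assms by (subst nn_integral_cmult) simp_all
  also have "\<dots> = (\<integral>\<^sup>+y. indicator {0<..} y * ennreal (\<theta> * exp (- (y / a)) / y) *
      (1 - nexp (\<phi> y + ennreal y)) \<partial>lborel)"
  proof (rule nn_integral_cong)
    fix y :: real
    have "ennreal (1 / a) * ennreal (\<theta> * exp (- (y / a)) / (y / a)) = ennreal (\<theta> * exp (- (y / a)) / y)"
      if "0 < y" using that assms by (simp add: ennreal_mult[symmetric])
    then show "ennreal (1 / a) * (indicator {0<..} (y / a) * ennreal (\<theta> * exp (- (y / a)) / (y / a)) *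
        (1 - nexp (\<phi> y + ennreal y))) = indicator {0<..} y * ennreal (\<theta> * exp (- (y / a)) / y) *
        (1 - nexp (\<phi> y + ennreal y))"
      using assms by (simp add: mult.assoc[symmetric] zero_less_divide_iff split: split_indicator)
  qed
  finally have L: "?L = (\<integral>\<^sup>+y. indicator {0<..} y * ennreal (\<theta> * exp (- (y / a)) / y) *
      (1 - nexp (\<phi> y + ennreal y)) \<partial>lborel)" .
  have F: "(\<integral>\<^sup>+y. ennreal \<theta> * (indicator {0<..} y * ennreal (max 0 (exp (- (b * y)) - exp (- (c * y))) / y)) \<partial>lborel)
      = ennreal (\<theta> * max 0 (ln (c / b)))" if "0 < b" "0 < c" for b c
    using frullani[OF that] assms by (subst nn_integral_cmult) (simp_all add: ennreal_mult)
  have "?L + ennreal (\<theta> * max 0 (- ln a)) = (\<integral>\<^sup>+y. indicator {0<..} y * ennreal (\<theta> * exp (- (y / a)) / y) *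
      (1 - nexp (\<phi> y + ennreal y)) +
      ennreal \<theta> * (indicator {0<..} y * ennreal (max 0 (exp (- (1 * y)) - exp (- (1 / a * y))) / y)) \<partial>lborel)"
    using F[of 1 "1 / a"] assms unfolding L by (subst nn_integral_add) (simp_all add: ln_div)
  also have "\<dots> = (\<integral>\<^sup>+x. gamma_kernel \<theta> x * (1 - nexp (\<phi> x + ennreal (x / a))) +
      ennreal \<theta> * (indicator {0<..} x * ennreal (max 0 (exp (- (1 / a * x)) - exp (- (1 * x))) / x)) \<partial>lborel)"
  proof (rule nn_integral_cong)
    fix y :: real
    show "indicator {0<..} y * ennreal (\<theta> * exp (- (y / a)) / y) * (1 - nexp (\<phi> y + ennreal y)) +
        ennreal \<theta> * (indicator {0<..} y * ennreal (max 0 (exp (- (1 * y)) - exp (- (1 / a * y))) / y))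
      = gamma_kernel \<theta> y * (1 - nexp (\<phi> y + ennreal (y / a))) +
        ennreal \<theta> * (indicator {0<..} y * ennreal (max 0 (exp (- (1 / a * y)) - exp (- (1 * y))) / y))"
    proof (cases "0 < y")
      case True
      obtain v where v: "nexp (\<phi> y) = ennreal v" "0 \<le> v" "v \<le> 1"
        using nexp_le_1[of "\<phi> y"] nexp_less_top[of "\<phi> y"] by (cases "nexp (\<phi> y)") simp_all
      have one: "1 - nexp (\<phi> y + ennreal z) = ennreal (1 - v * exp (- z))" if "0 \<le> z" for z
        using that v by (simp add: nexp_add nexp_ennreal ennreal_mult[symmetric] ennreal_minus flip: ennreal_1)
      have le: "v * exp (- z) \<le> 1" if "0 \<le> z" for z
        using mult_mono[of v 1 "exp (- z)" 1] that v by simp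
      define p where "p = exp (- y)"
      define q where "q = exp (- (y / a))"
      have pq: "0 < p" "0 < q" "v * p \<le> 1" "v * q \<le> 1"
        using le[of y] le[of "y / a"] True assms by (simp_all add: p_def q_def)
      \<comment> \<open>The products \<open>v * p * q\<close> on the two sides cancel. What remains
        is that \<open>q + max 0 (p - q)\<close> and \<open>p + max 0 (q - p)\<close> both equal the
        maximum of \<open>p\<close> and \<open>q\<close>.\<close>
      have "\<theta> * q / y * (1 - v * p) + \<theta> * (max 0 (p - q) / y)
          = \<theta> * p / y * (1 - v * q) + \<theta> * (max 0 (q - p) / y)"
        using True by (simp add: field_simps max_def)
      then have "ennreal (\<theta> * q / y) * ennreal (1 - v * p) + ennreal \<theta> * ennreal (max 0 (p - q) / y)
          = ennreal (\<theta> * p / y) * ennreal (1 - v * q) + ennreal \<theta> * ennreal (max 0 (q - p) / y)"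
        using True assms pq by (simp add: ennreal_mult[symmetric] ennreal_plus[symmetric] del: ennreal_plus)
      then show ?thesis using True assms by (simp add: one p_def q_def)
    qed simp
  qed
  also have "\<dots> = ?R + ennreal (\<theta> * max 0 (ln a))"
    using F[of "1 / a" 1] assms by (subst nn_integral_add) simp_all
  finally show ?thesis .
qed

lemma nn_integral_gamma_intensity:
  fixes g :: "real \<Rightarrow> 'a \<Rightarrow> ennreal"
  assumes N: "prob_space N" and [measurable]: "(\<lambda>(x, s). g x s) \<in> borel_measurable (borel \<Otimes>\<^sub>M N)"
  shows "(\<integral>\<^sup>+x. \<integral>\<^sup>+s. g x s \<partial>N \<partial>gamma_intensity \<theta>)
    = (\<integral>\<^sup>+s. \<integral>\<^sup>+x. gamma_kernel \<theta> x * g x s \<partial>lborel \<partial>N)"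
proof -
  interpret N: prob_space N by (rule N)
  interpret pair_sigma_finite lborel N by unfold_locales
  have "(\<integral>\<^sup>+x. \<integral>\<^sup>+s. g x s \<partial>N \<partial>gamma_intensity \<theta>) = (\<integral>\<^sup>+x. gamma_kernel \<theta> x * (\<integral>\<^sup>+s. g x s \<partial>N) \<partial>lborel)"
    unfolding gamma_intensity_def by (rule nn_integral_density) measurable
  also have "\<dots> = (\<integral>\<^sup>+x. \<integral>\<^sup>+s. gamma_kernel \<theta> x * g x s \<partial>N \<partial>lborel)"
    by (intro nn_integral_cong nn_integral_cmult[symmetric]) measurable
  also have "\<dots> = (\<integral>\<^sup>+s. \<integral>\<^sup>+x. gamma_kernel \<theta> x * g x s \<partial>lborel \<partial>N)"
    by (rule Fubini'[symmetric]) measurable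
  finally show ?thesis .
qed

text \<open>The scaling identity with \<open>a = f s\<close>, integrated over \<open>s\<close>: its
  logarithmic terms become the integrals \<open>p\<close> and \<open>q\<close> of the positive and
  negative parts of \<open>ln f\<close>, and their difference supplies the constant.\<close>

lemma gamma_tilt:
  fixes \<phi> :: "real \<Rightarrow> ennreal" and f :: "'a \<Rightarrow> real"
  assumes [measurable]: "\<phi> \<in> borel_measurable borel" "f \<in> borel_measurable N"
    and N: "prob_space N" and f: "\<And>s. 0 < f s" and \<theta>: "0 \<le> \<theta>" and int: "integrable N (\<lambda>s. ln (f s))"
  shows "nexp (\<integral>\<^sup>+x. \<integral>\<^sup>+s. 1 - nexp (\<phi> (f s * x) + ennreal (f s * x)) \<partial>N \<partial>gamma_intensity \<theta>)
    = ennreal (exp (- \<theta> * (\<integral>s. ln (f s) \<partial>N))) *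
      nexp (\<integral>\<^sup>+x. \<integral>\<^sup>+s. 1 - nexp (\<phi> x + ennreal (x / f s)) \<partial>N \<partial>gamma_intensity \<theta>)"
    (is "nexp ?IL = _ * nexp ?IR")
proof -
  interpret N: prob_space N by (rule N)
  note swap = nn_integral_gamma_intensity[OF N]
  define p where "p = (\<integral>s. max 0 (ln (f s)) \<partial>N)"
  define q where "q = (\<integral>s. max 0 (- ln (f s)) \<partial>N)"
  have int': "integrable N (\<lambda>s. max 0 (ln (f s)))" "integrable N (\<lambda>s. max 0 (- ln (f s)))"
    using int by (auto intro!: Bochner_Integration.integrable_max)
  have pq: "(\<integral>s. ln (f s) \<partial>N) = p - q" "0 \<le> p" "0 \<le> q"
  proof -
    have "(\<integral>s. ln (f s) \<partial>N) = (\<integral>s. max 0 (ln (f s)) - max 0 (- ln (f s)) \<partial>N)"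
      by (rule Bochner_Integration.integral_cong) auto
    then show "(\<integral>s. ln (f s) \<partial>N) = p - q" unfolding p_def q_def using int' by simp
  qed (simp_all add: p_def q_def)
  have pos: "(\<integral>\<^sup>+s. ennreal (\<theta> * max 0 (ln (f s))) \<partial>N) = ennreal (\<theta> * p)"
    and neg: "(\<integral>\<^sup>+s. ennreal (\<theta> * max 0 (- ln (f s))) \<partial>N) = ennreal (\<theta> * q)"
    unfolding p_def q_def using int' \<theta>
    by (subst nn_integral_eq_integral; simp)+
  have "?IL + ennreal (\<theta> * q) = (\<integral>\<^sup>+s. (\<integral>\<^sup>+x. gamma_kernel \<theta> x * (1 - nexp (\<phi> (f s * x) + ennreal (f s * x))) \<partial>lborel)
      + ennreal (\<theta> * max 0 (- ln (f s))) \<partial>N)"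
    unfolding neg[symmetric] by (subst swap, measurable, subst nn_integral_add) simp_all
  also have "\<dots> = (\<integral>\<^sup>+s. (\<integral>\<^sup>+x. gamma_kernel \<theta> x * (1 - nexp (\<phi> x + ennreal (x / f s))) \<partial>lborel)
      + ennreal (\<theta> * max 0 (ln (f s))) \<partial>N)"
    by (intro nn_integral_cong gamma_intensity_scale f \<theta> assms(1))
  also have "\<dots> = ?IR + ennreal (\<theta> * p)"
    unfolding pos[symmetric] by (subst swap, measurable, subst nn_integral_add) simp_all
  finally have "nexp (?IL + ennreal (\<theta> * q)) = nexp (?IR + ennreal (\<theta> * p))" by (rule arg_cong)
  \<comment> \<open>Either exponent may be infinite, so nothing is subtracted there. After applying
    \<open>nexp\<close>, the finite terms are positive real factors, and one of them can be
    cancelled.\<close>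
  then have "nexp ?IL * ennreal (exp (- (\<theta> * q))) = nexp ?IR * ennreal (exp (- (\<theta> * p)))"
    unfolding nexp_add nexp_ennreal[OF mult_nonneg_nonneg[OF \<theta> pq(2)]]
      nexp_ennreal[OF mult_nonneg_nonneg[OF \<theta> pq(3)]] .
  then have "nexp ?IL * ennreal (exp (- (\<theta> * q))) * ennreal (exp (\<theta> * q))
      = nexp ?IR * ennreal (exp (- (\<theta> * p))) * ennreal (exp (\<theta> * q))" by simp
  then have "nexp ?IL * ennreal (exp (- (\<theta> * q)) * exp (\<theta> * q))
      = nexp ?IR * ennreal (exp (- (\<theta> * p)) * exp (\<theta> * q))" by (simp only: mult.assoc ennreal_mult exp_ge_zero)
  then show ?thesis by (simp add: pq exp_add[symmetric] algebra_simps)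
qed

section \<open>Laplace functionals determine laws of descending sequences\<close>

declare measurable_R_down_coordinate [measurable]

lemma nn_integral_le_1_less_top:
  assumes "finite_measure M" "\<And>x. g x \<le> 1"
  shows "(\<integral>\<^sup>+x. g x \<partial>M) < top"
proof -
  interpret finite_measure M by fact
  have "(\<integral>\<^sup>+x. g x \<partial>M) \<le> (\<integral>\<^sup>+x. 1 \<partial>M)" by (rule nn_integral_mono) (rule assms(2))
  then show ?thesis using emeasure_finite[of "space M"] by (auto simp: top_unique less_top[symmetric])
qed

lemma ennreal_add_left_cancel_less_top: "a + b = a + c \<Longrightarrow> a < top \<Longrightarrow> b = (c :: ennreal)"
  by (auto simp: ennreal_add_left_cancel)

text \<open>The event $c = n$ is isolated as $1_{c = n} = \lim_k e^{kn} e^{-kc} 1_{c \ge n}$, where the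
  functions on the right are bounded by 1 and the contribution of the values below $n$ is known by induction.\<close>

lemma indicator_of_nat_eqI:
  fixes W c :: "'b \<Rightarrow> ennreal"
  assumes [measurable]: "W \<in> borel_measurable M" "c \<in> borel_measurable M"
    and sets: "sets N = sets M" and fin: "finite_measure M" "finite_measure N"
    and W: "\<And>x. W x \<le> 1" and c: "\<And>x. c x = top \<or> (\<exists>n. c x = of_nat n)"
    and eq: "\<And>k. (\<integral>\<^sup>+x. W x * nexp (of_nat k * c x) \<partial>M) = (\<integral>\<^sup>+x. W x * nexp (of_nat k * c x) \<partial>N)"
  shows "(\<integral>\<^sup>+x. W x * indicator {x. c x = of_nat n} x \<partial>M) = (\<integral>\<^sup>+x. W x * indicator {x. c x = of_nat n} x \<partial>N)"
proof (induction n rule: less_induct)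
  case (less n)
  have mc [measurable_cong]: "sets N = sets M" by (rule sets)
  let ?I = "\<lambda>m x. indicator {x. c x = of_nat m} x :: ennreal"
  let ?G = "\<lambda>x. indicator {x. of_nat n \<le> c x} x :: ennreal"
  have split: "W x * nexp (of_nat k * c x)
      = (\<Sum>m<n. nexp (of_nat k * of_nat m) * (W x * ?I m x)) + W x * nexp (of_nat k * c x) * ?G x" for k x
  proof (cases "\<exists>m<n. c x = of_nat m")
    case True
    then obtain m where m: "m < n" "c x = of_nat m" by blast
    have "(\<Sum>i<n. nexp (of_nat k * of_nat i) * (W x * ?I i x))
        = (\<Sum>i<n. if i = m then nexp (of_nat k * of_nat i) * W x else 0)"
      by (rule sum.cong) (auto simp: m)
    moreover have "\<not> (of_nat n \<le> (of_nat m :: ennreal))" using m by simp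
    ultimately show ?thesis using m by (simp add: mult.commute)
  next
    case False
    then have "?I i x = 0" if "i < n" for i using that by (auto split: split_indicator)
    moreover have "of_nat n \<le> c x"
    proof (rule ccontr)
      assume "\<not> of_nat n \<le> c x"
      moreover from this obtain m where "c x = of_nat m" using c[of x] by (metis top_greatest)
      ultimately show False using False by (metis not_le of_nat_less_iff)
    qed
    ultimately show ?thesis by simp
  qed
  have W1: "W x * a \<le> 1" if "a \<le> 1" for x a using mult_mono[OF W that, of x] by simp
  have tail: "(\<integral>\<^sup>+x. W x * nexp (of_nat k * c x) * ?G x \<partial>M) = (\<integral>\<^sup>+x. W x * nexp (of_nat k * c x) * ?G x \<partial>N)" for k
  proof -
    let ?S = "\<lambda>K. \<Sum>m<n. nexp (of_nat k * of_nat m) * (\<integral>\<^sup>+x. W x * ?I m x \<partial>K)"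
    have s: "(\<integral>\<^sup>+x. W x * nexp (of_nat k * c x) \<partial>K) = ?S K + (\<integral>\<^sup>+x. W x * nexp (of_nat k * c x) * ?G x \<partial>K)"
      if [measurable_cong]: "sets K = sets M" for K
      by (subst split) (simp add: nn_integral_add nn_integral_sum nn_integral_cmult)
    have SS: "?S M = ?S N" by (rule sum.cong) (use less.IH in simp_all)
    have "?S M < top"
      using nn_integral_le_1_less_top[OF fin(1), of "\<lambda>x. W x * ?I m x" for m] W1
      by (simp add: less_top[symmetric] ennreal_mult_eq_top_iff indicator_def)
    have "?S N + (\<integral>\<^sup>+x. W x * nexp (of_nat k * c x) * ?G x \<partial>M)
        = ?S N + (\<integral>\<^sup>+x. W x * nexp (of_nat k * c x) * ?G x \<partial>N)"
      using eq[of k] unfolding s[OF refl] s[OF sets] SS .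
    then show ?thesis
      by (rule ennreal_add_left_cancel_less_top) (use \<open>?S M < top\<close> in \<open>simp only: SS\<close>)
  qed
  define V where "V k x = ennreal (exp (real k * real n)) * (W x * nexp (of_nat k * c x) * ?G x)" for k x
  have V_le: "V k x \<le> 1" and V_lim: "(\<lambda>k. V k x) \<longlonglongrightarrow> W x * ?I n x" for k x
  proof -
    consider "\<not> of_nat n \<le> c x" | "c x = top" | m where "c x = of_nat m" "n < m" | "c x = of_nat n"
    proof (cases "of_nat n \<le> c x")
      case False
      then show thesis by (rule that(1))
    next
      case le: True
      show thesis
      proof (cases "c x = top")
        case True
        then show thesis by (rule that(2))
      next
        case False
        then obtain m where m: "c x = of_nat m" using c[of x] by blast
        then have "n \<le> m" using le by simp
        then show thesis using m that(3)[of m] that(4) by (cases "n = m") simp_all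
      qed
    qed
    then have "V k x \<le> 1 \<and> (\<lambda>k. V k x) \<longlonglongrightarrow> W x * ?I n x"
    proof cases
      case 1
      then have "c x \<noteq> of_nat n" by auto
      with 1 show ?thesis by (simp add: V_def)
    next
      case 2
      \<comment> \<open>At \<open>k = 0\<close> the exponent is 0 * \<infinity> = 0, so
        \<open>V 0 x\<close> is \<open>W x\<close> and need not vanish; the limit is therefore read
        off from the shifted sequence.\<close>
      have "(\<lambda>k. V (Suc k) x) \<longlonglongrightarrow> 0" using 2 by (simp add: V_def ennreal_mult_top)
      then have "(\<lambda>k. V k x) \<longlonglongrightarrow> 0" by (rule LIMSEQ_imp_Suc)
      moreover have "V k x \<le> 1" using 2 W1[of 1 x] by (cases k) (simp_all add: V_def ennreal_mult_top)
      ultimately show ?thesis using 2 by simp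
    next
      case 3
      have V: "V k x = W x * ennreal (exp (- (real k * (real m - real n))))" for k
      proof -
        have "nexp (of_nat k * of_nat m) = ennreal (exp (- (real k * real m)))"
          using nexp_ennreal[of "real k * real m"] by (simp add: ennreal_mult ennreal_of_nat_eq_real_of_nat)
        then show ?thesis using 3
          by (simp add: V_def mult.left_commute ennreal_mult[symmetric] exp_add[symmetric] algebra_simps)
      qed
      have "(\<lambda>k. exp (- (real k * (real m - real n)))) \<longlonglongrightarrow> 0"
        using 3 by (intro filterlim_compose[OF exp_at_bot] filterlim_uminus_at_bot_at_top[THEN filterlim_compose]
          filterlim_at_top_mult_tendsto_pos[OF tendsto_const] filterlim_real_sequentially) simp
      then have "(\<lambda>k. ennreal (exp (- (real k * (real m - real n))))) \<longlonglongrightarrow> ennreal 0" by (rule tendsto_ennrealI)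
      then have "(\<lambda>k. W x * ennreal (exp (- (real k * (real m - real n))))) \<longlonglongrightarrow> W x * ennreal 0"
        using W[of x] by (intro ennreal_tendsto_cmult) (simp_all add: order_le_less_trans[of _ 1])
      moreover have "V k x \<le> 1" unfolding V using 3 by (intro W1) (simp add: ennreal_le_1)
      ultimately show ?thesis using 3 by (simp add: V)
    next
      case 4
      have "V k x = W x" for k
      proof -
        have "nexp (of_nat k * of_nat n) = ennreal (exp (- (real k * real n)))"
          using nexp_ennreal[of "real k * real n"] by (simp add: ennreal_mult ennreal_of_nat_eq_real_of_nat)
        then show ?thesis using 4
          by (simp add: V_def mult.left_commute ennreal_mult[symmetric] exp_add[symmetric])
      qed
      then show ?thesis using 4 W[of x] by simp
    qed
    then show "V k x \<le> 1" "(\<lambda>k. V k x) \<longlonglongrightarrow> W x * ?I n x" by auto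
  qed
  have lim: "(\<lambda>k. \<integral>\<^sup>+x. V k x \<partial>K) \<longlonglongrightarrow> (\<integral>\<^sup>+x. W x * ?I n x \<partial>K)"
    if [measurable_cong]: "sets K = sets M" and K: "finite_measure K" for K
  proof (rule nn_integral_dominated_convergence[where w = "\<lambda>_. 1"])
    show "V k \<in> borel_measurable K" for k unfolding V_def[abs_def] by measurable
    show "(\<integral>\<^sup>+x. 1 \<partial>K) < \<infinity>" using nn_integral_le_1_less_top[OF K, of "\<lambda>_. 1"] by simp
  qed (simp_all add: V_le V_lim)
  have "(\<integral>\<^sup>+x. V k x \<partial>M) = (\<integral>\<^sup>+x. V k x \<partial>N)" for k
    unfolding V_def by (simp add: nn_integral_cmult tail)
  then show ?case
    using LIMSEQ_unique[OF lim[OF refl fin(1)]] lim[OF sets fin(2)] by simp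
qed

text \<open>Adding a multiple of the indicator of \<open>{t<..}\<close> to \<phi> tests the number
  of entries above \<open>t\<close>, and for a descending sequence this number decides whether a
  given coordinate exceeds \<open>t\<close>. The coordinates are constrained one at a time, by
  induction with \<phi> arbitrary, so that the weight needed for the next coordinate is available in
  the induction hypothesis.\<close>

lemma R_down_measure_eqI:
  fixes M N :: "(nat \<Rightarrow> real) measure"
  assumes sets_M: "sets M = sets R_down_space" and sets_N: "sets N = sets R_down_space"
    and fin: "finite_measure M" "finite_measure N"
    and eq: "\<And>\<phi> :: real \<Rightarrow> ennreal. \<phi> \<in> borel_measurable borel \<Longrightarrow> \<phi> 0 = 0 \<Longrightarrow>
      (\<integral>\<^sup>+x. nexp (\<Sum>i. \<phi> (x i)) \<partial>M) = (\<integral>\<^sup>+x. nexp (\<Sum>i. \<phi> (x i)) \<partial>N)"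
  shows "M = N"
proof -
  note [measurable_cong] = sets_M sets_N
  have space: "space M = R_down" "space N = R_down"
    using sets_eq_imp_space_eq[OF sets_M] sets_eq_imp_space_eq[OF sets_N] by simp_all
  have box: "(\<integral>\<^sup>+x. (\<Prod>j\<in>J. indicator (A j) (x j)) * nexp (\<Sum>i. \<phi> (x i)) \<partial>M)
      = (\<integral>\<^sup>+x. (\<Prod>j\<in>J. indicator (A j) (x j)) * nexp (\<Sum>i. \<phi> (x i)) \<partial>N)"
    if "finite J" "\<And>j. j \<in> J \<Longrightarrow> A j \<in> sets borel" "\<phi> \<in> borel_measurable borel" "\<phi> 0 = 0"
    for J A and \<phi> :: "real \<Rightarrow> ennreal"
    using that
  proof (induction J arbitrary: \<phi> rule: finite_induct)
    case empty
    then show ?case by (simp add: eq)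
  next
    case (insert j J)
    have [measurable]: "A i \<in> sets borel" if "i \<in> J" for i using insert that by simp
    have [measurable]: "A j \<in> sets borel" "\<phi> \<in> borel_measurable borel" using insert by simp_all
    define W where "W x = (\<Prod>j\<in>J. indicator (A j) (x j)) * nexp (\<Sum>i. \<phi> (x i))" for x
    have W_R [measurable]: "W \<in> borel_measurable R_down_space"
      unfolding W_def[abs_def] by measurable
    have W: "W x \<le> 1" for x
    proof -
      have "(\<Prod>j\<in>J. indicator (A j) (x j) :: ennreal) \<le> 1"
        by (rule prod_le_1) (simp split: split_indicator)
      from mult_mono[OF this nexp_le_1[of "\<Sum>i. \<phi> (x i)"]] show ?thesis by (simp add: W_def)
    qed
    have W_ind: "W x * indicator B y \<le> 1" for x y and B :: "'c set"
      using W[of x] by (simp split: split_indicator)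
    have distr: "emeasure (distr (density K W) borel (\<lambda>x. x j)) B = (\<integral>\<^sup>+x. W x * indicator B (x j) \<partial>K)"
      if [measurable_cong]: "sets K = sets R_down_space" and [measurable]: "B \<in> sets borel" for K B
    proof -
      have "emeasure (distr (density K W) borel (\<lambda>x. x j)) B
          = (\<integral>\<^sup>+x. W x * indicator ((\<lambda>x. x j) -` B \<inter> space K) x \<partial>K)"
        by (simp add: emeasure_distr emeasure_density)
      also have "\<dots> = (\<integral>\<^sup>+x. W x * indicator B (x j) \<partial>K)"
        by (rule nn_integral_cong) (simp split: split_indicator)
      finally show ?thesis .
    qed
    have above: "(\<integral>\<^sup>+x. W x * indicator {t<..} (x j) \<partial>M) = (\<integral>\<^sup>+x. W x * indicator {t<..} (x j) \<partial>N)" for t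
    proof (cases "t < 0")
      case True
      have "(\<integral>\<^sup>+x. W x * indicator {t<..} (x j) \<partial>K) = (\<integral>\<^sup>+x. W x \<partial>K)" if "space K = R_down" for K
        by (rule nn_integral_cong) (use True that in \<open>auto simp: R_down_def less_le_trans split: split_indicator\<close>)
      then show ?thesis using insert.IH[of \<phi>] insert.prems space by (simp add: W_def)
    next
      case False
      \<comment> \<open>Nonnegativity of \<open>t\<close> matters: the modified test function must
        still vanish at 0. Negative thresholds were treated apart, since every entry of a sequence
        in \<open>R_down\<close> exceeds them.\<close>
      define c where "c = count_above t"
      have [measurable]: "c \<in> borel_measurable R_down_space"
        unfolding c_def count_above_def[abs_def] by measurable
      have level: "(\<integral>\<^sup>+x. W x * indicator {x. c x = of_nat m} x \<partial>M)
          = (\<integral>\<^sup>+x. W x * indicator {x. c x = of_nat m} x \<partial>N)" for m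
      proof (rule indicator_of_nat_eqI[OF _ _ _ fin W])
        show "W \<in> borel_measurable M" "c \<in> borel_measurable M" by measurable
        show "sets N = sets M" by (simp add: sets_M sets_N)
        show "c x = top \<or> (\<exists>n. c x = of_nat n)" for x
          unfolding c_def count_above_eq_emeasure by (cases "finite {i. t < x i}") simp_all
        fix k :: nat
        have "W x * nexp (of_nat k * c x) = (\<Prod>j\<in>J. indicator (A j) (x j)) *
            nexp (\<Sum>i. \<phi> (x i) + of_nat k * indicator {t<..} (x i))" for x
        proof -
          have "(\<Sum>i. \<phi> (x i) + of_nat k * indicator {t<..} (x i))
              = (\<Sum>i. \<phi> (x i)) + of_nat k * c x"
            unfolding c_def count_above_def by (subst suminf_add[symmetric]) simp_all
          then show ?thesis by (simp add: W_def nexp_add mult.assoc)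
        qed
        moreover have "(\<lambda>z. \<phi> z + of_nat k * indicator {t<..} z) \<in> borel_measurable borel" by measurable
        ultimately show "(\<integral>\<^sup>+x. W x * nexp (of_nat k * c x) \<partial>M) = (\<integral>\<^sup>+x. W x * nexp (of_nat k * c x) \<partial>N)"
          using insert.IH[of "\<lambda>z. \<phi> z + of_nat k * indicator {t<..} z"] insert.prems False by simp
      qed
      \<comment> \<open>The complement of \<open>t < x j\<close> is the disjoint union of the events
        \<open>c x = of_nat m\<close> with \<open>m \<le> j\<close>. Their integrals are finite and
        known to agree, so they can be subtracted.\<close>
      have sum: "(\<integral>\<^sup>+x. W x \<partial>K) = (\<Sum>m\<le>j. \<integral>\<^sup>+x. W x * indicator {x. c x = of_nat m} x \<partial>K)
          + (\<integral>\<^sup>+x. W x * indicator {t<..} (x j) \<partial>K)"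
        if K [measurable_cong]: "sets K = sets R_down_space" and sp: "space K = R_down" for K
      proof -
        have "(\<integral>\<^sup>+x. W x \<partial>K) = (\<integral>\<^sup>+x. (\<Sum>m\<le>j. W x * indicator {x. c x = of_nat m} x) + W x * indicator {t<..} (x j) \<partial>K)"
        proof (rule nn_integral_cong)
          fix x assume "x \<in> space K"
          then have "decseq x" using sp by (simp add: R_down_def)
          from decseq_less_iff_count_above[OF this, of t j]
          have gt: "t < x j \<longleftrightarrow> of_nat j < c x" by (simp add: c_def)
          show "W x = (\<Sum>m\<le>j. W x * indicator {x. c x = of_nat m} x) + W x * indicator {t<..} (x j)"
          proof (cases "of_nat j < c x")
            case True
            then have "indicator {x. c x = of_nat m} x = (0::ennreal)" if "m \<le> j" for m
              using that by (auto split: split_indicator)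
            then show ?thesis using True gt by simp
          next
            case False
            then obtain m where m: "c x = of_nat m"
              unfolding c_def count_above_eq_emeasure
              by (cases "finite {i. t < x i}") (auto simp: of_nat_less_top)
            with False have "m \<le> j" by simp
            have "(\<Sum>i\<le>j. W x * indicator {x. c x = of_nat i} x) = (\<Sum>i\<le>j. if i = m then W x else 0)"
              by (rule sum.cong) (auto simp: m)
            then show ?thesis using False gt \<open>m \<le> j\<close> by simp
          qed
        qed
        also have "\<dots> = (\<Sum>m\<le>j. \<integral>\<^sup>+x. W x * indicator {x. c x = of_nat m} x \<partial>K)
          + (\<integral>\<^sup>+x. W x * indicator {t<..} (x j) \<partial>K)"
          by (subst nn_integral_add, simp, simp, subst nn_integral_sum) simp_all
        finally show ?thesis .
      qed
      let ?S = "\<lambda>K. \<Sum>m\<le>j. \<integral>\<^sup>+x. W x * indicator {x. c x = of_nat m} x \<partial>K"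
      have "?S M = ?S N" by (simp add: level)
      moreover have "?S M < top"
      proof -
        have "(\<integral>\<^sup>+x. W x * indicator {x. c x = of_nat m} x \<partial>M) \<noteq> top" for m
          using nn_integral_le_1_less_top[OF fin(1), of "\<lambda>x. W x * indicator {x. c x = of_nat m} x", OF W_ind]
          by (simp only: less_top)
        then show ?thesis by (simp add: less_top[symmetric])
      qed
      moreover have "(\<integral>\<^sup>+x. W x \<partial>M) = (\<integral>\<^sup>+x. W x \<partial>N)"
        using insert.IH[of \<phi>] insert.prems by (simp add: W_def)
      ultimately show ?thesis
        unfolding sum[OF sets_M space(1)] sum[OF sets_N space(2)]
        by (simp only: ennreal_add_left_cancel_less_top)
    qed
    have "distr (density M W) borel (\<lambda>x. x j) = distr (density N W) borel (\<lambda>x. x j)"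
    proof (rule measure_eqI_lessThan)
      show "emeasure (distr (density M W) borel (\<lambda>x. x j)) {t<..}
          = emeasure (distr (density N W) borel (\<lambda>x. x j)) {t<..}" for t
        by (simp add: distr sets_M sets_N above)
      show "emeasure (distr (density M W) borel (\<lambda>x. x j)) {t<..} < \<infinity>" for t
        using nn_integral_le_1_less_top[OF fin(1) W_ind] by (simp add: distr sets_M)
    qed simp_all
    then have "(\<integral>\<^sup>+x. W x * indicator (A j) (x j) \<partial>M) = (\<integral>\<^sup>+x. W x * indicator (A j) (x j) \<partial>N)"
      using distr[OF sets_M, of "A j"] distr[OF sets_N, of "A j"] by simp
    then show ?case using insert by (simp add: W_def mult_ac)
  qed
  \<comment> \<open>With \<phi> = 0 the weighted integrals are the masses of cylinder sets, which
    determine a finite measure on the full sequence space. The restriction to \<open>R_down\<close>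
    is recovered at the end.\<close>
  have "distr M (\<Pi>\<^sub>M i\<in>UNIV. borel) (\<lambda>x. x) = distr N (\<Pi>\<^sub>M i\<in>UNIV. borel) (\<lambda>x. x)"
  proof (rule measure_eqI_PiM_infinite[where I = UNIV and M = "\<lambda>_::nat. borel :: real measure"])
    have id [measurable]: "(\<lambda>x. x) \<in> measurable R_down_space (\<Pi>\<^sub>M i\<in>(UNIV::nat set). (borel :: real measure))"
      by (intro measurable_PiM_single') auto
    show "finite_measure (distr M (\<Pi>\<^sub>M i\<in>UNIV. borel) (\<lambda>x. x))"
      by (rule finite_measure.finite_measure_distr[OF fin(1)]) measurable
    fix A :: "nat \<Rightarrow> real set" and J assume J: "finite J" "\<And>i. i \<in> J \<Longrightarrow> A i \<in> sets borel"
    let ?E = "prod_emb UNIV (\<lambda>_. borel) J (Pi\<^sub>E J A)"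
    have E [measurable]: "?E \<in> sets (\<Pi>\<^sub>M i\<in>UNIV. borel)" using J by (intro sets_PiM_I) auto
    have "emeasure (distr K (\<Pi>\<^sub>M i\<in>UNIV. borel) (\<lambda>x. x)) ?E
        = (\<integral>\<^sup>+x. (\<Prod>j\<in>J. indicator (A j) (x j)) * nexp (\<Sum>i. (\<lambda>_. 0) (x i)) \<partial>K)"
      if [measurable_cong]: "sets K = sets R_down_space" for K
    proof -
      have "emeasure (distr K (\<Pi>\<^sub>M i\<in>UNIV. borel) (\<lambda>x. x)) ?E = (\<integral>\<^sup>+x. indicator (?E \<inter> space K) x \<partial>K)"
        by (subst emeasure_distr) simp_all
      also have "\<dots> = (\<integral>\<^sup>+x. (\<Prod>j\<in>J. indicator (A j) (x j)) \<partial>K)"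
      proof (rule nn_integral_cong)
        fix x assume "x \<in> space K"
        then show "indicator (?E \<inter> space K) x = (\<Prod>j\<in>J. indicator (A j) (x j) :: ennreal)"
          using J(1) by (auto simp: prod_emb_def PiE_iff restrict_def extensional_def indicator_def prod.If_cases
              intro!: prod_zero)
      qed
      finally show ?thesis by simp
    qed
    then show "emeasure (distr M (\<Pi>\<^sub>M i\<in>UNIV. borel) (\<lambda>x. x)) ?E
        = emeasure (distr N (\<Pi>\<^sub>M i\<in>UNIV. borel) (\<lambda>x. x)) ?E"
      using box[of J A "\<lambda>_. 0"] J sets_M sets_N by simp
  qed simp_all
  note D = this
  show ?thesis
  proof (rule measure_eqI)
    show "sets M = sets N" by (simp add: sets_M sets_N)
    fix E assume "E \<in> sets M"
    then obtain B where B: "B \<in> sets (borel :: (nat \<Rightarrow> real) measure)" "E = B \<inter> R_down"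
      unfolding sets_M sets_restrict_space by auto
    have [measurable]: "B \<in> sets (\<Pi>\<^sub>M i\<in>UNIV. borel)" using B by (simp add: sets_borel_seq)
    have id [measurable]: "(\<lambda>x. x) \<in> measurable R_down_space (\<Pi>\<^sub>M i\<in>(UNIV::nat set). (borel :: real measure))"
      by (intro measurable_PiM_single') auto
    have "emeasure (distr K (\<Pi>\<^sub>M i\<in>UNIV. borel) (\<lambda>x. x)) B = emeasure K E"
      if [measurable_cong]: "sets K = sets R_down_space" and "space K = R_down" for K
      by (subst emeasure_distr) (simp_all add: B that)
    then show "emeasure M E = emeasure N E" using D sets_M sets_N space by metis
  qed
qed

section \<open>The density of the labelled laws\<close>

text \<open>The Laplace exponent of the gamma law with shape \<theta>, obtained as the Frullani
  integral between the rates 1 and \<open>1 + a\<close>.\<close>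

lemma nn_integral_exponential_jumps:
  assumes "0 \<le> a" "0 \<le> \<theta>"
  shows "(\<integral>\<^sup>+x. gamma_kernel \<theta> x * (1 - nexp (ennreal (a * x))) \<partial>lborel)
    = ennreal (\<theta> * ln (1 + a))"
proof -
  have "(\<integral>\<^sup>+x. gamma_kernel \<theta> x * (1 - nexp (ennreal (a * x))) \<partial>lborel)
    = (\<integral>\<^sup>+x. ennreal \<theta> * (indicator {0<..} x * ennreal (max 0 (exp (- (1 * x)) - exp (- ((1 + a) * x))) / x)) \<partial>lborel)"
  proof (rule nn_integral_cong)
    fix x :: real
    show "gamma_kernel \<theta> x * (1 - nexp (ennreal (a * x)))
      = ennreal \<theta> * (indicator {0<..} x * ennreal (max 0 (exp (- (1 * x)) - exp (- ((1 + a) * x))) / x))"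
    proof (cases "0 < x")
      case True
      have "0 \<le> a * x" using True assms by simp
      have "exp (- ((1 + a) * x)) = exp (- x) * exp (- (a * x))"
        by (simp add: exp_add[symmetric] algebra_simps)
      moreover have "1 - nexp (ennreal (a * x)) = ennreal (1 - exp (- (a * x)))"
        using \<open>0 \<le> a * x\<close> by (simp add: nexp_ennreal ennreal_minus flip: ennreal_1)
      moreover have "max 0 (exp (- x) - exp (- x) * exp (- (a * x))) = exp (- x) * (1 - exp (- (a * x)))"
        using \<open>0 \<le> a * x\<close> by (simp add: max_def algebra_simps)
      ultimately show ?thesis using True assms \<open>0 \<le> a * x\<close>
        by (simp add: ennreal_mult[symmetric])
    qed simp
  qed
  also have "\<dots> = ennreal \<theta> * ennreal (max 0 (ln ((1 + a) / 1)))"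
    using frullani[of 1 "1 + a"] assms by (subst nn_integral_cmult) simp_all
  finally show ?thesis using assms by (simp add: ennreal_mult)
qed

section \<open>The marked gamma process and its total mass\<close>

locale gamma_marked =
  fixes P :: "'w measure" and \<theta> \<beta> :: real and \<nu>\<^sub>0 :: "'a::metric_space measure"
    and \<gamma> :: "nat \<Rightarrow> 'w \<Rightarrow> real" and \<xi> :: "nat \<Rightarrow> 'w \<Rightarrow> 'a"
  assumes nu: "prob_space \<nu>\<^sub>0" "sets \<nu>\<^sub>0 = sets borel"
    and \<theta>: "0 < \<theta>" and \<beta>: "0 < \<beta>" and gs: "gamma_setup P \<theta> \<nu>\<^sub>0 \<gamma> \<xi>"
begin

sublocale P: prob_space P using gs by (simp add: gamma_setup_def)
sublocale nu: prob_space \<nu>\<^sub>0 by (rule nu(1))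
abbreviation mark_law :: "(nat \<Rightarrow> 'a) measure" where
  "mark_law \<equiv> \<Pi>\<^sub>M i\<in>UNIV. \<nu>\<^sub>0"

sublocale PiM: prob_space mark_law by (rule prob_space_PiM) (rule nu(1))

lemma poisson: "poisson_points P (gamma_intensity \<theta>) \<gamma>"
  using gs by (simp add: gamma_setup_def gamma_points_def)

lemma sets_gamma_intensity: "sets (gamma_intensity \<theta>) = sets borel"
  by (simp add: gamma_intensity_def)

lemma marks: "iid P \<nu>\<^sub>0 \<xi>" "indep_sequences P \<gamma> \<xi>"
  using gs by (simp_all add: gamma_setup_def)

lemmas marked_setup = P.prob_space_axioms poisson sets_gamma_intensity marks nu

lemma AE_gamma_points: "AE w in P. \<forall>i. 0 < \<gamma> i w \<and> \<gamma> (Suc i) w < \<gamma> i w"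
  using gs by (simp add: gamma_setup_def gamma_points_def)

lemma measurable_\<gamma> [measurable]: "\<gamma> i \<in> borel_measurable P"
  by (rule measurable_poisson_points[OF P.prob_space_axioms poisson sets_gamma_intensity])

lemma measurable_\<xi> [measurable]: "\<xi> i \<in> measurable P borel" "\<xi> i \<in> measurable P \<nu>\<^sub>0"
proof -
  show *: "\<xi> i \<in> measurable P borel"
    by (rule measurable_marks[OF marked_setup])
  then show "\<xi> i \<in> measurable P \<nu>\<^sub>0" using nu(2) by (simp cong: measurable_cong_sets)
qed

end

locale gamma_tilted = gamma_marked P \<theta> \<beta> \<nu>\<^sub>0 \<gamma> \<xi>
  for P :: "'w measure" and \<theta> \<beta> and \<nu>\<^sub>0 :: "'a::metric_space measure" and \<gamma> \<xi> +
  fixes f :: "'a \<Rightarrow> real"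
  assumes f: "f \<in> B_plus" and ln_f: "integrable \<nu>\<^sub>0 (\<lambda>s. ln (f s))"
begin

lemma measurable_f [measurable]: "f \<in> borel_measurable borel" "f \<in> borel_measurable \<nu>\<^sub>0"
  using f nu(2) by (auto simp: B_plus_def cong: measurable_cong_sets)

lemma f_pos: "0 < f s"
  using f by (auto simp: B_plus_def intro: less_le_trans)

text \<open>The mass is finite with probability $\lim_{\epsilon \to 0} E e^{-\epsilon S}$, and
  $E e^{-\epsilon S} = \exp(-\theta \int \ln(1 + \epsilon f)\, d\nu_0) \to 1$.\<close>

lemma AE_summable_marked: "AE w in P. summable (\<lambda>i. f (\<xi> i w) * \<gamma> i w)"
proof -
  define S where "S w = (\<Sum>i. ennreal (f (\<xi> i w) * \<gamma> i w))" for w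
  have [measurable]: "S \<in> borel_measurable P" unfolding S_def[abs_def] by measurable
  define e where "e n = 1 / real (Suc n)" for n
  have e: "0 < e n" "e n \<le> 1" for n by (simp_all add: e_def)
  define I where "I n = (\<integral>\<^sup>+s. ennreal (\<theta> * ln (1 + e n * f s)) \<partial>\<nu>\<^sub>0)" for n
  have laplace: "(\<integral>\<^sup>+w. nexp (\<Sum>i. ennreal (e n * f (\<xi> i w) * \<gamma> i w)) \<partial>P) = nexp (I n)" for n
  proof -
    have "(\<integral>\<^sup>+w. nexp (\<Sum>i. ennreal (e n * f (\<xi> i w) * \<gamma> i w)) \<partial>P)
        = nexp (\<integral>\<^sup>+x. \<integral>\<^sup>+s. 1 - nexp (ennreal (e n * f s * x)) \<partial>\<nu>\<^sub>0 \<partial>gamma_intensity \<theta>)"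
      using laplace_marked[OF marked_setup, of "\<lambda>(x, s). ennreal (e n * f s * x)"] by simp
    also have "(\<integral>\<^sup>+x. \<integral>\<^sup>+s. 1 - nexp (ennreal (e n * f s * x)) \<partial>\<nu>\<^sub>0 \<partial>gamma_intensity \<theta>) = I n"
      unfolding I_def
      by (subst nn_integral_gamma_intensity[OF nu(1)], measurable,
          intro nn_integral_cong nn_integral_exponential_jumps)
         (use \<theta> e f_pos in \<open>auto simp: less_imp_le\<close>)
    finally show ?thesis .
  qed
  have "I \<longlonglongrightarrow> (\<integral>\<^sup>+s. ennreal (\<theta> * ln (1 + 0 * f s)) \<partial>\<nu>\<^sub>0)"
    unfolding I_def
  \<comment> \<open>The bound rests on \<open>e n \<le> 1\<close>: the logarithm is at most that of
    \<open>2 * f s\<close> when \<open>f s \<ge> 1\<close>, and at most \<open>ln 2\<close>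
    otherwise.\<close>
  proof (rule nn_integral_dominated_convergence[where w = "\<lambda>s. ennreal (\<theta> * (ln 2 + \<bar>ln (f s)\<bar>))"])
    show "AE s in \<nu>\<^sub>0. ennreal (\<theta> * ln (1 + e n * f s)) \<le> ennreal (\<theta> * (ln 2 + \<bar>ln (f s)\<bar>))" for n
    proof (intro AE_I2 ennreal_leI mult_left_mono)
      fix s
      have fs: "0 < f s" "e n * f s \<le> f s" "0 < e n * f s" using f_pos[of s] e[of n] by simp_all
      show "ln (1 + e n * f s) \<le> ln 2 + \<bar>ln (f s)\<bar>"
      proof (cases "1 \<le> f s")
        case True
        then have "ln (1 + e n * f s) \<le> ln (2 * f s)" using fs by (subst ln_le_cancel_iff) linarith+
        then show ?thesis using fs True by (simp add: ln_mult)
      next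
        case False
        then have "ln (1 + e n * f s) \<le> ln 2" using fs by (subst ln_le_cancel_iff) linarith+
        then show ?thesis by linarith
      qed
    qed (use \<theta> in simp)
    have "integrable \<nu>\<^sub>0 (\<lambda>s. \<theta> * (ln 2 + \<bar>ln (f s)\<bar>))" using ln_f by simp
    then show "(\<integral>\<^sup>+s. ennreal (\<theta> * (ln 2 + \<bar>ln (f s)\<bar>)) \<partial>\<nu>\<^sub>0) < \<infinity>"
      using \<theta> by (subst nn_integral_eq_integral) simp_all
    have "e \<longlonglongrightarrow> 0" unfolding e_def using LIMSEQ_inverse_real_of_nat by (simp add: inverse_eq_divide)
    then have "(\<lambda>n. ennreal (\<theta> * ln (1 + e n * f s))) \<longlonglongrightarrow> ennreal (\<theta> * ln (1 + 0 * f s))" for s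
      by (intro tendsto_ennrealI tendsto_mult tendsto_ln tendsto_add tendsto_const) simp_all
    then show "AE s in \<nu>\<^sub>0. (\<lambda>n. ennreal (\<theta> * ln (1 + e n * f s))) \<longlonglongrightarrow> ennreal (\<theta> * ln (1 + 0 * f s))" by simp
  qed measurable
  then have "(\<lambda>n. nexp (I n)) \<longlonglongrightarrow> nexp 0" by (intro tendsto_nexp) simp
  \<comment> \<open>Where the sum is infinite, every positive multiple of it is infinite and
    \<open>nexp\<close> vanishes; elsewhere \<open>nexp\<close> is at most 1. The Laplace transform
    is thus a lower bound for the probability of finiteness.\<close>
  moreover have "nexp (I n) \<le> emeasure P {w \<in> space P. S w < top}" for n
  proof -
    have "nexp (I n) \<le> (\<integral>\<^sup>+w. indicator {w \<in> space P. S w < top} w \<partial>P)"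
      unfolding laplace[symmetric]
    proof (rule nn_integral_mono)
      fix w assume "w \<in> space P"
      have "(\<Sum>i. ennreal (e n * f (\<xi> i w) * \<gamma> i w)) = ennreal (e n) * S w"
        using e[of n] unfolding S_def by (simp add: ennreal_mult' mult.assoc less_imp_le)
      then show "nexp (\<Sum>i. ennreal (e n * f (\<xi> i w) * \<gamma> i w)) \<le> indicator {w \<in> space P. S w < top} w"
        using e[of n] \<open>w \<in> space P\<close> by (cases "S w < top") (simp_all add: ennreal_mult_top less_top[symmetric])
    qed
    then show ?thesis by simp
  qed
  ultimately have "1 \<le> emeasure P {w \<in> space P. S w < top}"
    by (intro LIMSEQ_le_const2) auto
  then have "P.prob {w \<in> space P. S w < top} = 1"
    using P.prob_le_1 by (simp add: P.emeasure_eq_measure antisym)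
  then have "AE w in P. S w < top" by (subst (asm) P.prob_Collect_eq_1) simp_all
  with AE_gamma_points show ?thesis
  proof eventually_elim
    case (elim w)
    then have "S w \<noteq> top" by simp
    then show ?case unfolding S_def
      by (rule summable_suminf_not_top[rotated]) (use elim f_pos in \<open>simp add: less_imp_le\<close>)
  qed
qed

end

text \<open>The untransformed mass is the case of the constant function 1, whose logarithm is
  trivially integrable.\<close>

lemma (in gamma_marked) AE_summable_points: "AE w in P. summable (\<lambda>i. \<gamma> i w)"
proof -
  interpret gamma_tilted P \<theta> \<beta> \<nu>\<^sub>0 \<gamma> \<xi> "\<lambda>_. 1"
    by unfold_locales (auto simp: B_plus_def intro: exI[of _ 1])
  show ?thesis using AE_summable_marked by simp
qed

context gamma_tilted
begin

lemma AE_descending_points: "AE w in P. descending (\<lambda>i. \<beta> * \<gamma> i w) = (\<lambda>i. \<beta> * \<gamma> i w) \<and> (\<lambda>i. \<beta> * \<gamma> i w) \<in> R_down"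
  using AE_gamma_points AE_summable_points
proof eventually_elim
  case (elim w)
  have "decseq (\<lambda>i. \<beta> * \<gamma> i w)" using elim \<beta> by (intro decseq_SucI) (simp add: less_imp_le)
  then have "(\<lambda>i. \<beta> * \<gamma> i w) \<in> R_down" using elim \<beta> by (simp add: R_down_def less_imp_le)
  then show ?case by (simp add: descending_id)
qed

section \<open>The density as an average over fresh marks\<close>

abbreviation tilt :: "(nat \<Rightarrow> real) \<Rightarrow> (nat \<Rightarrow> 'a) \<Rightarrow> real" where
  "tilt x y \<equiv> exp (- (\<Sum>i. inverse \<beta> * (inverse (f (y i)) - 1) * x i))"

text \<open>The exponent is the difference of two convergent sums; convergence of the one involving
  \<open>f\<close> uses the lower bound of \<open>f\<close>. As that sum is nonnegative, the tilt is
  bounded uniformly in the marks, and the weight in the second claim cancels precisely the part that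
  could make it large.\<close>

lemma integrable_tilt:
  assumes "x \<in> R_down"
  shows "integrable mark_law (\<lambda>y. tilt x y)"
    and "nexp (\<Sum>i. ennreal (x i / \<beta>)) * ennreal (tilt x y)
      = nexp (\<Sum>i. ennreal (x i / (\<beta> * f (y i))))"
proof -
  have x: "0 \<le> x i" "summable x" for i using assms by (simp_all add: R_down_def)
  obtain c where c: "0 < c" "\<And>s. c \<le> f s" using f by (auto simp: B_plus_def)
  have 1: "summable (\<lambda>i. x i / \<beta>)" using x by (intro summable_divide)
  have 2: "summable (\<lambda>i. x i / (\<beta> * f (y i)))" for y
  proof (rule summable_comparison_test')
    show "summable (\<lambda>i. x i / (\<beta> * c))" using x by (intro summable_divide)
    show "norm (x i / (\<beta> * f (y i))) \<le> x i / (\<beta> * c)" for i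
      using x(1)[of i] c \<beta> f_pos[of "y i"] by (auto intro!: divide_left_mono mult_left_mono)
  qed
  have eq: "(\<Sum>i. inverse \<beta> * (inverse (f (y i)) - 1) * x i) = (\<Sum>i. x i / (\<beta> * f (y i))) - (\<Sum>i. x i / \<beta>)" for y
    unfolding suminf_diff[OF 2 1]
  proof (rule suminf_cong)
    fix i
    have "f (y i) \<noteq> 0" "\<beta> \<noteq> 0" using f_pos[of "y i"] \<beta> by simp_all
    then show "inverse \<beta> * (inverse (f (y i)) - 1) * x i = x i / (\<beta> * f (y i)) - x i / \<beta>"
      by (simp add: field_simps)
  qed
  have nn: "0 \<le> (\<Sum>i. x i / (\<beta> * f (y i)))" for y
    using x \<beta> f_pos by (intro suminf_nonneg 2) (simp add: less_imp_le)
  have "(\<lambda>y. tilt x y) \<in> borel_measurable mark_law"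
    by measurable
  then show "integrable mark_law (\<lambda>y. tilt x y)"
  proof (rule PiM.integrable_const_bound[rotated])
    show "AE y in mark_law. norm (tilt x y) \<le> exp (\<Sum>i. x i / \<beta>)"
      unfolding eq using nn by simp
  qed
  have "(\<Sum>i. ennreal (x i / \<beta>)) = ennreal (\<Sum>i. x i / \<beta>)"
    "(\<Sum>i. ennreal (x i / (\<beta> * f (y i)))) = ennreal (\<Sum>i. x i / (\<beta> * f (y i)))"
    using x \<beta> f_pos 1 2 by (intro suminf_ennreal2; simp add: less_imp_le)+
  moreover have "0 \<le> (\<Sum>i. x i / \<beta>)" using x \<beta> by (intro suminf_nonneg 1) simp
  ultimately show "nexp (\<Sum>i. ennreal (x i / \<beta>)) * ennreal (tilt x y)
      = nexp (\<Sum>i. ennreal (x i / (\<beta> * f (y i))))"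
    unfolding eq using nn[of y] by (simp add: nexp_ennreal ennreal_mult[symmetric] exp_add[symmetric])
qed

lemma gamma_density_nn:
  assumes "x \<in> R_down"
  shows "ennreal (gamma_density \<theta> \<beta> \<nu>\<^sub>0 f x) = ennreal (exp (- \<theta> * (\<integral>s. ln (f s) \<partial>\<nu>\<^sub>0))) *
    (\<integral>\<^sup>+y. ennreal (tilt x y) \<partial>mark_law)"
  unfolding gamma_density_def
  by (subst nn_integral_eq_integral[OF integrable_tilt(1)[OF assms]]) (simp_all add: ennreal_mult')

lemma measurable_gamma_density [measurable]:
  "(\<lambda>x. ennreal (gamma_density \<theta> \<beta> \<nu>\<^sub>0 f x)) \<in> borel_measurable R_down_space"
proof -
  have "(\<lambda>x. ennreal (exp (- \<theta> * (\<integral>s. ln (f s) \<partial>\<nu>\<^sub>0))) *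
      (\<integral>\<^sup>+y. ennreal (tilt x y) \<partial>mark_law))
    \<in> borel_measurable R_down_space" by measurable
  then show ?thesis by (rule measurable_cong[THEN iffD1, rotated]) (simp add: gamma_density_nn)
qed

text \<open>Strict positivity is what yields absolute continuity in the reverse direction.\<close>

lemma gamma_density_pos:
  assumes "x \<in> R_down"
  shows "0 < gamma_density \<theta> \<beta> \<nu>\<^sub>0 f x"
proof -
  have "0 < (\<integral>y. tilt x y \<partial>mark_law)"
  proof (rule PiM.expectation_greater[where a = 0])
    show "integrable mark_law (\<lambda>y. tilt x y)"
      by (rule integrable_tilt(1)[OF assms])
  qed simp
  then show ?thesis by (simp add: gamma_density_def)
qed

text \<open>The identity is established for the two measures multiplied by the weight
  \<open>D\<close>, where all exponents are nonnegative and Laplace functionals apply. On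
  \<open>R_down\<close> the weight lies strictly between 0 and \<infinity>, so it can be divided out
  again.\<close>

lemma labelled_T_law_eq_density:
  "labelled_T_law P f \<beta> \<gamma> \<xi> = density (labelled_law P \<beta> \<gamma>) (\<lambda>x. ennreal (gamma_density \<theta> \<beta> \<nu>\<^sub>0 f x))"
proof -
  let ?M = "labelled_law P \<beta> \<gamma>" and ?N = "labelled_T_law P f \<beta> \<gamma> \<xi>"
  let ?g = "\<lambda>x. ennreal (gamma_density \<theta> \<beta> \<nu>\<^sub>0 f x)"
  define D where "D x = nexp (\<Sum>i. ennreal (x i / \<beta>))" for x :: "nat \<Rightarrow> real"
  have [measurable]: "D \<in> borel_measurable R_down_space" unfolding D_def[abs_def] by measurable
  have [measurable]: "(\<lambda>w. descending (\<lambda>i. \<beta> * \<gamma> i w)) \<in> measurable P R_down_space"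
    "(\<lambda>w. descending (\<lambda>i. f (\<xi> i w) * (\<beta> * \<gamma> i w))) \<in> measurable P R_down_space"
    by (intro measurable_descending; measurable)+
  have sets [measurable_cong]: "sets ?M = sets R_down_space" "sets ?N = sets R_down_space"
    by (simp_all add: labelled_law_def labelled_T_law_def)
  interpret M: prob_space ?M unfolding labelled_law_def by (rule P.prob_space_distr) measurable
  interpret N: prob_space ?N unfolding labelled_T_law_def by (rule P.prob_space_distr) measurable
  have laplace_N: "(\<integral>\<^sup>+x. D x * nexp (\<Sum>i. \<phi> (x i)) \<partial>?N)
      = nexp (\<integral>\<^sup>+x. \<integral>\<^sup>+s. 1 - nexp (\<phi> (\<beta> * (f s * x)) + ennreal (f s * x)) \<partial>\<nu>\<^sub>0 \<partial>gamma_intensity \<theta>)"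
    if [measurable]: "\<phi> \<in> borel_measurable borel" and "\<phi> 0 = 0" for \<phi> :: "real \<Rightarrow> ennreal"
  proof -
    have "(\<integral>\<^sup>+x. D x * nexp (\<Sum>i. \<phi> (x i)) \<partial>?N) = (\<integral>\<^sup>+x. nexp (\<Sum>i. \<phi> (x i) + ennreal (x i / \<beta>)) \<partial>?N)"
      by (rule nn_integral_cong) (simp add: D_def nexp_add suminf_add[symmetric] mult.commute)
    also have "\<dots> = (\<integral>\<^sup>+w. nexp (\<Sum>i. \<phi> (descending (\<lambda>i. f (\<xi> i w) * (\<beta> * \<gamma> i w)) i) +
        ennreal (descending (\<lambda>i. f (\<xi> i w) * (\<beta> * \<gamma> i w)) i / \<beta>)) \<partial>P)"
      unfolding labelled_T_law_def by (rule nn_integral_distr) measurable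
    also have "\<dots> = (\<integral>\<^sup>+w. nexp (\<Sum>i. \<phi> (\<beta> * (f (\<xi> i w) * \<gamma> i w)) + ennreal (f (\<xi> i w) * \<gamma> i w)) \<partial>P)"
    proof (rule nn_integral_cong_AE, use AE_gamma_points AE_summable_marked in eventually_elim)
      case (elim w)
      let ?y = "\<lambda>i. f (\<xi> i w) * (\<beta> * \<gamma> i w)"
      have y: "0 \<le> ?y i" for i using elim f_pos \<beta> by (simp add: less_imp_le)
      have "summable (\<lambda>i. \<beta> * (f (\<xi> i w) * \<gamma> i w))" using elim by (intro summable_mult) simp
      then have "summable ?y" by (simp add: mult.left_commute)
      from suminf_descending[of ?y "\<lambda>t. \<phi> t + ennreal (t / \<beta>)", OF y this]
      have "(\<Sum>i. \<phi> (descending ?y i) + ennreal (descending ?y i / \<beta>)) = (\<Sum>i. \<phi> (?y i) + ennreal (?y i / \<beta>))"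
        using that by simp
      then show ?case using \<beta> by (simp add: mult.left_commute)
    qed
    also have "\<dots> = nexp (\<integral>\<^sup>+x. \<integral>\<^sup>+s. 1 - nexp (\<phi> (\<beta> * (f s * x)) + ennreal (f s * x)) \<partial>\<nu>\<^sub>0 \<partial>gamma_intensity \<theta>)"
      using laplace_marked[OF marked_setup, of "\<lambda>(x, s). \<phi> (\<beta> * (f s * x)) + ennreal (f s * x)"] by simp
    finally show ?thesis .
  qed
  have laplace_M: "(\<integral>\<^sup>+x. ?g x * D x * nexp (\<Sum>i. \<phi> (x i)) \<partial>?M) = ennreal (exp (- \<theta> * (\<integral>s. ln (f s) \<partial>\<nu>\<^sub>0))) *
      nexp (\<integral>\<^sup>+x. \<integral>\<^sup>+s. 1 - nexp (\<phi> (\<beta> * x) + ennreal (x / f s)) \<partial>\<nu>\<^sub>0 \<partial>gamma_intensity \<theta>)"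
    if [measurable]: "\<phi> \<in> borel_measurable borel" for \<phi> :: "real \<Rightarrow> ennreal"
  proof -
    let ?C = "ennreal (exp (- \<theta> * (\<integral>s. ln (f s) \<partial>\<nu>\<^sub>0)))"
    have pt: "?g x * D x * nexp (\<Sum>i. \<phi> (x i)) = ?C * (\<integral>\<^sup>+y. nexp (\<Sum>i. \<phi> (x i) + ennreal (x i / (\<beta> * f (y i)))) \<partial>mark_law)"
      if x: "x \<in> R_down" for x
    proof -
      have "?g x * D x * nexp (\<Sum>i. \<phi> (x i)) = ?C * ((D x * nexp (\<Sum>i. \<phi> (x i))) *
          (\<integral>\<^sup>+y. ennreal (tilt x y) \<partial>mark_law))"
        unfolding gamma_density_nn[OF x] by (simp only: mult_ac)
      also have "\<dots> = ?C * (\<integral>\<^sup>+y. (D x * nexp (\<Sum>i. \<phi> (x i))) *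
          ennreal (tilt x y) \<partial>mark_law)"
        by (subst nn_integral_cmult) simp_all
      also have "\<dots> = ?C * (\<integral>\<^sup>+y. nexp (\<Sum>i. \<phi> (x i) + ennreal (x i / (\<beta> * f (y i)))) \<partial>mark_law)"
      proof (intro arg_cong[where f = "\<lambda>z. ?C * z"] nn_integral_cong)
        fix y
        have "D x * nexp (\<Sum>i. \<phi> (x i)) * ennreal (tilt x y)
            = nexp (\<Sum>i. \<phi> (x i)) * nexp (\<Sum>i. ennreal (x i / (\<beta> * f (y i))))"
          unfolding integrable_tilt(2)[OF x, symmetric] D_def by (simp only: mult_ac)
        then show "D x * nexp (\<Sum>i. \<phi> (x i)) * ennreal (tilt x y)
            = nexp (\<Sum>i. \<phi> (x i) + ennreal (x i / (\<beta> * f (y i))))"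
          by (simp add: nexp_add suminf_add[symmetric])
      qed
      finally show ?thesis .
    qed
    have "(\<integral>\<^sup>+x. ?g x * D x * nexp (\<Sum>i. \<phi> (x i)) \<partial>?M)
        = (\<integral>\<^sup>+w. ?g (descending (\<lambda>i. \<beta> * \<gamma> i w)) * D (descending (\<lambda>i. \<beta> * \<gamma> i w)) *
            nexp (\<Sum>i. \<phi> (descending (\<lambda>i. \<beta> * \<gamma> i w) i)) \<partial>P)"
      unfolding labelled_law_def by (rule nn_integral_distr) measurable
    \<comment> \<open>The gamma points are already decreasing, so \<open>descending\<close> acts as
      the identity and the density is evaluated at the points themselves.\<close>
    also have "\<dots> = (\<integral>\<^sup>+w. ?C * (\<integral>\<^sup>+y. nexp (\<Sum>i. \<phi> (\<beta> * \<gamma> i w) + ennreal (\<gamma> i w / f (y i))) \<partial>mark_law) \<partial>P)"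
    proof (rule nn_integral_cong_AE, use AE_descending_points in eventually_elim)
      case (elim w)
      then show ?case using pt[of "\<lambda>i. \<beta> * \<gamma> i w"] \<beta> by simp
    qed
    also have "\<dots> = ?C * (\<integral>\<^sup>+w. (\<integral>\<^sup>+y. nexp (\<Sum>i. \<phi> (\<beta> * \<gamma> i w) + ennreal (\<gamma> i w / f (y i))) \<partial>mark_law) \<partial>P)"
      by (rule nn_integral_cmult) measurable
    \<comment> \<open>The fresh marks of the density become the marks of the process: this accounts
      for the expectation over i.i.d. locations in the claimed formula.\<close>
    also have "(\<integral>\<^sup>+w. (\<integral>\<^sup>+y. nexp (\<Sum>i. \<phi> (\<beta> * \<gamma> i w) + ennreal (\<gamma> i w / f (y i))) \<partial>mark_law) \<partial>P)
        = (\<integral>\<^sup>+w. nexp (\<Sum>i. \<phi> (\<beta> * \<gamma> i w) + ennreal (\<gamma> i w / f (\<xi> i w))) \<partial>P)"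
      using nn_integral_joint[OF marked_setup, of "\<lambda>(x, y). nexp (\<Sum>i. \<phi> (\<beta> * x i) + ennreal (x i / f (y i)))"] by simp
    also have "\<dots> = nexp (\<integral>\<^sup>+x. \<integral>\<^sup>+s. 1 - nexp (\<phi> (\<beta> * x) + ennreal (x / f s)) \<partial>\<nu>\<^sub>0 \<partial>gamma_intensity \<theta>)"
      using laplace_marked[OF marked_setup, of "\<lambda>(x, s). \<phi> (\<beta> * x) + ennreal (x / f s)"] by simp
    finally show ?thesis .
  qed
  \<comment> \<open>Taking \<open>\<phi> (\<beta> * x)\<close> as test function absorbs \<beta>, and
    only the scaling by \<open>f\<close> is left for \<open>gamma_tilt\<close>.\<close>
  have laplace_eq: "(\<integral>\<^sup>+x. ?g x * D x * nexp (\<Sum>i. \<phi> (x i)) \<partial>?M) = (\<integral>\<^sup>+x. D x * nexp (\<Sum>i. \<phi> (x i)) \<partial>?N)"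
    if [measurable]: "\<phi> \<in> borel_measurable borel" and "\<phi> 0 = 0" for \<phi> :: "real \<Rightarrow> ennreal"
    using gamma_tilt[of "\<lambda>x. \<phi> (\<beta> * x)" f \<nu>\<^sub>0 \<theta>] nu(1) f_pos \<theta> ln_f
    by (simp add: laplace_M laplace_N that)
  have fin_N: "(\<integral>\<^sup>+x. D x \<partial>?N) < top"
    by (rule nn_integral_le_1_less_top) (simp_all add: N.finite_measure_axioms D_def)
  have eq: "density ?M (\<lambda>x. ?g x * D x) = density ?N D"
  proof (rule R_down_measure_eqI)
    show "sets (density ?M (\<lambda>x. ?g x * D x)) = sets R_down_space" "sets (density ?N D) = sets R_down_space"
      by (simp_all add: sets)
    show "finite_measure (density ?N D)"
      using fin_N by (intro finite_measureI) (simp add: emeasure_density nn_integral_cong_AE less_top cong: nn_integral_cong_simp)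
    \<comment> \<open>In place of a bound on the density, the total mass is read off from the zero
      test function, for which it equals that of the other measure.\<close>
    show "finite_measure (density ?M (\<lambda>x. ?g x * D x))"
      using fin_N laplace_eq[of "\<lambda>_. 0"]
      by (intro finite_measureI) (simp add: emeasure_density less_top cong: nn_integral_cong_simp)
    fix \<phi> :: "real \<Rightarrow> ennreal" assume [measurable]: "\<phi> \<in> borel_measurable borel" and "\<phi> 0 = 0"
    then show "(\<integral>\<^sup>+x. nexp (\<Sum>i. \<phi> (x i)) \<partial>density ?M (\<lambda>x. ?g x * D x))
        = (\<integral>\<^sup>+x. nexp (\<Sum>i. \<phi> (x i)) \<partial>density ?N D)"
      using laplace_eq by (simp add: nn_integral_density)
  qed
  have D: "D x * (1 / D x) = 1" if "x \<in> R_down" for x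
  proof -
    have "summable (\<lambda>i. x i / \<beta>)" using that by (intro summable_divide) (simp add: R_down_def)
    then have "(\<Sum>i. ennreal (x i / \<beta>)) \<noteq> top"
      using that \<beta> by (subst suminf_ennreal2) (simp_all add: R_down_def)
    then have "D x \<noteq> 0" "D x \<noteq> top"
      using nexp_pos[of "\<Sum>i. ennreal (x i / \<beta>)"] by (simp_all add: D_def)
    then show ?thesis by (simp add: ennreal_times_divide ennreal_divide_self less_top zero_less_iff_neq_zero)
  qed
  have space: "space ?M = R_down" "space ?N = R_down"
    using sets_eq_imp_space_eq[OF sets(1)] sets_eq_imp_space_eq[OF sets(2)] by simp_all
  have "density ?M ?g = density ?M (\<lambda>x. ?g x * D x * (1 / D x))"
  proof (rule density_cong)
    show "AE x in ?M. ?g x = ?g x * D x * (1 / D x)"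
      by (rule AE_I2) (simp only: space mult.assoc D mult_1_right)
  qed measurable
  also have "\<dots> = density (density ?M (\<lambda>x. ?g x * D x)) (\<lambda>x. 1 / D x)"
    by (rule density_density_eq[symmetric]) measurable
  also have "\<dots> = density ?N (\<lambda>x. D x * (1 / D x))"
    unfolding eq by (rule density_density_eq) measurable
  also have "\<dots> = density ?N (\<lambda>_. 1)"
  proof (rule density_cong)
    show "AE x in ?N. D x * (1 / D x) = 1"
      by (rule AE_I2) (simp only: space D)
  qed measurable
  finally show ?thesis by (simp add: density_1)
qed

end

section \<open>The Borel structure of the weak topology\<close>

text \<open>McShane-type envelopes $\min_j (q_j + K d(\cdot, x_j))$ with rational $q_j$ and $x_j$ from
  finite nets form a countable uniformly dense family of continuous functions.  Its only purpose is the
  second countability of the weak topology, without which the Borel sets need not be generated by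
  evaluations.\<close>

definition lip_env :: "nat \<Rightarrow> ('a::metric_space \<times> real) list \<Rightarrow> 'a \<Rightarrow> real" where
  "lip_env K xs s = foldr (\<lambda>(x, q) m. min (q + real K * dist s x) m) xs (real K)"

lemma continuous_lip_env: "continuous_on UNIV (lip_env K xs)"
proof (induction xs)
  case Nil
  then show ?case by (simp add: lip_env_def[abs_def])
next
  case (Cons p xs)
  obtain x q where p: "p = (x, q)" by (cases p)
  have "lip_env K (p # xs) = (\<lambda>s. min (q + real K * dist s x) (lip_env K xs s))"
    by (rule ext) (simp add: lip_env_def p)
  then show ?case using Cons by (auto intro!: continuous_intros)
qed

lemma lip_env_le: "(x, q) \<in> set xs \<Longrightarrow> lip_env K xs s \<le> q + real K * dist s x"
  by (induction xs) (auto simp: lip_env_def min_le_iff_disj)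

lemma lip_env_ge:
  assumes "L \<le> real K" "\<And>x q. (x, q) \<in> set xs \<Longrightarrow> L \<le> q + real K * dist s x"
  shows "L \<le> lip_env K xs s"
  using assms(2) by (induction xs) (auto simp: lip_env_def assms(1))

lemma compact_bounded_range:
  fixes g :: "'a::metric_space \<Rightarrow> real"
  assumes "compact (UNIV :: 'a set)" "continuous_on UNIV g"
  shows "bounded (range g)"
  using compact_continuous_image[OF assms(2,1)] by (rule compact_imp_bounded)

lemma ex_finite_nets:
  assumes cpt: "compact (UNIV :: 'a::metric_space set)"
  obtains k :: "nat \<Rightarrow> 'a::metric_space set" where "\<And>n. finite (k n)"
    "\<And>n. UNIV \<subseteq> (\<Union>x\<in>k n. ball x (1 / real (Suc n)))"
proof -
  have "\<forall>e>0. \<exists>k. finite k \<and> (UNIV :: 'a set) \<subseteq> (\<Union>x\<in>k. ball x e)"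
    using cpt unfolding compact_eq_totally_bounded by blast
  then have "\<forall>n. \<exists>k. finite k \<and> (UNIV :: 'a set) \<subseteq> (\<Union>x\<in>k. ball x (1 / real (Suc n)))" by simp
  then show thesis using that by metis
qed

lemma ex_countable_dense_continuous:
  assumes cpt: "compact (UNIV :: 'a::metric_space set)"
  obtains D :: "('a::metric_space \<Rightarrow> real) set" where "countable D" "\<And>h. h \<in> D \<Longrightarrow> continuous_on UNIV h"
    "\<And>g e. continuous_on UNIV g \<Longrightarrow> 0 < e \<Longrightarrow> \<exists>h\<in>D. \<forall>s. \<bar>g s - h s\<bar> < e"
proof -
  obtain k :: "nat \<Rightarrow> 'a set" where k: "\<And>n. finite (k n)" "\<And>n. UNIV \<subseteq> (\<Union>x\<in>k n. ball x (1 / real (Suc n)))"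
    using ex_finite_nets[OF cpt] by blast
  define C where "C = (\<Union>n. k n)"
  have "countable C" unfolding C_def using k(1) by (intro countable_UN) (auto intro: countable_finite)
  define D where "D = (\<lambda>(K, xs). lip_env K xs) ` (UNIV \<times> lists (C \<times> \<rat>))"
  have "countable D" unfolding D_def
    using \<open>countable C\<close> countable_rat by (intro countable_image countable_SIGMA countable_lists) auto
  moreover have "continuous_on UNIV h" if "h \<in> D" for h
    using that continuous_lip_env by (auto simp: D_def)
  moreover have "\<exists>h\<in>D. \<forall>s. \<bar>g s - h s\<bar> < e" if g: "continuous_on UNIV g" and "0 < e" for g e
  proof -
    obtain m where m: "0 < m" "\<And>s. \<bar>g s\<bar> \<le> m"
      using compact_bounded_range[OF cpt g] unfolding bounded_pos by auto
    \<comment> \<open>The envelope exceeds \<open>g\<close> by at most three errors of size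
      \<open>d\<close>: the rational value against \<open>g\<close> at the net point, the variation
      of \<open>g\<close> to that point, and the slope term. It falls below \<open>g\<close> by at
      most one.\<close>
    define d where "d = e / 4"
    have "0 < d" using \<open>0 < e\<close> by (simp add: d_def)
    have "uniformly_continuous_on UNIV g" by (rule compact_uniformly_continuous[OF g cpt])
    then obtain \<delta> where \<delta>: "0 < \<delta>" "\<And>s t. dist s t < \<delta> \<Longrightarrow> \<bar>g s - g t\<bar> < d"
      using \<open>0 < d\<close> unfolding uniformly_continuous_on_def dist_real_def by (metis UNIV_I)
    \<comment> \<open>The bound \<open>m < K\<close> places the starting value \<open>real K\<close>
      of the envelope above \<open>g\<close>. The bound \<open>2 * m / \<delta> < K\<close> makes
      the slope term at distance at least \<delta> no smaller than \<open>2 * m\<close>, hence no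
      smaller than any oscillation of \<open>g\<close>.\<close>
    obtain K :: nat where K: "max m (2 * m / \<delta>) < real K" using reals_Archimedean2 by blast
    then have "0 < real K" "m \<le> real K" using m by linarith+
    have "2 * m / \<delta> \<le> real K" using K by linarith
    then have "2 * m \<le> real K * \<delta>" using \<delta>(1) by (simp add: field_simps)
    define \<eta> where "\<eta> = min \<delta> (d / real K)"
    have "0 < \<eta>" using \<delta> \<open>0 < d\<close> \<open>0 < real K\<close> by (simp add: \<eta>_def)
    then obtain n where n: "1 / real (Suc n) < \<eta>" using nat_approx_posE by blast
    have "\<forall>x. \<exists>q\<in>\<rat>. g x < q \<and> q < g x + d" using Rats_dense_in_real \<open>0 < d\<close> by (metis less_add_same_cancel1)
    then obtain q where q: "\<And>x. q x \<in> \<rat>" "\<And>x. g x < q x" "\<And>x. q x < g x + d" by metis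
    obtain ys where ys: "set ys = k n" using finite_list[OF k(1)] by blast
    define xs where "xs = map (\<lambda>x. (x, q x)) ys"
    have set_xs: "set xs = (\<lambda>x. (x, q x)) ` k n" by (simp add: xs_def ys)
    have "xs \<in> lists (C \<times> \<rat>)" using q(1) by (auto simp: in_lists_conv_set set_xs C_def)
    then have "lip_env K xs \<in> D" by (auto simp: D_def)
    moreover have "\<bar>g s - lip_env K xs s\<bar> < e" for s
    proof -
      have "s \<in> (\<Union>x\<in>k n. ball x (1 / real (Suc n)))" using k(2)[of n] by blast
      then obtain x where x: "x \<in> k n" "dist x s < 1 / real (Suc n)" by (auto simp del: of_nat_Suc)
      then have ds: "dist s x < \<eta>" using n by (simp add: dist_commute)
      then have "dist s x \<le> d / real K" by (simp add: \<eta>_def)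
      then have Kd: "real K * dist s x \<le> d" using \<open>0 < real K\<close> by (simp add: field_simps)
      have "lip_env K xs s \<le> q x + real K * dist s x"
        by (rule lip_env_le) (use x set_xs in auto)
      moreover have "\<bar>g s - g x\<bar> < d" using ds by (intro \<delta>(2)) (simp add: \<eta>_def)
      ultimately have up: "lip_env K xs s \<le> g s + 3 * d" using q(3)[of x] Kd by linarith
      have low: "g s - d \<le> lip_env K xs s"
      proof (rule lip_env_ge)
        show "g s - d \<le> real K" using m(2)[of s] \<open>m \<le> real K\<close> \<open>0 < d\<close> by linarith
        fix z p assume "(z, p) \<in> set xs"
        then have p: "p = q z" by (auto simp: set_xs)
        show "g s - d \<le> p + real K * dist s z"
        proof (cases "dist s z < \<delta>")
          case True
          then have "\<bar>g s - g z\<bar> < d" by (rule \<delta>(2))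
          moreover have "0 \<le> real K * dist s z" by simp
          ultimately show ?thesis using q(2)[of z] p by linarith
        next
          case False
          then have "real K * \<delta> \<le> real K * dist s z" by (intro mult_left_mono) auto
          then show ?thesis using q(2)[of z] p m(2)[of s] m(2)[of z] \<open>2 * m \<le> real K * \<delta>\<close> \<open>0 < d\<close> by linarith
        qed
      qed
      have "e = 4 * d" by (simp add: d_def)
      with up low \<open>0 < d\<close> show ?thesis by linarith
    qed
    ultimately show ?thesis by blast
  qed
  ultimately show thesis by (rule that)
qed

section \<open>A countable base of the weak topology\<close>

lemma fin_measures_space [simp]: "\<mu> \<in> fin_measures \<Longrightarrow> space \<mu> = UNIV"
  unfolding fin_measures_def by (auto dest: sets_eq_imp_space_eq)

lemma topspace_weak_topology: "topspace (weak_topology :: 'a::metric_space measure topology) = fin_measures"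
proof -
  have "fin_measures \<in> {{\<mu> \<in> fin_measures. (\<integral>s. g s \<partial>\<mu>) \<in> U} | (g :: 'a \<Rightarrow> real) U.
        continuous_on UNIV g \<and> bounded (range g) \<and> open U}"
    by (rule CollectI, rule exI[of _ "\<lambda>_. 0"], rule exI[of _ UNIV]) auto
  then show ?thesis unfolding weak_topology_def topology_generated_by_topspace by blast
qed

lemma space_weak_borel [simp]: "space weak_borel = fin_measures"
  unfolding weak_borel_def
  by (rule space_measure_of) (auto simp: topspace_weak_topology[symmetric] dest: openin_subset)

lemma sets_weak_borel: "sets weak_borel = sigma_sets fin_measures {U. openin weak_topology U}"
  unfolding weak_borel_def
  by (rule sets_measure_of) (auto simp: topspace_weak_topology[symmetric] dest: openin_subset)

text \<open>Parametrized by triples so that a countable set of functions with rational bounds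
  indexes a countable family of sets.\<close>

definition eval_set :: "('a::metric_space \<Rightarrow> real) \<times> real \<times> real \<Rightarrow> 'a measure set" where
  "eval_set = (\<lambda>(h, p, q). {\<mu> \<in> fin_measures. p < (\<integral>s. h s \<partial>\<mu>) \<and> (\<integral>s. h s \<partial>\<mu>) < q})"

lemma integrable_continuous_fin_measure:
  fixes g :: "'a::metric_space \<Rightarrow> real"
  assumes "compact (UNIV :: 'a set)" "continuous_on UNIV g" "\<mu> \<in> fin_measures"
  shows "integrable \<mu> g"
proof -
  interpret finite_measure \<mu> using assms(3) by (simp add: fin_measures_def)
  have sets: "sets \<mu> = sets borel" using assms(3) by (simp add: fin_measures_def)
  obtain m where "\<And>s. \<bar>g s\<bar> \<le> m" using compact_bounded_range[OF assms(1,2)] unfolding bounded_iff by auto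
  then show ?thesis
    by (intro integrable_const_bound[of _ m])
      (use borel_measurable_continuous_onI[OF assms(2)] sets in \<open>auto cong: measurable_cong_sets\<close>)
qed

text \<open>Uniform closeness of \<open>g\<close> and \<open>h\<close> controls the difference of
  their integrals only on measures of bounded mass. The constant function 1 is therefore added to
  \<open>D\<close>: it yields a neighbourhood on which the total mass stays below a rational
  \<open>r\<close>.\<close>

lemma weak_open_nbhd:
  assumes cpt: "compact (UNIV :: 'a::metric_space set)" and D: "countable D"
      "\<And>h. h \<in> D \<Longrightarrow> continuous_on UNIV h"
      "\<And>g e. continuous_on UNIV g \<Longrightarrow> 0 < e \<Longrightarrow> \<exists>h\<in>D. \<forall>s. \<bar>g s - h s\<bar> < e"
    and U: "openin weak_topology U" and \<mu>: "\<mu> \<in> (U :: 'a::metric_space measure set)"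
  shows "\<exists>F. finite F \<and> F \<subseteq> insert (\<lambda>_. 1) D \<times> \<rat> \<times> \<rat> \<and> \<mu> \<in> fin_measures \<inter> (\<Inter>t\<in>F. eval_set t)
      \<and> fin_measures \<inter> (\<Inter>t\<in>F. eval_set t) \<subseteq> U"
  using U[unfolded weak_topology_def openin_topology_generated_by_iff] \<mu>
proof (induction arbitrary: \<mu>)
  case Empty
  then show ?case by simp
next
  case (Int a b)
  then have "\<mu> \<in> a" "\<mu> \<in> b" by simp_all
  from Int.IH(1)[OF this(1)] obtain F where F: "finite F" "F \<subseteq> insert (\<lambda>_. 1) D \<times> \<rat> \<times> \<rat>"
    "\<mu> \<in> fin_measures \<inter> (\<Inter>t\<in>F. eval_set t)" "fin_measures \<inter> (\<Inter>t\<in>F. eval_set t) \<subseteq> a"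
    by (elim exE conjE)
  from Int.IH(2)[OF \<open>\<mu> \<in> b\<close>] obtain G where G: "finite G" "G \<subseteq> insert (\<lambda>_. 1) D \<times> \<rat> \<times> \<rat>"
    "\<mu> \<in> fin_measures \<inter> (\<Inter>t\<in>G. eval_set t)" "fin_measures \<inter> (\<Inter>t\<in>G. eval_set t) \<subseteq> b"
    by (elim exE conjE)
  show ?case
  proof (intro exI[of _ "F \<union> G"] conjI)
    show "finite (F \<union> G)" "F \<union> G \<subseteq> insert (\<lambda>_. 1) D \<times> \<rat> \<times> \<rat>"
      using F(1,2) G(1,2) by (simp_all only: finite_Un Un_subset_iff)
    show "\<mu> \<in> fin_measures \<inter> (\<Inter>t\<in>F \<union> G. eval_set t)" using F(3) G(3) by (simp add: INT_Un)
    show "fin_measures \<inter> (\<Inter>t\<in>F \<union> G. eval_set t) \<subseteq> a \<inter> b"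
      by (rule subset_trans[OF _ Int_mono[OF F(4) G(4)]]) auto
  qed
next
  case (UN K)
  then obtain a where a: "a \<in> K" "\<mu> \<in> a" by (elim UnionE)
  from UN.IH[OF this] obtain F where F: "finite F" "F \<subseteq> insert (\<lambda>_. 1) D \<times> \<rat> \<times> \<rat>"
    "\<mu> \<in> fin_measures \<inter> (\<Inter>t\<in>F. eval_set t)" "fin_measures \<inter> (\<Inter>t\<in>F. eval_set t) \<subseteq> a"
    by (elim exE conjE)
  have "fin_measures \<inter> (\<Inter>t\<in>F. eval_set t) \<subseteq> \<Union>K"
    by (rule subset_trans[OF F(4) Union_upper[OF a(1)]])
  then show ?case by (intro exI[of _ F] conjI F)
next
  case (Basis s)
  then obtain g :: "'a \<Rightarrow> real" and V where g: "continuous_on UNIV g" and V: "open V"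
    and s: "s = {\<mu> \<in> fin_measures. (\<integral>s. g s \<partial>\<mu>) \<in> V}" by blast
  have \<mu>: "\<mu> \<in> fin_measures" "(\<integral>s. g s \<partial>\<mu>) \<in> V" using Basis s by auto
  obtain e where e: "0 < e" "\<And>v. \<bar>v - (\<integral>s. g s \<partial>\<mu>)\<bar> < e \<Longrightarrow> v \<in> V"
    using V \<mu>(2) unfolding open_dist dist_real_def by blast
  have one: "(\<integral>s. 1 \<partial>\<nu>) = measure \<nu> UNIV" if "\<nu> \<in> fin_measures" for \<nu> :: "'a measure"
    using that by simp
  obtain r where r: "r \<in> \<rat>" "measure \<mu> UNIV < r" using Rats_dense_in_real[of "measure \<mu> UNIV" "measure \<mu> UNIV + 1"] by auto
  have "0 < r" using r(2) measure_nonneg[of \<mu> UNIV] by linarith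
  \<comment> \<open>Exchanging \<open>g\<close> for \<open>h\<close> then costs at most
    \<open>e / 4\<close> under either measure, and the choice of \<open>p\<close> and
    \<open>q\<close> below makes the two integrals of \<open>h\<close> differ by less than
    \<open>e / 4\<close>.\<close>
  define d where "d = e / (4 * r)"
  have "0 < d" using e \<open>0 < r\<close> by (simp add: d_def)
  obtain h where h: "h \<in> D" "\<And>s. \<bar>g s - h s\<bar> < d" using D(3)[OF g \<open>0 < d\<close>] by blast
  have diff: "\<bar>(\<integral>s. g s \<partial>\<nu>) - (\<integral>s. h s \<partial>\<nu>)\<bar> \<le> e / 4"
    if \<nu>: "\<nu> \<in> fin_measures" "measure \<nu> UNIV < r" for \<nu>
  proof -
    interpret finite_measure \<nu> using \<nu> by (simp add: fin_measures_def)
    have int: "integrable \<nu> g" "integrable \<nu> h"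
      using integrable_continuous_fin_measure[OF cpt _ \<nu>(1)] g D(2)[OF h(1)] by auto
    have "\<bar>(\<integral>s. g s \<partial>\<nu>) - (\<integral>s. h s \<partial>\<nu>)\<bar> = \<bar>\<integral>s. g s - h s \<partial>\<nu>\<bar>" using int by simp
    also have "\<dots> \<le> (\<integral>s. \<bar>g s - h s\<bar> \<partial>\<nu>)" by (rule integral_abs_bound)
    also have "\<dots> \<le> (\<integral>s. d \<partial>\<nu>)" using int h(2) by (intro integral_mono) (auto simp: less_imp_le)
    also have "\<dots> = measure \<nu> UNIV * d" using \<nu> by simp
    also have "\<dots> \<le> r * d" using \<nu> \<open>0 < d\<close> by simp
    also have "\<dots> = e / 4" using \<open>0 < r\<close> by (simp add: d_def)
    finally show ?thesis .
  qed
  let ?I = "\<integral>s. h s \<partial>\<mu>"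
  obtain p where p: "p \<in> \<rat>" "?I - e / 4 < p" "p < ?I" using Rats_dense_in_real[of "?I - e / 4" ?I] e by auto
  obtain q where q: "q \<in> \<rat>" "?I < q" "q < ?I + e / 4" using Rats_dense_in_real[of ?I "?I + e / 4"] e by auto
  \<comment> \<open>The value \<open>- 1\<close> is a rational lower bound satisfied by every total
    mass, so the first triple expresses only the upper bound \<open>r\<close>.\<close>
  let ?F = "{(\<lambda>_. 1, - 1, r), (h, p, q)} :: (('a \<Rightarrow> real) \<times> real \<times> real) set"
  show ?case
  proof (intro exI[of _ ?F] conjI)
    show "?F \<subseteq> insert (\<lambda>_. 1) D \<times> \<rat> \<times> \<rat>" using r p q h by simp
    have "- 1 < measure \<mu> UNIV" using measure_nonneg[of \<mu> UNIV] by linarith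
    then show "\<mu> \<in> fin_measures \<inter> (\<Inter>t\<in>?F. eval_set t)"
      using \<mu> r p q by (simp add: eval_set_def)
    show "fin_measures \<inter> (\<Inter>t\<in>?F. eval_set t) \<subseteq> s"
    proof
      fix \<nu> assume "\<nu> \<in> fin_measures \<inter> (\<Inter>t\<in>?F. eval_set t)"
      then have \<nu>: "\<nu> \<in> fin_measures" "measure \<nu> UNIV < r" "p < (\<integral>s. h s \<partial>\<nu>)" "(\<integral>s. h s \<partial>\<nu>) < q"
        by (auto simp: eval_set_def)
      have "\<bar>(\<integral>s. g s \<partial>\<nu>) - (\<integral>s. g s \<partial>\<mu>)\<bar> < e"
        using diff[OF \<nu>(1,2)] diff[OF \<mu>(1) r(2)] \<nu>(3,4) p q by linarith
      then show "\<nu> \<in> s" using e(2) \<nu>(1) by (simp add: s)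
    qed
  qed simp
qed

lemma kernel_nn_integral_measurable:
  assumes sets: "\<And>w. w \<in> space M \<Longrightarrow> sets (X w) = sets N"
    and X: "\<And>A. A \<in> sets N \<Longrightarrow> (\<lambda>w. emeasure (X w) A) \<in> borel_measurable M"
    and u: "u \<in> borel_measurable N"
  shows "(\<lambda>w. \<integral>\<^sup>+s. u s \<partial>X w) \<in> borel_measurable M"
  using u
proof (induction rule: borel_measurable_induct)
  case (cong f g)
  have "(\<integral>\<^sup>+s. f s \<partial>X w) = (\<integral>\<^sup>+s. g s \<partial>X w)" if "w \<in> space M" for w
    using cong(3) sets_eq_imp_space_eq[OF sets[OF that]] by (intro nn_integral_cong) simp
  then show ?case using cong by (simp cong: measurable_cong)
next
  case (set A)
  have "(\<integral>\<^sup>+s. indicator A s \<partial>X w) = emeasure (X w) A" if "w \<in> space M" for w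
    using set sets[OF that] by simp
  then show ?case using X[OF set] by (simp cong: measurable_cong)
next
  case (mult u c)
  have "(\<integral>\<^sup>+s. c * u s \<partial>X w) = c * (\<integral>\<^sup>+s. u s \<partial>X w)" if "w \<in> space M" for w
    using mult sets[OF that] by (intro nn_integral_cmult) (simp cong: measurable_cong_sets)
  then show ?case using mult by (simp cong: measurable_cong)
next
  case (add u v)
  have "(\<integral>\<^sup>+s. v s + u s \<partial>X w) = (\<integral>\<^sup>+s. v s \<partial>X w) + (\<integral>\<^sup>+s. u s \<partial>X w)" if "w \<in> space M" for w
    using add sets[OF that] by (intro nn_integral_add) (simp_all cong: measurable_cong_sets)
  then show ?case using add by (simp cong: measurable_cong)
next
  case (seq U)
  have "(\<integral>\<^sup>+s. (SUP i. U i) s \<partial>X w) = (SUP i. \<integral>\<^sup>+s. U i s \<partial>X w)" if "w \<in> space M" for w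
    using seq sets[OF that] unfolding SUP_apply
    by (intro nn_integral_monotone_convergence_SUP) (simp_all cong: measurable_cong_sets)
  then show ?case using seq by (simp cong: measurable_cong)
qed

text \<open>Every weakly open set is a countable union of finite intersections of evaluation sets,
  so it suffices to measure the integrals of continuous functions, and these are determined by the
  masses of Borel sets.\<close>

lemma measurable_weak_borelI:
  fixes X :: "'w \<Rightarrow> 'a::metric_space measure"
  assumes cpt: "compact (UNIV :: 'a set)"
    and fin: "\<And>w. w \<in> space M \<Longrightarrow> X w \<in> fin_measures"
    and X: "\<And>A. A \<in> sets borel \<Longrightarrow> (\<lambda>w. emeasure (X w) A) \<in> borel_measurable M"
  shows "X \<in> measurable M weak_borel"
proof -
  obtain D :: "('a \<Rightarrow> real) set" where D: "countable D" "\<And>h. h \<in> D \<Longrightarrow> continuous_on UNIV h"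
    "\<And>g e. continuous_on UNIV g \<Longrightarrow> 0 < e \<Longrightarrow> \<exists>h\<in>D. \<forall>s. \<bar>g s - h s\<bar> < e"
    using ex_countable_dense_continuous[OF cpt] by blast
  have sets: "sets (X w) = sets borel" if "w \<in> space M" for w using fin[OF that] by (simp add: fin_measures_def)
  have eval: "(\<lambda>w. \<integral>s. h s \<partial>X w) \<in> borel_measurable M" if h: "continuous_on UNIV h" for h :: "'a \<Rightarrow> real"
  proof -
    have [measurable]: "h \<in> borel_measurable borel" by (rule borel_measurable_continuous_onI[OF h])
    have [measurable]: "(\<lambda>w. \<integral>\<^sup>+s. u s \<partial>X w) \<in> borel_measurable M" if "u \<in> borel_measurable borel" for u
      by (rule kernel_nn_integral_measurable[OF sets X that])
    have "(\<lambda>w. enn2real (\<integral>\<^sup>+s. ennreal (h s) \<partial>X w) - enn2real (\<integral>\<^sup>+s. ennreal (- h s) \<partial>X w)) \<in> borel_measurable M"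
      by measurable
    moreover have "(\<integral>s. h s \<partial>X w) = enn2real (\<integral>\<^sup>+s. ennreal (h s) \<partial>X w) - enn2real (\<integral>\<^sup>+s. ennreal (- h s) \<partial>X w)"
      if "w \<in> space M" for w
      by (rule real_lebesgue_integral_def[OF integrable_continuous_fin_measure[OF cpt h fin[OF that]]])
    ultimately show ?thesis by (simp cong: measurable_cong)
  qed
  let ?T = "insert (\<lambda>_. 1) D \<times> (\<rat> :: real set) \<times> (\<rat> :: real set)"
  have ev: "X -` eval_set t \<inter> space M \<in> sets M" if t: "t \<in> ?T" for t
  proof -
    obtain h p q where t': "t = (h, p, q)" by (cases t)
    have "continuous_on UNIV h" using t D(2) by (auto simp: t')
    note [measurable] = eval[OF this]
    have "X -` eval_set t \<inter> space M = {w \<in> space M. p < (\<integral>s. h s \<partial>X w) \<and> (\<integral>s. h s \<partial>X w) < q}"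
      using fin by (auto simp: t' eval_set_def)
    then show ?thesis by simp
  qed
  define \<F> where "\<F> = {F. finite F \<and> F \<subseteq> ?T}"
  have "countable \<F>" unfolding \<F>_def
    by (intro countable_Collect_finite_subset countable_SIGMA countable_insert countable_rat D(1))
  define B where "B F = fin_measures \<inter> (\<Inter>t\<in>F. eval_set t)" for F :: "(('a \<Rightarrow> real) \<times> real \<times> real) set"
  have B: "X -` B F \<inter> space M \<in> sets M" if "F \<in> \<F>" for F
  proof -
    have "X -` B F \<inter> space M = space M \<inter> (\<Inter>t\<in>F. X -` eval_set t \<inter> space M)"
      using fin by (auto simp: B_def)
    moreover have "space M \<inter> (\<Inter>t\<in>F. X -` eval_set t \<inter> space M) \<in> sets M"
    proof (cases "F = {}")
      case False
      then have "(\<Inter>t\<in>F. X -` eval_set t \<inter> space M) \<in> sets M"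
        using that ev by (intro sets.finite_INT) (auto simp: \<F>_def)
      then show ?thesis by blast
    qed simp
    ultimately show ?thesis by simp
  qed
  show ?thesis
    unfolding weak_borel_def
  proof (rule measurable_measure_of)
    show "{U. openin weak_topology U} \<subseteq> Pow (fin_measures :: 'a measure set)"
      by (auto simp: topspace_weak_topology[symmetric] dest: openin_subset)
    show "X \<in> space M \<rightarrow> fin_measures" using fin by blast
    fix U :: "'a measure set" assume "U \<in> {U. openin weak_topology U}"
    then have U: "openin weak_topology U" by simp
    have "U = (\<Union>F\<in>{F \<in> \<F>. B F \<subseteq> U}. B F)"
    proof
      show "U \<subseteq> (\<Union>F\<in>{F \<in> \<F>. B F \<subseteq> U}. B F)"
      proof
        fix \<mu> assume "\<mu> \<in> U"
        from weak_open_nbhd[OF cpt D U this] obtain F where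
          "finite F" "F \<subseteq> ?T" "\<mu> \<in> B F" "B F \<subseteq> U" unfolding B_def by blast
        then show "\<mu> \<in> (\<Union>F\<in>{F \<in> \<F>. B F \<subseteq> U}. B F)" unfolding \<F>_def by blast
      qed
    qed blast
    then have "X -` U \<inter> space M = (\<Union>F\<in>{F \<in> \<F>. B F \<subseteq> U}. X -` B F \<inter> space M)" by blast
    also have "\<dots> \<in> sets M"
      using \<open>countable \<F>\<close> B by (intro sets.countable_UN'') (auto intro: countable_subset)
    finally show "X -` U \<inter> space M \<in> sets M" .
  qed
qed

section \<open>Measurable evaluations, integrals and atom masses\<close>

lemma measurable_weak_integral:
  fixes g :: "'a::metric_space \<Rightarrow> real"
  assumes "continuous_on UNIV g" "bounded (range g)"
  shows "(\<lambda>\<mu>. \<integral>s. g s \<partial>\<mu>) \<in> borel_measurable weak_borel"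
proof (rule borel_measurableI)
  fix U :: "real set" assume "open U"
  then have "openin weak_topology {\<mu> \<in> fin_measures. (\<integral>s. g s \<partial>\<mu>) \<in> U}"
    unfolding weak_topology_def using assms by (intro topology_generated_by_Basis) blast
  then have "{\<mu> \<in> fin_measures. (\<integral>s. g s \<partial>\<mu>) \<in> U} \<in> sets weak_borel"
    unfolding sets_weak_borel by (intro sigma_sets.Basic) simp
  moreover have "(\<lambda>\<mu>. \<integral>s. g s \<partial>\<mu>) -` U \<inter> space weak_borel = {\<mu> \<in> fin_measures. (\<integral>s. g s \<partial>\<mu>) \<in> U}" by auto
  ultimately show "(\<lambda>\<mu>. \<integral>s. g s \<partial>\<mu>) -` U \<inter> space weak_borel \<in> sets weak_borel" by simp
qed

text \<open>The indicator of a closed set is a pointwise limit of bounded continuous functions,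
  whose integrals are measurable by definition of the topology. Closed sets are stable under
  intersection and generate the Borel sets, and finiteness of the measures handles
  complements.\<close>

lemma measurable_weak_emeasure:
  fixes A :: "'a::metric_space set"
  assumes "A \<in> sets borel"
  shows "(\<lambda>\<mu>. emeasure \<mu> A) \<in> borel_measurable weak_borel"
proof -
  have fin: "finite_measure \<mu>" "sets \<mu> = sets borel" if "\<mu> \<in> space weak_borel" for \<mu> :: "'a measure"
    using that by (simp_all add: fin_measures_def)
  have closed: "(\<lambda>\<mu>. emeasure \<mu> F) \<in> borel_measurable weak_borel" if F: "closed F" for F :: "'a set"
  proof (cases "F = {}")
    case False
    \<comment> \<open>The empty set was split off because \<open>infdist\<close> to it is 0 by
      convention, which would make these functions constantly 1.\<close>
    define g where "g n s = max 0 (1 - real n * infdist s F)" for n s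
    have cont: "continuous_on UNIV (g n)" for n
      unfolding g_def by (intro continuous_intros)
    have g01: "0 \<le> g n s" "g n s \<le> 1" for n s
      using infdist_nonneg[of s F] by (simp_all add: g_def)
    have bdd: "bounded (range (g n))" for n
      using g01 by (intro boundedI[of _ 1]) auto
    have lim: "(\<lambda>n. g n s) \<longlonglongrightarrow> indicator F s" for s
    proof (cases "s \<in> F")
      case True
      then show ?thesis by (simp add: g_def)
    next
      case s: False
      then have "0 < infdist s F" using F False infdist_pos_not_in_closed by blast
      then obtain n0 :: nat where n0: "1 < real n0 * infdist s F" using reals_Archimedean3 by blast
      have "g n s = 0" if "n0 \<le> n" for n
      proof -
        have "real n0 * infdist s F \<le> real n * infdist s F"
          using that infdist_nonneg[of s F] by (intro mult_right_mono) auto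
        then show ?thesis using n0 by (simp add: g_def)
      qed
      then have "eventually (\<lambda>n. g n s = 0) sequentially" unfolding eventually_sequentially by blast
      then show ?thesis using s by (simp add: tendsto_eventually)
    qed
    have int: "(\<lambda>n. \<integral>s. g n s \<partial>\<mu>) \<longlonglongrightarrow> measure \<mu> F" if "\<mu> \<in> space weak_borel" for \<mu>
    proof -
      interpret finite_measure \<mu> by (rule fin(1)[OF that])
      note [measurable_cong] = fin(2)[OF that]
      have [measurable]: "F \<in> sets borel" using F by simp
      have [measurable]: "g n \<in> borel_measurable borel" for n by (rule borel_measurable_continuous_onI[OF cont])
      have "(\<lambda>n. \<integral>s. g n s \<partial>\<mu>) \<longlonglongrightarrow> (\<integral>s. indicator F s \<partial>\<mu>)"
        by (rule integral_dominated_convergence[where w = "\<lambda>_. 1"]) (use g01 lim in auto)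
      then show ?thesis using that fin_measures_space[of \<mu>] by simp
    qed
    have "(\<lambda>\<mu>. measure \<mu> F) \<in> borel_measurable weak_borel"
      by (rule borel_measurable_LIMSEQ_real[OF int measurable_weak_integral[OF cont bdd]])
    then have meas: "(\<lambda>\<mu>. ennreal (measure \<mu> F)) \<in> borel_measurable weak_borel" by measurable
    have eq: "emeasure \<mu> F = ennreal (measure \<mu> F)" if "\<mu> \<in> space weak_borel" for \<mu>
      by (rule finite_measure.emeasure_eq_measure[OF fin(1)[OF that]])
    show ?thesis by (rule measurable_cong[THEN iffD2, OF eq meas])
  qed simp
  have "A \<in> sigma_sets UNIV (Collect closed)" using assms by (simp add: borel_eq_closed)
  note A = this
  have "Int_stable (Collect closed :: 'a set set)" "(Collect closed :: 'a set set) \<subseteq> Pow UNIV"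
    by (auto simp: Int_stable_def)
  from this A show ?thesis
  proof (induction rule: sigma_sets_induct_disjoint)
    case (basic A)
    then show ?case using closed by simp
  next
    case empty
    show ?case by simp
  next
    case (compl A)
    have A: "A \<in> sets borel" using compl(1) by (simp add: borel_eq_closed)
    have eq: "emeasure \<mu> (UNIV - A) = emeasure \<mu> UNIV - emeasure \<mu> A" if "\<mu> \<in> space weak_borel" for \<mu>
      using emeasure_compl[of A \<mu>] A fin[OF that] that fin_measures_space[of \<mu>]
      by (simp add: finite_measure.emeasure_finite)
    have meas: "(\<lambda>\<mu>. emeasure \<mu> UNIV - emeasure \<mu> A) \<in> borel_measurable weak_borel"
      using compl(2) closed[OF closed_UNIV] by measurable
    show ?case by (rule measurable_cong[THEN iffD2, OF eq meas])
  next
    case (union A)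
    have A: "range A \<subseteq> sets borel" using union(2) by (simp add: borel_eq_closed)
    have eq: "emeasure \<mu> (\<Union>i. A i) = (\<Sum>i. emeasure \<mu> (A i))" if "\<mu> \<in> space weak_borel" for \<mu>
      using A fin(2)[OF that] union(1) by (intro suminf_emeasure[symmetric]) auto
    have meas: "(\<lambda>\<mu>. \<Sum>i. emeasure \<mu> (A i)) \<in> borel_measurable weak_borel"
      using union(3) by measurable
    show ?case by (rule measurable_cong[THEN iffD2, OF eq meas])
  qed
qed

text \<open>Normalization makes the results on kernels into \<^const>\<open>subprob_algebra\<close> applicable; for the
  zero measure the factor $1/0 = \infty$ is harmless.\<close>

lemma measurable_normalized:
  "(\<lambda>\<mu>. scale_measure (1 / emeasure \<mu> UNIV) \<mu>) \<in> measurable weak_borel (subprob_algebra (borel :: 'a::metric_space measure))"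
proof (rule measurable_subprob_algebra)
  fix \<mu> :: "'a measure" assume "\<mu> \<in> space weak_borel"
  then have \<mu>: "\<mu> \<in> fin_measures" by simp
  then show "sets (scale_measure (1 / emeasure \<mu> UNIV) \<mu>) = sets borel" by (simp add: fin_measures_def)
  interpret finite_measure \<mu> using \<mu> by (simp add: fin_measures_def)
  show "subprob_space (scale_measure (1 / emeasure \<mu> UNIV) \<mu>)"
  proof (rule subprob_spaceI)
    show "space (scale_measure (1 / emeasure \<mu> UNIV) \<mu>) \<noteq> {}" using \<mu> by (simp add: space_scale_measure)
    show "emeasure (scale_measure (1 / emeasure \<mu> UNIV) \<mu>) (space (scale_measure (1 / emeasure \<mu> UNIV) \<mu>)) \<le> 1"
      using \<mu> by (cases "emeasure \<mu> UNIV = 0")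
        (simp_all add: space_scale_measure ennreal_divide_times ennreal_divide_self less_top[symmetric] zero_less_iff_neq_zero)
  qed
next
  fix A :: "'a set" assume [measurable]: "A \<in> sets borel"
  note measurable_weak_emeasure [measurable]
  have "(\<lambda>\<mu>. 1 / emeasure \<mu> UNIV * emeasure \<mu> A) \<in> borel_measurable weak_borel" by measurable
  then show "(\<lambda>\<mu>. emeasure (scale_measure (1 / emeasure \<mu> UNIV) \<mu>) A) \<in> borel_measurable weak_borel" by simp
qed

text \<open>Integrand and measure both depend on the parameter. Normalized measures form a
  subprobability kernel, and multiplying by the total mass restores the integral; for the zero
  measure both sides are 0.\<close>

lemma measurable_weak_nn_integral:
  fixes L :: "'w \<Rightarrow> 'a::metric_space measure"
  assumes F: "(\<lambda>(x, s). F x s) \<in> borel_measurable (M \<Otimes>\<^sub>M borel)" and L: "L \<in> measurable M weak_borel"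
  shows "(\<lambda>x. \<integral>\<^sup>+s. F x s \<partial>L x) \<in> borel_measurable M"
proof -
  let ?K = "\<lambda>\<mu>. scale_measure (1 / emeasure \<mu> UNIV) \<mu>"
  have K: "(\<lambda>x. ?K (L x)) \<in> measurable M (subprob_algebra borel)"
    by (rule measurable_compose[OF L measurable_normalized])
  have mass [measurable]: "(\<lambda>x. emeasure (L x) UNIV) \<in> borel_measurable M"
    by (rule measurable_compose[OF L measurable_weak_emeasure]) simp
  have [measurable]: "(\<lambda>x. \<integral>\<^sup>+s. F x s \<partial>?K (L x)) \<in> borel_measurable M"
    by (rule nn_integral_measurable_subprob_algebra2[OF F K])
  have "(\<integral>\<^sup>+s. F x s \<partial>L x) = emeasure (L x) UNIV * (\<integral>\<^sup>+s. F x s \<partial>?K (L x))" if x: "x \<in> space M" for x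
  proof -
    have Lx: "L x \<in> fin_measures" using measurable_space[OF L x] by simp
    then have sets: "sets (L x) = sets borel" and fin: "finite_measure (L x)" by (simp_all add: fin_measures_def)
    have Fx: "F x \<in> borel_measurable (L x)"
      using measurable_compose[OF measurable_Pair1'[OF x] F] sets by (simp cong: measurable_cong_sets)
    show ?thesis
    proof (cases "emeasure (L x) UNIV = 0")
      case True
      then have "emeasure (L x) (space (L x)) = 0" using Lx by simp
      then have "AE s in L x. F x s = 0" by (intro AE_I[of _ _ "space (L x)"]) auto
      then have "(\<integral>\<^sup>+s. F x s \<partial>L x) = (\<integral>\<^sup>+s. 0 \<partial>L x)" by (rule nn_integral_cong_AE)
      then show ?thesis using True by simp
    next
      case False
      have "emeasure (L x) UNIV \<noteq> top" using finite_measure.emeasure_finite[OF fin] by simp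
      then have "emeasure (L x) UNIV * (1 / emeasure (L x) UNIV) = 1"
        using False by (simp add: ennreal_times_divide ennreal_divide_self less_top[symmetric] zero_less_iff_neq_zero)
      then show ?thesis by (simp add: nn_integral_scale_measure[OF Fx] mult.assoc[symmetric])
    qed
  qed
  moreover have "(\<lambda>x. emeasure (L x) UNIV * (\<integral>\<^sup>+s. F x s \<partial>?K (L x))) \<in> borel_measurable M" by measurable
  ultimately show ?thesis by (simp cong: measurable_cong)
qed

text \<open>Two points that share a ball of radius \<open>1 / (n + 1)\<close> for every
  \<open>n\<close> coincide. Finite nets keep the unions finite, so the diagonal is assembled from
  measurable rectangles and lies in the product \<sigma>-algebra itself.\<close>

lemma diagonal_measurable:
  assumes cpt: "compact (UNIV :: 'a::metric_space set)"
  shows "{(s, t). s = t} \<in> sets (borel \<Otimes>\<^sub>M borel :: ('a \<times> 'a) measure)"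
proof -
  obtain k :: "nat \<Rightarrow> 'a set" where k: "\<And>n. finite (k n)" "\<And>n. UNIV \<subseteq> (\<Union>x\<in>k n. ball x (1 / real (Suc n)))"
    using ex_finite_nets[OF cpt] by blast
  have "{(s, t). s = t} = (\<Inter>n. \<Union>x\<in>k n. ball x (1 / real (Suc n)) \<times> ball x (1 / real (Suc n)))" (is "?L = ?R")
  proof
    show "?L \<subseteq> ?R" using k(2) by fastforce
    show "?R \<subseteq> ?L"
    proof clarify
      fix s t assume st: "(s, t) \<in> ?R"
      show "s = t"
      proof (rule ccontr)
        assume "s \<noteq> t"
        then have "0 < dist s t / 2" by simp
        then obtain n where n: "1 / real (Suc n) < dist s t / 2" using nat_approx_posE by blast
        obtain x where "dist x s < 1 / real (Suc n)" "dist x t < 1 / real (Suc n)"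
          using st by (auto dest!: spec[of _ n])
        then show False using n dist_triangle3[of s t x] by linarith
      qed
    qed
  qed
  also have "\<dots> \<in> sets (borel \<Otimes>\<^sub>M borel)"
    using k(1) by (intro sets.countable_INT sets.finite_UN) auto
  finally show ?thesis .
qed

text \<open>The mass at \<open>s\<close> is the integral of a section of the diagonal, which makes
  it jointly measurable in the measure and the location.\<close>

lemma measurable_atom_mass:
  assumes cpt: "compact (UNIV :: 'a::metric_space set)"
  shows "(\<lambda>(\<mu>, s). emeasure \<mu> {s :: 'a::metric_space}) \<in> borel_measurable (weak_borel \<Otimes>\<^sub>M borel)"
proof -
  define \<Delta> where "\<Delta> = {(s, t). s = (t :: 'a)}"
  have [measurable]: "\<Delta> \<in> sets (borel \<Otimes>\<^sub>M borel)"
    unfolding \<Delta>_def by (rule diagonal_measurable[OF cpt])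
  have "(\<lambda>z. \<integral>\<^sup>+t. indicator \<Delta> (snd z, t) \<partial>fst z) \<in> borel_measurable (weak_borel \<Otimes>\<^sub>M borel)"
    by (rule measurable_weak_nn_integral) measurable
  moreover have "(\<integral>\<^sup>+t. indicator \<Delta> (snd z, t) \<partial>fst z) = emeasure (fst z) {snd z}"
    if "z \<in> space ((weak_borel :: 'a measure measure) \<Otimes>\<^sub>M borel)" for z
  proof -
    have "fst z \<in> fin_measures" using that by (auto simp: space_pair_measure)
    then have "{snd z} \<in> sets (fst z)" by (simp add: fin_measures_def)
    moreover have "(\<integral>\<^sup>+t. indicator \<Delta> (snd z, t) \<partial>fst z) = (\<integral>\<^sup>+t. indicator {snd z} t \<partial>fst z)"
      by (rule nn_integral_cong) (simp add: \<Delta>_def split: split_indicator)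
    ultimately show ?thesis by simp
  qed
  ultimately show ?thesis by (simp add: case_prod_beta cong: measurable_cong)
qed

section \<open>Atomic measures and their masses\<close>

lemma sets_atomic [simp]: "sets (atomic x \<xi>) = sets borel"
  by (simp add: atomic_def)

lemma nn_integral_atomic:
  assumes "u \<in> borel_measurable borel"
  shows "(\<integral>\<^sup>+s. u s \<partial>atomic x \<xi>) = (\<Sum>i. ennreal (x i) * u (\<xi> i))"
proof -
  have "(\<integral>\<^sup>+s. u s \<partial>atomic x \<xi>) = (\<integral>\<^sup>+i. u (\<xi> i) \<partial>density (count_space UNIV) (\<lambda>i. ennreal (x i)))"
    unfolding atomic_def using assms by (intro nn_integral_distr) simp_all
  also have "\<dots> = (\<integral>\<^sup>+i. ennreal (x i) * u (\<xi> i) \<partial>count_space UNIV)"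
    by (rule nn_integral_density) simp_all
  finally show ?thesis unfolding nn_integral_count_space_nat .
qed

lemma emeasure_atomic:
  assumes "A \<in> sets borel"
  shows "emeasure (atomic x \<xi>) A = (\<Sum>i. ennreal (x i) * indicator A (\<xi> i))"
proof -
  have "emeasure (atomic x \<xi>) A = (\<integral>\<^sup>+s. indicator A s \<partial>atomic x \<xi>)"
    by (rule nn_integral_indicator[symmetric]) (simp only: sets_atomic assms)
  also have "\<dots> = (\<Sum>i. ennreal (x i) * indicator A (\<xi> i))"
    by (rule nn_integral_atomic) (rule borel_measurable_indicator[OF assms])
  finally show ?thesis .
qed

lemma atomic_in_fin_measures:
  assumes "\<And>i. 0 \<le> x i" "summable x"
  shows "atomic x \<xi> \<in> fin_measures"
proof -
  have "space (atomic x \<xi>) = UNIV" by (simp add: atomic_def)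
  then have "emeasure (atomic x \<xi>) (space (atomic x \<xi>)) \<noteq> \<infinity>"
    using suminf_ennreal2[OF assms] by (simp add: emeasure_atomic)
  from finite_measureI[OF this] show ?thesis by (simp only: fin_measures_def sets_atomic mem_Collect_eq)
qed

lemma emeasure_atomic_singleton:
  assumes nonneg: "\<And>i. 0 \<le> x i" and inj: "inj_on \<xi> {i. 0 < x i}"
  shows "0 < x j \<Longrightarrow> emeasure (atomic x \<xi>) {\<xi> j} = ennreal (x j)"
    and "s \<notin> \<xi> ` {i. 0 < x i} \<Longrightarrow> emeasure (atomic x \<xi>) {s} = 0"
proof -
  assume j: "0 < x j"
  have "(\<Sum>i. ennreal (x i) * indicator {\<xi> j} (\<xi> i)) = (\<Sum>i\<in>{j}. ennreal (x i) * indicator {\<xi> j} (\<xi> i))"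
  proof (rule suminf_finite)
    fix i assume "i \<notin> {j}"
    then show "ennreal (x i) * indicator {\<xi> j} (\<xi> i) = 0"
      using inj j nonneg[of i] unfolding inj_on_def by (cases "x i = 0") (auto simp: indicator_def)
  qed simp
  then show "emeasure (atomic x \<xi>) {\<xi> j} = ennreal (x j)" by (simp add: emeasure_atomic)
next
  assume s: "s \<notin> \<xi> ` {i. 0 < x i}"
  have "ennreal (x i) * indicator {s} (\<xi> i) = 0" for i
    using s nonneg[of i] by (cases "x i = 0") (auto simp: indicator_def)
  then have "(\<Sum>i. ennreal (x i) * indicator {s} (\<xi> i)) = (\<Sum>i::nat. 0)" by (rule suminf_cong)
  then show "emeasure (atomic x \<xi>) {s} = 0" by (simp add: emeasure_atomic)
qed

text \<open>The right side mentions only the measure, so two representations with distinct locations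
  have the same positive level counts. This makes the unique choice in \<open>J_map\<close> well
  defined.\<close>

lemma card_level_atomic:
  assumes nonneg: "\<And>i. 0 \<le> x i" and inj: "inj_on \<xi> {i. 0 < x i}" and t: "0 < t"
  shows "card {i. x i = t} = card {s. emeasure (atomic x \<xi>) {s} = ennreal t}"
proof -
  have "bij_betw \<xi> {i. x i = t} {s. emeasure (atomic x \<xi>) {s} = ennreal t}"
  proof (rule bij_betw_imageI)
    show "inj_on \<xi> {i. x i = t}" by (rule inj_on_subset[OF inj]) (use t in auto)
    show "\<xi> ` {i. x i = t} = {s. emeasure (atomic x \<xi>) {s} = ennreal t}"
    proof (intro equalityI subsetI)
      fix s assume "s \<in> {s. emeasure (atomic x \<xi>) {s} = ennreal t}"
      then have s: "emeasure (atomic x \<xi>) {s} = ennreal t" by simp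
      have "s \<in> \<xi> ` {i. 0 < x i}"
      proof (rule ccontr)
        assume "s \<notin> \<xi> ` {i. 0 < x i}"
        from emeasure_atomic_singleton(2)[OF nonneg inj this] s t show False by simp
      qed
      then obtain j where j: "0 < x j" "s = \<xi> j" by blast
      then have "x j = t" using emeasure_atomic_singleton(1)[OF nonneg inj j(1)] s t by simp
      then show "s \<in> \<xi> ` {i. x i = t}" using j by blast
    next
      fix s assume "s \<in> \<xi> ` {i. x i = t}"
      then obtain j where "x j = t" "s = \<xi> j" by blast
      then show "s \<in> {s. emeasure (atomic x \<xi>) {s} = ennreal t}"
        using emeasure_atomic_singleton(1)[OF nonneg inj, of j] t by simp
    qed
  qed
  then show ?thesis by (rule bij_betw_same_card)
qed

lemma J_map_atomic:
  assumes y: "\<And>i. 0 \<le> y i" "summable y" and inj: "inj_on \<xi> {i. 0 < y i}"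
  shows "J_map (atomic y \<xi>) = descending y"
  unfolding J_map_def
proof (rule the_equality)
  show "\<exists>y' \<xi>'. (\<forall>i. 0 \<le> y' i) \<and> summable y' \<and> inj_on \<xi>' {i. 0 < y' i} \<and>
      atomic y \<xi> = atomic y' \<xi>' \<and> descending y = descending y'"
    by (rule exI[of _ y], rule exI[of _ \<xi>]) (use assms in simp)
next
  fix x assume "\<exists>y' \<xi>'. (\<forall>i. 0 \<le> y' i) \<and> summable y' \<and> inj_on \<xi>' {i. 0 < y' i} \<and>
      atomic y \<xi> = atomic y' \<xi>' \<and> x = descending y'"
  then obtain y' \<xi>' where y': "\<forall>i. 0 \<le> y' i" "summable y'" "inj_on \<xi>' {i. 0 < y' i}"
    "atomic y \<xi> = atomic y' \<xi>'" "x = descending y'" by blast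
  have "descending y' = descending y"
  proof (rule R_down_levels_unique[OF descending_in_R_down descending_in_R_down])
    fix t :: real assume t: "0 < t"
    have nn: "0 \<le> y' i" for i using y'(1) by simp
    show "card {i. descending y' i = t} = card {i. descending y i = t}"
      using card_descending[OF y t] card_descending[OF nn y'(2) t]
        card_level_atomic[OF y(1) inj t] card_level_atomic[OF nn y'(3) t] y'(4) by simp
  qed
  then show "x = descending y" using y'(5) by simp
qed

text \<open>A finite measure has at most countably many atoms; enumerating them gives a
  representation in which each location is listed once, so coinciding locations of another
  representation are merged.\<close>

lemma ex_distinct_atomic:
  assumes \<mu>: "\<mu> \<in> fin_measures" and atoms: "emeasure \<mu> {s. emeasure \<mu> {s} \<noteq> 0} = emeasure \<mu> UNIV"
  obtains y \<xi> where "\<And>i. 0 \<le> y i" "summable y" "inj_on \<xi> {i. 0 < y i}" "\<mu> = atomic y \<xi>"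
proof -
  interpret finite_measure \<mu> using \<mu> by (simp add: fin_measures_def)
  have sets: "sets \<mu> = sets borel" and space: "space \<mu> = UNIV" using \<mu> by (simp_all add: fin_measures_def)
  define A where "A = {s. emeasure \<mu> {s} \<noteq> 0}"
  have "A = {s. measure \<mu> {s} \<noteq> 0}" unfolding A_def by (simp add: emeasure_eq_measure)
  then have A: "countable A" using countable_support by simp
  have sA: "B \<in> sets \<mu>" if "B \<subseteq> A" for B
    using A that sets by (intro sets.countable[OF _ countable_subset[OF that A]]) auto
  \<comment> \<open>If there are finitely many atoms, the surplus indices get mass 0. Their
    locations come from the default of \<open>from_nat_into\<close> and may repeat, which does no
    harm since injectivity concerns positive masses only.\<close>
  define y where "y i = (if i \<in> to_nat_on A ` A then measure \<mu> {from_nat_into A i} else 0)" for i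
  define \<xi> where "\<xi> i = from_nat_into A i" for i
  have inj: "inj_on (to_nat_on A) A" using A by (rule inj_on_to_nat_on)
  have y: "0 \<le> y i" for i by (simp add: y_def)
  have inj\<xi>: "inj_on \<xi> {i. 0 < y i}"
  proof (rule inj_onI)
    fix i j assume "i \<in> {i. 0 < y i}" "j \<in> {i. 0 < y i}" and eq: "\<xi> i = \<xi> j"
    then have "i \<in> to_nat_on A ` A" "j \<in> to_nat_on A ` A" by (auto simp: y_def split: if_splits)
    then show "i = j" using eq A by (auto simp: \<xi>_def)
  qed
  have rep: "(\<Sum>i. ennreal (y i) * u (\<xi> i)) = (\<integral>\<^sup>+s. emeasure \<mu> {s} * u s \<partial>count_space A)" for u
  proof -
    have "bij_betw (to_nat_on A) A (to_nat_on A ` A)" using inj by (rule inj_on_imp_bij_betw)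
    from nn_integral_bij_count_space[OF this, of "\<lambda>i. ennreal (y i) * u (\<xi> i)"]
    have "(\<integral>\<^sup>+i. ennreal (y i) * u (\<xi> i) \<partial>count_space (to_nat_on A ` A))
        = (\<integral>\<^sup>+s. ennreal (y (to_nat_on A s)) * u (\<xi> (to_nat_on A s)) \<partial>count_space A)" by simp
    also have "\<dots> = (\<integral>\<^sup>+s. emeasure \<mu> {s} * u s \<partial>count_space A)"
      by (rule nn_integral_cong) (use A in \<open>simp add: y_def \<xi>_def emeasure_eq_measure\<close>)
    also have "(\<integral>\<^sup>+i. ennreal (y i) * u (\<xi> i) \<partial>count_space (to_nat_on A ` A))
        = (\<integral>\<^sup>+i. ennreal (y i) * u (\<xi> i) * indicator (to_nat_on A ` A) i \<partial>count_space UNIV)"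
      by (rule nn_integral_count_space_indicator) simp
    also have "\<dots> = (\<integral>\<^sup>+i. ennreal (y i) * u (\<xi> i) \<partial>count_space UNIV)"
      by (rule nn_integral_cong) (simp add: y_def split: split_indicator)
    finally show ?thesis by (simp add: nn_integral_count_space_nat)
  qed
  have eq: "emeasure (atomic y \<xi>) B = emeasure \<mu> B" if B: "B \<in> sets borel" for B
  proof -
    have "emeasure (atomic y \<xi>) B = (\<integral>\<^sup>+s. emeasure \<mu> {s} * indicator B s \<partial>count_space A)"
      using B rep[of "indicator B"] by (simp add: emeasure_atomic)
    also have "\<dots> = (\<integral>\<^sup>+s. emeasure \<mu> {s} * indicator B s * indicator A s \<partial>count_space UNIV)"
      by (rule nn_integral_count_space_indicator) simp
    also have "\<dots> = (\<integral>\<^sup>+s. emeasure \<mu> {s} * indicator (A \<inter> B) s \<partial>count_space UNIV)"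
      by (rule nn_integral_cong) (simp split: split_indicator)
    also have "\<dots> = (\<integral>\<^sup>+s. emeasure \<mu> {s} \<partial>count_space (A \<inter> B))"
      by (rule nn_integral_count_space_indicator[symmetric]) simp
    also have "\<dots> = emeasure \<mu> (A \<inter> B)"
    proof (rule emeasure_countable_singleton[symmetric])
      show "{s} \<in> sets \<mu>" for s using sets by simp
      show "countable (A \<inter> B)" using A by (rule countable_subset[rotated]) simp
    qed
    also have "\<dots> = emeasure \<mu> B"
    proof -
      have "emeasure \<mu> (UNIV - A) = emeasure \<mu> UNIV - emeasure \<mu> A"
        using emeasure_compl[OF sA[of A]] space emeasure_finite by simp
      then have "emeasure \<mu> (UNIV - A) = 0" using atoms emeasure_finite by (simp add: A_def)
      then have null: "UNIV - A \<in> null_sets \<mu>" using sets.compl_sets[OF sA[of A]] space by auto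
      have "A \<inter> B = B - (UNIV - A)" by auto
      then show ?thesis using emeasure_Diff_null_set[OF null] B sets by simp
    qed
    finally show ?thesis .
  qed
  have "\<mu> = atomic y \<xi>" by (rule measure_eqI) (use sets eq in simp_all)
  moreover have "summable y"
  proof (rule summable_suminf_not_top[OF y])
    have "(\<Sum>i. ennreal (y i)) = emeasure \<mu> UNIV"
      using eq[of UNIV] by (simp add: emeasure_atomic)
    then show "(\<Sum>i. ennreal (y i)) \<noteq> top" using emeasure_finite[of UNIV] by simp
  qed
  ultimately show thesis using that y inj\<xi> by blast
qed

section \<open>The space of atomic measures and the map to masses\<close>

text \<open>The mass carried by points that are not atoms, written as an integral so that it is
  measurable in the measure.\<close>

abbreviation diffuse_mass :: "'a::metric_space measure \<Rightarrow> ennreal" where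
  "diffuse_mass \<mu> \<equiv> \<integral>\<^sup>+s. indicator {0} (emeasure \<mu> {s}) \<partial>\<mu>"

lemma measurable_atoms:
  fixes \<mu> :: "'a::metric_space measure"
  assumes cpt: "compact (UNIV :: 'a set)" and \<mu>: "\<mu> \<in> fin_measures"
  shows "(\<lambda>s. emeasure \<mu> {s}) \<in> borel_measurable borel"
proof -
  have "Pair \<mu> \<in> measurable borel (weak_borel \<Otimes>\<^sub>M (borel :: 'a measure))"
    by (rule measurable_Pair1') (simp only: space_weak_borel \<mu>)
  from measurable_compose[OF this measurable_atom_mass[OF cpt]] show ?thesis
    by (simp only: prod.case)
qed

lemma emeasure_atoms:
  fixes \<mu> :: "'a::metric_space measure"
  assumes cpt: "compact (UNIV :: 'a set)" and \<mu>: "\<mu> \<in> fin_measures"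
    and z: "diffuse_mass \<mu> = 0"
  shows "emeasure \<mu> {s. emeasure \<mu> {s} \<noteq> 0} = emeasure \<mu> UNIV"
proof -
  have sets [measurable_cong]: "sets \<mu> = sets borel" using \<mu> by (simp add: fin_measures_def)
  note measurable_atoms[OF cpt \<mu>, measurable]
  have "(\<lambda>s. indicator {0} (emeasure \<mu> {s}) :: ennreal) \<in> borel_measurable \<mu>" by measurable
  from nn_integral_0_iff_AE[THEN iffD1, OF this z]
  have AE: "AE s in \<mu>. emeasure \<mu> {s} \<noteq> 0" by eventually_elim (auto simp: indicator_def)
  have "{s \<in> space \<mu>. emeasure \<mu> {s} \<noteq> 0} \<in> sets \<mu>" by measurable
  then have "{s. emeasure \<mu> {s} \<noteq> 0} \<in> sets \<mu>" using \<mu> by simp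
  then show ?thesis using AE sets by (intro emeasure_eq_AE) auto
qed

text \<open>In a sum of point masses every location of positive weight is an atom, so nothing
  diffuse remains; conversely a measure carried by its atoms is the sum over them. The right side
  removes the existential over representations and is a measurable condition.\<close>

lemma M_a_iff:
  fixes \<mu> :: "'a::metric_space measure"
  assumes cpt: "compact (UNIV :: 'a set)"
  shows "\<mu> \<in> M_a \<longleftrightarrow> \<mu> \<in> fin_measures \<and> emeasure \<mu> UNIV \<noteq> 0 \<and>
    diffuse_mass \<mu> = 0" (is "_ \<longleftrightarrow> ?R")
proof -
  note measurable_atoms[OF cpt, measurable]
  show ?thesis
  proof
    assume "\<mu> \<in> M_a"
    then obtain x \<xi> where x: "\<And>i. 0 \<le> x i" "summable x" "0 < suminf x" and \<mu>: "\<mu> = atomic x \<xi>"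
      unfolding M_a_def by blast
    have fin: "\<mu> \<in> fin_measures" unfolding \<mu> by (rule atomic_in_fin_measures[OF x(1,2)])
    have "emeasure \<mu> UNIV = ennreal (suminf x)"
      unfolding \<mu> using suminf_ennreal2[OF x(1,2)] by (simp add: emeasure_atomic)
    then have "emeasure \<mu> UNIV \<noteq> 0" using x(3) by simp
    moreover have "diffuse_mass \<mu> = 0"
    proof -
      have "ennreal (x i) * indicator {0} (emeasure \<mu> {\<xi> i}) = 0" for i
      proof -
        have "(\<Sum>j\<in>{i}. ennreal (x j) * indicator {\<xi> i} (\<xi> j)) \<le> (\<Sum>j. ennreal (x j) * indicator {\<xi> i} (\<xi> j))"
          by (rule sum_le_suminf) auto
        then have "ennreal (x i) \<le> emeasure \<mu> {\<xi> i}" by (simp add: \<mu> emeasure_atomic)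
        then show ?thesis by (cases "x i = 0") (auto simp: indicator_def)
      qed
      then have "(\<Sum>i. ennreal (x i) * indicator {0} (emeasure \<mu> {\<xi> i})) = (\<Sum>i::nat. 0)"
        by (rule suminf_cong)
      moreover have "(\<integral>\<^sup>+s. indicator {0} (emeasure \<mu> {s}) \<partial>atomic x \<xi>)
          = (\<Sum>i. ennreal (x i) * indicator {0} (emeasure \<mu> {\<xi> i}))"
        using fin by (intro nn_integral_atomic) measurable
      ultimately have "(\<integral>\<^sup>+s. indicator {0} (emeasure \<mu> {s}) \<partial>atomic x \<xi>) = (\<Sum>i::nat. 0)"
        by (rule trans[rotated])
      then show ?thesis by (simp add: \<mu>[symmetric])
    qed
    ultimately show ?R using fin by blast
  next
    assume R: ?R
    then have fin: "\<mu> \<in> fin_measures" by simp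
    from R have "emeasure \<mu> {s. emeasure \<mu> {s} \<noteq> 0} = emeasure \<mu> UNIV"
      by (intro emeasure_atoms[OF cpt]) blast+
    from ex_distinct_atomic[OF fin this] obtain y \<xi> where
      y: "\<And>i. 0 \<le> y i" "summable y" and \<mu>: "\<mu> = atomic y \<xi>" by metis
    have "emeasure \<mu> UNIV = ennreal (suminf y)"
      unfolding \<mu> using suminf_ennreal2[OF y] by (simp add: emeasure_atomic)
    then have "0 < suminf y" using R suminf_nonneg[OF y(2,1)] by (cases "suminf y = 0") auto
    then show "\<mu> \<in> M_a" using y \<mu> unfolding M_a_def by blast
  qed
qed

lemma M_a_distinct:
  assumes cpt: "compact (UNIV :: 'a::metric_space set)" and "\<mu> \<in> (M_a :: 'a::metric_space measure set)"
  obtains y \<xi> where "\<And>i. 0 \<le> y i" "summable y" "inj_on \<xi> {i. 0 < y i}" "\<mu> = atomic y \<xi>"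
proof -
  have fin: "\<mu> \<in> fin_measures" and z: "diffuse_mass \<mu> = 0"
    using assms M_a_iff[OF cpt] by blast+
  from ex_distinct_atomic[OF fin emeasure_atoms[OF cpt fin z]] that show thesis by metis
qed

lemma sets_M_a:
  assumes cpt: "compact (UNIV :: 'a::metric_space set)"
  shows "(M_a :: 'a::metric_space measure set) \<in> sets weak_borel"
proof -
  have [measurable]: "(\<lambda>\<mu>. emeasure \<mu> UNIV) \<in> borel_measurable (weak_borel :: 'a measure measure)"
    by (rule measurable_weak_emeasure) simp
  note measurable_atom_mass[OF cpt, measurable]
  have [measurable]: "(\<lambda>\<mu>. \<integral>\<^sup>+s. indicator {0} (emeasure \<mu> {s}) \<partial>\<mu>) \<in> borel_measurable (weak_borel :: 'a measure measure)"
    by (rule measurable_weak_nn_integral) measurable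
  have "M_a = {\<mu> \<in> space (weak_borel :: 'a measure measure). emeasure \<mu> UNIV \<noteq> 0 \<and>
      diffuse_mass \<mu> = 0}"
    using M_a_iff[OF cpt] by (auto simp: set_eq_iff)
  also have "\<dots> \<in> sets weak_borel" by measurable
  finally show ?thesis .
qed

text \<open>The number of atoms of mass greater than $t$ is $\int 1_{\mu\{s\} > t}\, \mu\{s\}^{-1} \mu(ds)$,
  which is measurable in $\mu$.\<close>

lemma measurable_J_map:
  assumes cpt: "compact (UNIV :: 'a::metric_space set)"
  shows "J_map \<in> measurable (restrict_space (weak_borel :: 'a::metric_space measure measure) M_a) R_down_space"
proof -
  let ?W = "restrict_space (weak_borel :: 'a measure measure) M_a"
  define h where "h t \<mu> s = (if ennreal t < emeasure \<mu> {s} then 1 / emeasure \<mu> {s} else 0)"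
    for t :: real and \<mu> :: "'a measure" and s
  have h [measurable]: "(\<lambda>(\<mu>, s). h t \<mu> s) \<in> borel_measurable (weak_borel \<Otimes>\<^sub>M borel)" for t
    using measurable_atom_mass[OF cpt] unfolding h_def case_prod_beta by measurable
  have count: "(\<integral>\<^sup>+s. h t (atomic y \<xi>) s \<partial>atomic y \<xi>) = count_above t y"
    if t: "0 \<le> t" and y: "\<And>i. 0 \<le> y i" "summable y" and inj: "inj_on \<xi> {i. 0 < y i}"
    for t y and \<xi> :: "nat \<Rightarrow> 'a"
  proof -
    have "atomic y \<xi> \<in> fin_measures" by (rule atomic_in_fin_measures[OF y])
    then have "h t (atomic y \<xi>) \<in> borel_measurable borel"
      using measurable_compose[OF measurable_Pair1'[of "atomic y \<xi>" weak_borel] h[of t]] by simp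
    then have "(\<integral>\<^sup>+s. h t (atomic y \<xi>) s \<partial>atomic y \<xi>) = (\<Sum>i. ennreal (y i) * h t (atomic y \<xi>) (\<xi> i))"
      by (rule nn_integral_atomic)
    also have "\<dots> = count_above t y"
      unfolding count_above_def
    proof (rule suminf_cong)
      fix i
      show "ennreal (y i) * h t (atomic y \<xi>) (\<xi> i) = indicator {t<..} (y i)"
      proof (cases "0 < y i")
        case True
        have "ennreal (y i) * (1 / ennreal (y i)) = 1"
          using True by (simp add: ennreal_times_divide ennreal_divide_self)
        then show ?thesis using emeasure_atomic_singleton(1)[OF y(1) inj True] t
          by (simp add: h_def ennreal_less_iff split: split_indicator)
      next
        case False
        then have "y i = 0" using y(1)[of i] by simp
        then show ?thesis using t by simp
      qed
    qed
    finally show ?thesis .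
  qed
  have space: "space ?W \<subseteq> M_a" by (simp add: space_restrict_space)
  show ?thesis
  proof (rule measurable_to_R_downI)
    fix \<mu> assume "\<mu> \<in> space ?W"
    with space have "\<mu> \<in> M_a" by blast
    then obtain y \<xi> where "\<And>i. 0 \<le> y i" "summable y" "inj_on \<xi> {i. 0 < y i}" "\<mu> = atomic y \<xi>"
      using M_a_distinct[OF cpt] by metis
    then show "J_map \<mu> \<in> R_down" using J_map_atomic descending_in_R_down by metis
  next
    fix n
    show "(\<lambda>\<mu>. J_map \<mu> n) \<in> borel_measurable ?W"
      unfolding borel_measurable_iff_greater
    proof
      fix t
      have [measurable]: "(\<lambda>\<mu>. \<integral>\<^sup>+s. h t \<mu> s \<partial>\<mu>) \<in> borel_measurable ?W"
        by (intro measurable_restrict_space1 measurable_weak_nn_integral) measurable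
      have "{\<mu> \<in> space ?W. t < J_map \<mu> n} = {\<mu> \<in> space ?W. t < 0 \<or> of_nat n < (\<integral>\<^sup>+s. h t \<mu> s \<partial>\<mu>)}"
      proof (rule Collect_cong, rule conj_cong[OF refl])
        fix \<mu> assume "\<mu> \<in> space ?W"
        with space have "\<mu> \<in> M_a" by blast
        then obtain y \<xi> where y: "\<And>i. 0 \<le> y i" "summable y" and inj: "inj_on \<xi> {i. 0 < y i}" and \<mu>: "\<mu> = atomic y \<xi>"
          using M_a_distinct[OF cpt] by metis
        have J: "J_map \<mu> = descending y" unfolding \<mu> by (rule J_map_atomic[OF y inj])
        show "t < J_map \<mu> n \<longleftrightarrow> t < 0 \<or> of_nat n < (\<integral>\<^sup>+s. h t \<mu> s \<partial>\<mu>)"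
        proof (cases "t < 0")
          case True
          have "0 \<le> descending y n" using descending_in_R_down[of y] by (simp add: R_down_def)
          then show ?thesis using True J by simp
        next
          case False
          then show ?thesis
            using less_descending_iff[OF y, of t n] count[of t, OF _ y inj] J \<mu> by simp
        qed
      qed
      also have "\<dots> \<in> sets ?W" by measurable
      finally show "{\<mu> \<in> space ?W. t < J_map \<mu> n} \<in> sets ?W" .
    qed
  qed
qed

section \<open>Image laws under the map to masses\<close>

text \<open>A representation with distinct locations is required only almost surely. It also places
  \<open>X w\<close> in \<open>M_a\<close> almost surely, so restricting the law to
  \<open>M_a\<close> loses no mass.\<close>

lemma J_image_distr:
  fixes X :: "'w \<Rightarrow> 'a::metric_space measure"
  assumes cpt: "compact (UNIV :: 'a set)" and X [measurable]: "X \<in> measurable P weak_borel"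
    and Y: "\<And>n. (\<lambda>w. Y w n) \<in> borel_measurable P"
    and AE: "AE w in P. (\<forall>i. 0 \<le> Y w i) \<and> summable (Y w) \<and> 0 < suminf (Y w) \<and> inj_on (\<xi> w) {i. 0 < Y w i}
      \<and> X w = atomic (Y w) (\<xi> w)"
  shows "J_image (distr P weak_borel X) = distr P R_down_space (\<lambda>w. descending (Y w))"
proof (rule measure_eqI)
  show "sets (J_image (distr P weak_borel X)) = sets (distr P R_down_space (\<lambda>w. descending (Y w)))"
    by (simp add: J_image_def)
  fix A assume "A \<in> sets (J_image (distr P weak_borel X))"
  then have A [measurable]: "A \<in> sets R_down_space" by (simp add: J_image_def)
  note [measurable] = measurable_descending[OF Y] sets_M_a[OF cpt]
  let ?L = "distr P weak_borel X"
  have Ma: "M_a \<subseteq> (fin_measures :: 'a measure set)" using M_a_iff[OF cpt] by blast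
  have J: "J_map \<in> measurable (restrict_space ?L M_a) R_down_space"
    using measurable_J_map[OF cpt] by (simp cong: measurable_cong_sets add: sets_restrict_space)
  have sp: "space (restrict_space ?L M_a) = M_a" using Ma by (auto simp: space_restrict_space)
  let ?B = "J_map -` A \<inter> (M_a :: 'a measure set)"
  have "?B \<in> sets (restrict_space weak_borel M_a)"
    using measurable_sets[OF measurable_J_map[OF cpt] A] Ma
    by (simp add: space_restrict_space Int_absorb1 Int_absorb2)
  moreover have "M_a \<inter> space (weak_borel :: 'a measure measure) \<in> sets weak_borel"
    using sets_M_a[OF cpt] by blast
  ultimately have B [measurable]: "?B \<in> sets weak_borel"
    using sets_restrict_space_iff[of "M_a :: 'a measure set" weak_borel ?B] by blast
  have "emeasure (J_image ?L) A = emeasure (restrict_space ?L M_a) ?B"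
    unfolding J_image_def using emeasure_distr[OF J A] sp by simp
  also have "\<dots> = emeasure ?L ?B"
    by (rule emeasure_restrict_space) (simp_all add: Int_absorb2[OF Ma] sets_M_a[OF cpt])
  also have "\<dots> = emeasure P (X -` ?B \<inter> space P)" by (simp add: emeasure_distr)
  also have "\<dots> = emeasure P ((\<lambda>w. descending (Y w)) -` A \<inter> space P)"
  proof (rule emeasure_eq_AE)
    show "X -` ?B \<inter> space P \<in> sets P" by (rule measurable_sets[OF X B])
    show "(\<lambda>w. descending (Y w)) -` A \<inter> space P \<in> sets P" by (rule measurable_sets[OF measurable_descending[OF Y] A])
    show "AE w in P. w \<in> X -` ?B \<inter> space P \<longleftrightarrow> w \<in> (\<lambda>w. descending (Y w)) -` A \<inter> space P"
      using AE
    proof eventually_elim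
      case (elim w)
      have "X w \<in> M_a" using elim unfolding M_a_def by blast
      moreover have "J_map (X w) = descending (Y w)" using elim J_map_atomic by metis
      ultimately show ?case by simp
    qed
  qed
  also have "\<dots> = emeasure (distr P R_down_space (\<lambda>w. descending (Y w))) A" by (simp add: emeasure_distr)
  finally show "emeasure (J_image ?L) A = emeasure (distr P R_down_space (\<lambda>w. descending (Y w))) A" .
qed

lemma fin_or_zero_in_fin_measures: "sets (\<mu> :: 'a::metric_space measure) = sets borel \<Longrightarrow> fin_or_zero \<mu> \<in> fin_measures"
proof -
  have "finite_measure (null_measure (borel :: 'a measure))" by (rule finite_measureI) simp
  then show "sets \<mu> = sets borel \<Longrightarrow> fin_or_zero \<mu> \<in> fin_measures"
    by (simp add: fin_or_zero_def fin_measures_def)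
qed

lemma fin_or_zero_id: "\<mu> \<in> fin_measures \<Longrightarrow> fin_or_zero \<mu> = \<mu>"
  by (simp add: fin_or_zero_def fin_measures_def)

lemma measurable_fin_or_zero:
  fixes X :: "'w \<Rightarrow> 'a::metric_space measure"
  assumes cpt: "compact (UNIV :: 'a set)" and sets: "\<And>w. w \<in> space M \<Longrightarrow> sets (X w) = sets borel"
    and X: "\<And>A. A \<in> sets borel \<Longrightarrow> (\<lambda>w. emeasure (X w) A) \<in> borel_measurable M"
  shows "(\<lambda>w. fin_or_zero (X w)) \<in> measurable M weak_borel"
proof (rule measurable_weak_borelI[OF cpt])
  show "fin_or_zero (X w) \<in> fin_measures" if "w \<in> space M" for w
    by (rule fin_or_zero_in_fin_measures[OF sets[OF that]])
  fix A :: "'a set" assume A: "A \<in> sets borel"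
  have "emeasure (fin_or_zero (X w)) A = (if emeasure (X w) UNIV = top then 0 else emeasure (X w) A)"
    if "w \<in> space M" for w
  proof -
    have "space (X w) = UNIV" using sets_eq_imp_space_eq[OF sets[OF that]] by simp
    then have "finite_measure (X w) \<longleftrightarrow> emeasure (X w) UNIV \<noteq> top"
      using finite_measureI[of "X w"] finite_measure.emeasure_finite[of "X w" UNIV] by auto
    then show ?thesis by (simp add: fin_or_zero_def)
  qed
  moreover have "(\<lambda>w. if emeasure (X w) UNIV = top then 0 else emeasure (X w) A) \<in> borel_measurable M"
    using X[OF A] X[of UNIV] by measurable
  ultimately show "(\<lambda>w. emeasure (fin_or_zero (X w)) A) \<in> borel_measurable M"
    by (simp cong: measurable_cong)
qed

context gamma_tilted
begin

text \<open>Two independent marks have the product law, and the sections of the diagonal are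
  singletons, null for an atomless law. There are only countably many pairs of indices.\<close>

lemma AE_distinct_marks:
  assumes cpt: "compact (UNIV :: 'a set)" and atomless: "\<And>s. measure \<nu>\<^sub>0 {s} = 0"
  shows "AE w in P. inj (\<lambda>i. \<xi> i w)"
proof -
  have ne: "AE w in P. \<xi> i w \<noteq> \<xi> j w" if "i \<noteq> j" for i j
  proof -
    define \<Delta> where "\<Delta> = {(s, t). s = (t :: 'a)}"
    have \<Delta>: "\<Delta> \<in> sets (borel \<Otimes>\<^sub>M borel)" unfolding \<Delta>_def by (rule diagonal_measurable[OF cpt])
    then have [measurable]: "\<Delta> \<in> sets (\<nu>\<^sub>0 \<Otimes>\<^sub>M \<nu>\<^sub>0)"
      using sets_pair_measure_cong[OF nu(2) nu(2)] by simp
    have "P.indep_vars (\<lambda>_. borel) \<xi> UNIV" "distr P borel (\<xi> i) = \<nu>\<^sub>0" for i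
      using marks(1) by (simp_all add: iid_def)
    note ind = this
    have "P.indep_var (PiM {i} (\<lambda>_. borel)) (\<lambda>w. restrict (\<lambda>i. \<xi> i w) {i})
        (PiM {j} (\<lambda>_. borel)) (\<lambda>w. restrict (\<lambda>i. \<xi> i w) {j})"
      using that by (intro P.indep_var_restrict[OF ind(1)]) auto
    then have "P.indep_var borel ((\<lambda>x. x i) \<circ> (\<lambda>w. restrict (\<lambda>i. \<xi> i w) {i}))
        borel ((\<lambda>x. x j) \<circ> (\<lambda>w. restrict (\<lambda>i. \<xi> i w) {j}))"
      by (rule P.indep_var_compose) (rule measurable_component_singleton, simp)+
    then have "P.indep_var borel (\<xi> i) borel (\<xi> j)" by (simp add: comp_def)
    then have D: "distr P (borel \<Otimes>\<^sub>M borel) (\<lambda>w. (\<xi> i w, \<xi> j w)) = \<nu>\<^sub>0 \<Otimes>\<^sub>M \<nu>\<^sub>0"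
      unfolding P.indep_var_distribution_eq ind(2) by simp
    have "emeasure (\<nu>\<^sub>0 \<Otimes>\<^sub>M \<nu>\<^sub>0) \<Delta> = (\<integral>\<^sup>+s. emeasure \<nu>\<^sub>0 (Pair s -` \<Delta>) \<partial>\<nu>\<^sub>0)"
      by (rule nu.emeasure_pair_measure_alt) measurable
    also have "\<dots> = (\<integral>\<^sup>+s. 0 \<partial>\<nu>\<^sub>0)"
    proof (rule nn_integral_cong)
      fix s
      have "Pair s -` \<Delta> = {s}" by (auto simp: \<Delta>_def)
      then show "emeasure \<nu>\<^sub>0 (Pair s -` \<Delta>) = 0" using atomless[of s] by (simp add: nu.emeasure_eq_measure)
    qed
    finally have "emeasure (distr P (borel \<Otimes>\<^sub>M borel) (\<lambda>w. (\<xi> i w, \<xi> j w))) \<Delta> = 0" unfolding D by simp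
    then have "emeasure P ((\<lambda>w. (\<xi> i w, \<xi> j w)) -` \<Delta> \<inter> space P) = 0"
      using \<Delta> by (subst (asm) emeasure_distr) auto
    moreover have "(\<lambda>w. (\<xi> i w, \<xi> j w)) -` \<Delta> \<inter> space P \<in> sets P"
      using \<Delta> by (intro measurable_sets[of _ P "borel \<Otimes>\<^sub>M borel"]) measurable
    ultimately show ?thesis
      by (intro AE_I[of _ _ "(\<lambda>w. (\<xi> i w, \<xi> j w)) -` \<Delta> \<inter> space P"]) (auto simp: \<Delta>_def)
  qed
  have "AE w in P. \<forall>i j. i \<noteq> j \<longrightarrow> \<xi> i w \<noteq> \<xi> j w"
    unfolding AE_all_countable using ne by auto
  then show ?thesis by eventually_elim (auto simp: inj_on_def)
qed

abbreviation scaled_atoms :: "'w \<Rightarrow> 'a measure" where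
  "scaled_atoms w \<equiv> scale_measure (ennreal \<beta>) (atomic (\<lambda>i. \<gamma> i w) (\<lambda>i. \<xi> i w))"

abbreviation gamma_measure :: "'w \<Rightarrow> 'a measure" where
  "gamma_measure w \<equiv> fin_or_zero (scaled_atoms w)"

lemma measurable_gamma_measure:
  assumes cpt: "compact (UNIV :: 'a set)"
  shows "gamma_measure \<in> measurable P weak_borel"
proof (rule measurable_fin_or_zero[OF cpt])
  fix A :: "'a set" assume [measurable]: "A \<in> sets borel"
  have "(\<lambda>w. ennreal \<beta> * (\<Sum>i. ennreal (\<gamma> i w) * indicator A (\<xi> i w))) \<in> borel_measurable P" by measurable
  then show "(\<lambda>w. emeasure (scaled_atoms w) A) \<in> borel_measurable P"
    by (simp add: emeasure_atomic)
qed simp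

lemma measurable_T_map:
  assumes cpt: "compact (UNIV :: 'a set)"
  shows "T_map f \<in> measurable weak_borel weak_borel"
  unfolding T_map_def[abs_def]
proof (rule measurable_fin_or_zero[OF cpt])
  have sets: "sets \<mu> = sets borel" if "\<mu> \<in> space weak_borel" for \<mu> :: "'a measure"
    using that by (simp add: fin_measures_def)
  then show "sets (density \<mu> (\<lambda>s. ennreal (f s))) = sets borel" if "\<mu> \<in> space weak_borel" for \<mu> :: "'a measure"
    using that by simp
  fix A :: "'a set" assume [measurable]: "A \<in> sets borel"
  have "(\<lambda>\<mu>. \<integral>\<^sup>+s. ennreal (f s) * indicator A s \<partial>\<mu>) \<in> borel_measurable weak_borel"
    by (rule measurable_weak_nn_integral) measurable
  note meas = this
  have eq: "emeasure (density \<mu> (\<lambda>s. ennreal (f s))) A = (\<integral>\<^sup>+s. ennreal (f s) * indicator A s \<partial>\<mu>)"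
    if "\<mu> \<in> space weak_borel" for \<mu> :: "'a measure"
    using sets[OF that] by (intro emeasure_density) (simp_all cong: measurable_cong_sets)
  show "(\<lambda>\<mu>. emeasure (density \<mu> (\<lambda>s. ennreal (f s))) A) \<in> borel_measurable weak_borel"
    by (rule measurable_cong[THEN iffD2, OF eq meas])
qed

lemma gamma_measure_eq:
  assumes "\<And>i. 0 < \<gamma> i w" "summable (\<lambda>i. \<gamma> i w)"
  shows "gamma_measure w = atomic (\<lambda>i. \<beta> * \<gamma> i w) (\<lambda>i. \<xi> i w)"
proof -
  have "scaled_atoms w = atomic (\<lambda>i. \<beta> * \<gamma> i w) (\<lambda>i. \<xi> i w)"
  proof (rule measure_eqI)
    fix A assume "A \<in> sets (scaled_atoms w)"
    then have "A \<in> sets borel" by simp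
    then show "emeasure (scaled_atoms w) A
        = emeasure (atomic (\<lambda>i. \<beta> * \<gamma> i w) (\<lambda>i. \<xi> i w)) A"
      using assms \<beta> by (simp add: emeasure_atomic ennreal_suminf_cmult[symmetric] ennreal_mult less_imp_le mult.assoc
          del: ennreal_suminf_cmult)
  qed simp
  moreover have "atomic (\<lambda>i. \<beta> * \<gamma> i w) (\<lambda>i. \<xi> i w) \<in> fin_measures"
    using assms \<beta> by (intro atomic_in_fin_measures summable_mult) (simp_all add: less_imp_le)
  ultimately show ?thesis by (simp add: fin_or_zero_id)
qed

lemma T_map_atomic:
  assumes "\<And>i. 0 \<le> y i" "summable (\<lambda>i. f (z i) * y i)"
  shows "T_map f (atomic y z) = atomic (\<lambda>i. f (z i) * y i) z"
proof -
  have "density (atomic y z) (\<lambda>s. ennreal (f s)) = atomic (\<lambda>i. f (z i) * y i) z"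
  proof (rule measure_eqI)
    fix A assume "A \<in> sets (density (atomic y z) (\<lambda>s. ennreal (f s)))"
    then have [measurable]: "A \<in> sets borel" by simp
    have "emeasure (density (atomic y z) (\<lambda>s. ennreal (f s))) A = (\<integral>\<^sup>+s. ennreal (f s) * indicator A s \<partial>atomic y z)"
      by (rule emeasure_density) (simp_all cong: measurable_cong_sets)
    also have "\<dots> = (\<Sum>i. ennreal (y i) * (ennreal (f (z i)) * indicator A (z i)))"
      by (rule nn_integral_atomic) measurable
    also have "\<dots> = emeasure (atomic (\<lambda>i. f (z i) * y i) z) A"
      using assms f_pos by (simp add: emeasure_atomic ennreal_mult less_imp_le mult_ac)
    finally show "emeasure (density (atomic y z) (\<lambda>s. ennreal (f s))) A = emeasure (atomic (\<lambda>i. f (z i) * y i) z) A" .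
  qed simp
  moreover have "atomic (\<lambda>i. f (z i) * y i) z \<in> fin_measures"
    using assms f_pos by (intro atomic_in_fin_measures) (simp_all add: less_imp_le)
  ultimately show ?thesis by (simp add: T_map_def fin_or_zero_id)
qed

lemma J_image_gamma_law:
  assumes cpt: "compact (UNIV :: 'a set)" and atomless: "\<And>s. measure \<nu>\<^sub>0 {s} = 0"
  shows "J_image (gamma_law P \<beta> \<gamma> \<xi>) = labelled_law P \<beta> \<gamma>"
  unfolding gamma_law_def labelled_law_def
proof (rule J_image_distr[OF cpt measurable_gamma_measure[OF cpt], where Y = "\<lambda>w i. \<beta> * \<gamma> i w" and \<xi> = "\<lambda>w i. \<xi> i w"])
  show "(\<lambda>w. \<beta> * \<gamma> n w) \<in> borel_measurable P" for n by measurable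
  show "AE w in P. (\<forall>i. 0 \<le> \<beta> * \<gamma> i w) \<and> summable (\<lambda>i. \<beta> * \<gamma> i w) \<and> 0 < (\<Sum>i. \<beta> * \<gamma> i w) \<and>
      inj_on (\<lambda>i. \<xi> i w) {i. 0 < \<beta> * \<gamma> i w} \<and> gamma_measure w = atomic (\<lambda>i. \<beta> * \<gamma> i w) (\<lambda>i. \<xi> i w)"
    using AE_gamma_points AE_summable_points AE_distinct_marks[OF cpt atomless]
  proof eventually_elim
    case (elim w)
    then have pos: "\<And>i. 0 < \<gamma> i w" by simp
    have sum: "summable (\<lambda>i. \<beta> * \<gamma> i w)" using elim(2) by (rule summable_mult)
    have pos': "0 < \<beta> * \<gamma> i w" for i using pos \<beta> by simp
    have "inj_on (\<lambda>i. \<xi> i w) {i. 0 < \<beta> * \<gamma> i w}" by (rule inj_on_subset[OF elim(3)]) simp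
    then show ?case
      by (intro conjI allI less_imp_le[OF pos'] sum suminf_pos[OF sum pos'] gamma_measure_eq[OF pos elim(2)])
  qed
qed

text \<open>\<open>T_map\<close> multiplies each mass by \<open>f\<close> at its location and leaves
  the locations in place, so the almost sure distinctness of the marks serves the transformed
  measure as well.\<close>

lemma J_image_T_gamma_law:
  assumes cpt: "compact (UNIV :: 'a set)" and atomless: "\<And>s. measure \<nu>\<^sub>0 {s} = 0"
  shows "J_image (distr (gamma_law P \<beta> \<gamma> \<xi>) weak_borel (T_map f)) = labelled_T_law P f \<beta> \<gamma> \<xi>"
proof -
  have comp: "distr (gamma_law P \<beta> \<gamma> \<xi>) weak_borel (T_map f) = distr P weak_borel (T_map f \<circ> gamma_measure)"
    unfolding gamma_law_def by (rule distr_distr[OF measurable_T_map[OF cpt] measurable_gamma_measure[OF cpt]])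
  show ?thesis
    unfolding comp labelled_T_law_def
  proof (rule J_image_distr[OF cpt, where Y = "\<lambda>w i. f (\<xi> i w) * (\<beta> * \<gamma> i w)" and \<xi> = "\<lambda>w i. \<xi> i w"])
    show "T_map f \<circ> gamma_measure \<in> measurable P weak_borel"
      by (rule measurable_comp[OF measurable_gamma_measure[OF cpt] measurable_T_map[OF cpt]])
    show "(\<lambda>w. f (\<xi> n w) * (\<beta> * \<gamma> n w)) \<in> borel_measurable P" for n by measurable
    show "AE w in P. (\<forall>i. 0 \<le> f (\<xi> i w) * (\<beta> * \<gamma> i w)) \<and> summable (\<lambda>i. f (\<xi> i w) * (\<beta> * \<gamma> i w)) \<and>
        0 < (\<Sum>i. f (\<xi> i w) * (\<beta> * \<gamma> i w)) \<and> inj_on (\<lambda>i. \<xi> i w) {i. 0 < f (\<xi> i w) * (\<beta> * \<gamma> i w)} \<and>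
        (T_map f \<circ> gamma_measure) w = atomic (\<lambda>i. f (\<xi> i w) * (\<beta> * \<gamma> i w)) (\<lambda>i. \<xi> i w)"
      using AE_gamma_points AE_summable_points AE_summable_marked AE_distinct_marks[OF cpt atomless]
    proof eventually_elim
      case (elim w)
      then have pos: "\<And>i. 0 < \<gamma> i w" by simp
      have "summable (\<lambda>i. \<beta> * (f (\<xi> i w) * \<gamma> i w))" using elim by (intro summable_mult)
      then have sum: "summable (\<lambda>i. f (\<xi> i w) * (\<beta> * \<gamma> i w))" by (simp add: mult.left_commute)
      have pos': "0 < f (\<xi> i w) * (\<beta> * \<gamma> i w)" for i using pos \<beta> f_pos by simp
      have "0 \<le> \<beta> * \<gamma> i w" for i using pos \<beta> by (simp add: less_imp_le)
      from T_map_atomic[of "\<lambda>i. \<beta> * \<gamma> i w", OF this sum]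
      have T: "T_map f (gamma_measure w) = atomic (\<lambda>i. f (\<xi> i w) * (\<beta> * \<gamma> i w)) (\<lambda>i. \<xi> i w)"
        unfolding gamma_measure_eq[OF pos elim(2)] .
      have "inj_on (\<lambda>i. \<xi> i w) {i. 0 < f (\<xi> i w) * (\<beta> * \<gamma> i w)}"
        by (rule inj_on_subset[OF elim(4)]) simp
      moreover have "0 < (\<Sum>i. f (\<xi> i w) * (\<beta> * \<gamma> i w))" by (rule suminf_pos[OF sum pos'])
      ultimately show ?case using sum T by (intro conjI allI less_imp_le[OF pos']) (simp_all only: comp_def)
    qed
  qed
qed

lemma labelled_laws:
  "absolutely_continuous (labelled_law P \<beta> \<gamma>) (labelled_T_law P f \<beta> \<gamma> \<xi>)"
  "absolutely_continuous (labelled_T_law P f \<beta> \<gamma> \<xi>) (labelled_law P \<beta> \<gamma>)"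
  "AE x in labelled_law P \<beta> \<gamma>. RN_deriv (labelled_law P \<beta> \<gamma>) (labelled_T_law P f \<beta> \<gamma> \<xi>) x
    = ennreal (gamma_density \<theta> \<beta> \<nu>\<^sub>0 f x)"
proof -
  let ?M = "labelled_law P \<beta> \<gamma>" and ?g = "\<lambda>x. ennreal (gamma_density \<theta> \<beta> \<nu>\<^sub>0 f x)"
  have sets [measurable_cong]: "sets ?M = sets R_down_space" by (simp add: labelled_law_def)
  have space: "space ?M = R_down" using sets_eq_imp_space_eq[OF sets] by simp
  have "(\<lambda>w. descending (\<lambda>i. \<beta> * \<gamma> i w)) \<in> measurable P R_down_space"
    by (intro measurable_descending) measurable
  then interpret M: prob_space ?M unfolding labelled_law_def by (rule P.prob_space_distr)
  have g: "?g \<in> borel_measurable ?M" by measurable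
  show "absolutely_continuous ?M (labelled_T_law P f \<beta> \<gamma> \<xi>)"
    unfolding labelled_T_law_eq_density by (rule absolutely_continuousI_density[OF g])
  show "absolutely_continuous (labelled_T_law P f \<beta> \<gamma> \<xi>) ?M"
    unfolding labelled_T_law_eq_density absolutely_continuous_def
  proof
    fix A assume "A \<in> null_sets (density ?M ?g)"
    then have A: "A \<in> sets ?M" "AE x in ?M. x \<in> A \<longrightarrow> ?g x = 0" by (simp_all add: null_sets_density_iff[OF g])
    \<comment> \<open>The density vanishes almost everywhere on a null set of the transformed law,
      but it is positive on all of \<open>R_down\<close>.\<close>
    have "AE x in ?M. x \<notin> A"
      using A(2) AE_space
    proof eventually_elim
      case (elim x)
      then show ?case using gamma_density_pos[of x] space by (auto simp: ennreal_eq_0_iff)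
    qed
    then show "A \<in> null_sets ?M" using A(1) by (simp add: AE_iff_null_sets)
  qed
  show "AE x in ?M. RN_deriv ?M (labelled_T_law P f \<beta> \<gamma> \<xi>) x = ?g x"
    using M.RN_deriv_unique[OF g labelled_T_law_eq_density[symmetric]] by eventually_elim simp
qed

end

theorem theorem4p1:
  fixes \<nu>\<^sub>0 :: "'a::metric_space measure" and \<theta> \<beta> :: real and f :: "'a \<Rightarrow> real"
    and P :: "'w measure" and \<gamma> :: "nat \<Rightarrow> 'w \<Rightarrow> real" and \<xi> :: "nat \<Rightarrow> 'w \<Rightarrow> 'a"
    and \<Gamma> :: "'a measure measure"
  assumes "compact (UNIV :: 'a set)"
    and "prob_space \<nu>\<^sub>0" and "sets \<nu>\<^sub>0 = sets borel"
    and "\<theta> > 0" and "\<beta> > 0"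
    and "gamma_setup P \<theta> \<nu>\<^sub>0 \<gamma> \<xi>"
    and "\<Gamma> = gamma_law P \<beta> \<gamma> \<xi>"
    and "f \<in> B_plus" and "integrable \<nu>\<^sub>0 (\<lambda>s. ln (f s))"
  shows "((\<forall>s. measure \<nu>\<^sub>0 {s} = 0) \<longrightarrow>
            absolutely_continuous (J_image \<Gamma>) (J_image (distr \<Gamma> weak_borel (T_map f))) \<and>
            absolutely_continuous (J_image (distr \<Gamma> weak_borel (T_map f))) (J_image \<Gamma>) \<and>
            (AE x in J_image \<Gamma>.
               RN_deriv (J_image \<Gamma>) (J_image (distr \<Gamma> weak_borel (T_map f))) x
                 = ennreal (gamma_density \<theta> \<beta> \<nu>\<^sub>0 f x))) \<and>
         absolutely_continuous (labelled_law P \<beta> \<gamma>) (labelled_T_law P f \<beta> \<gamma> \<xi>) \<and>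
         absolutely_continuous (labelled_T_law P f \<beta> \<gamma> \<xi>) (labelled_law P \<beta> \<gamma>) \<and>
         (AE x in labelled_law P \<beta> \<gamma>.
            RN_deriv (labelled_law P \<beta> \<gamma>) (labelled_T_law P f \<beta> \<gamma> \<xi>) x
              = ennreal (gamma_density \<theta> \<beta> \<nu>\<^sub>0 f x))"
proof -
  interpret gamma_tilted P \<theta> \<beta> \<nu>\<^sub>0 \<gamma> \<xi> f
    by (intro gamma_tilted.intro gamma_marked.intro gamma_tilted_axioms.intro assms)
  show ?thesis
    unfolding assms(7)
  proof (intro conjI impI labelled_laws)
    assume "\<forall>s. measure \<nu>\<^sub>0 {s} = 0"
    then have atomless: "measure \<nu>\<^sub>0 {s} = 0" for s by blast
    \<comment> \<open>With almost surely distinct locations both image laws are the labelled ones,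
      so the claims about \<open>J_map\<close> are the labelled claims rewritten.\<close>
    note J = J_image_gamma_law[OF assms(1) atomless] J_image_T_gamma_law[OF assms(1) atomless]
    show "absolutely_continuous (J_image (gamma_law P \<beta> \<gamma> \<xi>))
        (J_image (distr (gamma_law P \<beta> \<gamma> \<xi>) weak_borel (T_map f)))"
      unfolding J by (rule labelled_laws)
    show "absolutely_continuous (J_image (distr (gamma_law P \<beta> \<gamma> \<xi>) weak_borel (T_map f)))
        (J_image (gamma_law P \<beta> \<gamma> \<xi>))"
      unfolding J by (rule labelled_laws)
    show "AE x in J_image (gamma_law P \<beta> \<gamma> \<xi>). RN_deriv (J_image (gamma_law P \<beta> \<gamma> \<xi>))
        (J_image (distr (gamma_law P \<beta> \<gamma> \<xi>) weak_borel (T_map f))) x = ennreal (gamma_density \<theta> \<beta> \<nu>\<^sub>0 f x)"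
      unfolding J by (rule labelled_laws)
  qed
qed

end
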